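(* Let $Q\cong\mathbb{Z}^d$, let $Z$ be a free abelian group of finite rank, and let $\{V_n\}_{n\in Z}$ be a numerically constructible family of $Q$-graded $\Bbbk$-vector spaces. (1) The set $T=\{n\in Z\mid \ell(V_n)<\infty\}$ is semisimple, and the function $\ell_V:T\to\mathbb{N}$, $\ell_V(n)=\ell(V_n)$, is piecewise quasipolynomial of degree at most $d$. (2) For any linear function $\lambda:Q\to\mathbb{Z}$, the sets $\mathrm{Top}_\lambda V=\{n\in Z\mid V_n\neq 0 \text{ and } \sup\{\langle\lambda,q\rangle\mid V_{nq}\neq 0\}<\infty\}$ and $\mathrm{soc}_\lambda V=\{n\in Z\mid V_n\neq 0\text{ and }\inf\{\langle\lambda,q\rangle\mid V_{nq}\neq0\}>-\infty\}$ are semisimple, and the functions $\max_{\lambda,V}:\mathrm{Top}_\lambda V\to\mathbb{Z}$, $n\mapsto\max_{V_{nq}\neq0}\langle\lambda,q\rangle$, and $\min_{\lambda,V}:\mathrm{soc}_\lambda V\to\mathbb{Z}$, $n\mapsto\min_{V_{nq}\neq0}\langle\lambda,q\rangle$, are piecewise quasilinear.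
   Context: $\Bbbk$ is a field. A subset $S$ of a finitely generated free abelian group is simple if $S=q+N$ with $N$ the submonoid generated by a (possibly empty) linearly independent set; it is semisimple if it is a finite disjoint union of simple subsets (equivalently, Presburger definable after choosing coordinates). A family $\{V_n\}_{n\in Z}$ with each $V_n=\bigoplus_{q\in Q}V_{nq}$ a $Q$-graded $\Bbbk$-vector space is numerically constructible if $\dim_\Bbbk V_{nq}<\infty$ for all $(n,q)\in Z\times Q$ and $Z\times Q$ can be partitioned into finitely many semisimple subsets on each of which $(n,q)\mapsto\dim_\Bbbk V_{nq}$ is constant. The length of a graded vector space $V=\bigoplus_q V_q$ is $\ell(V)=\sum_q\dim_\Bbbk V_q$. A function $P:Z\to\mathbb{Q}$ on a free abelian group $Z$ of rank $k$ is a quasipolynomial if there are a rank-$k$ sublattice $\Lambda\subseteq Z$ and polynomials $P_{\bar m}\in\mathbb{Q}[x_1,\dots,x_k]$, one for each coset $\bar m\in Z/\Lambda$, with $P(n)=P_{\bar m}(n)$ for $n\in\bar m$. For $T\subseteq Z$, a function $g:T\to\mathbb{Q}$ is piecewise quasipolynomial if there are a finite set $A$, rational convex polyhedra $\Gamma_\alpha$ ($\alpha\in A$) with $Z=\bigcup_\alpha(\Gamma_\alpha\cap Z)$, and quasipolynomials $Q_\alpha$ with $g(n)=Q_\alpha(n)$ for all $n\in\Gamma_\alpha\cap T$; it has degree at most $d$ if all polynomials involved have degree at most $d$, and it is piecewise quasilinear if all these polynomials are linear (degree at most 1). *)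

theory Defs
  imports Complex_Main
begin

definition lattice :: "nat \<Rightarrow> int list set" where
  "lattice k = {x. length x = k}"

definition vadd :: "int list \<Rightarrow> int list \<Rightarrow> int list" where
  "vadd x y = map2 (+) x y"

definition lincomb :: "nat \<Rightarrow> int list \<Rightarrow> int list list \<Rightarrow> int list" where
  "lincomb k cs vs = map (\<lambda>j. \<Sum>i<length vs. cs ! i * (vs ! i ! j)) [0..<k]"

definition lin_indep :: "nat \<Rightarrow> int list list \<Rightarrow> bool" where
  "lin_indep k vs \<longleftrightarrow> (\<forall>v\<in>set vs. length v = k) \<and>
     (\<forall>cs. length cs = length vs \<longrightarrow> lincomb k cs vs = replicate k 0 \<longrightarrow> (\<forall>c\<in>set cs. c = 0))"

definition simple_set :: "nat \<Rightarrow> int list set \<Rightarrow> bool" where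
  "simple_set k S \<longleftrightarrow> (\<exists>q vs. length q = k \<and> lin_indep k vs \<and>
     S = {vadd q (lincomb k cs vs) | cs. length cs = length vs \<and> (\<forall>c\<in>set cs. c \<ge> 0)})"

definition semisimple :: "nat \<Rightarrow> int list set \<Rightarrow> bool" where
  "semisimple k S \<longleftrightarrow> (\<exists>Ss :: int list set list. (\<forall>A\<in>set Ss. simple_set k A) \<and>
     (\<forall>i<length Ss. \<forall>j<length Ss. i \<noteq> j \<longrightarrow> Ss ! i \<inter> Ss ! j = {}) \<and> S = \<Union>(set Ss))"

text \<open>A family V_n (n in Z = Z^k) of Q-graded vector spaces (Q = Z^d) is given by its graded
  pieces V n q, subspaces of an ambient vector space over the field 'k (with scalar
  multiplication scale); V_n is the (external) direct sum of the V n q.\<close>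

definition graded_family :: "('k::field \<Rightarrow> 'v::ab_group_add \<Rightarrow> 'v) \<Rightarrow> nat \<Rightarrow> nat
    \<Rightarrow> (int list \<Rightarrow> int list \<Rightarrow> 'v set) \<Rightarrow> bool" where
  "graded_family scale k d V \<longleftrightarrow> vector_space scale \<and>
     (\<forall>n q. length n = k \<longrightarrow> length q = d \<longrightarrow> module.subspace scale (V n q))"

definition numerically_constructible :: "('k::field \<Rightarrow> 'v::ab_group_add \<Rightarrow> 'v) \<Rightarrow> nat \<Rightarrow> nat
    \<Rightarrow> (int list \<Rightarrow> int list \<Rightarrow> 'v set) \<Rightarrow> bool" where
  "numerically_constructible scale k d V \<longleftrightarrow>
     (\<forall>n q. length n = k \<longrightarrow> length q = d \<longrightarrow>
        (\<exists>B. finite B \<and> module.span scale B = V n q)) \<and>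
     (\<exists>Ps :: int list set list.
        (\<forall>P\<in>set Ps. semisimple (k + d) P) \<and>
        (\<forall>i<length Ps. \<forall>j<length Ps. i \<noteq> j \<longrightarrow> Ps ! i \<inter> Ps ! j = {}) \<and>
        \<Union>(set Ps) = lattice (k + d) \<and>
        (\<forall>P\<in>set Ps. \<forall>n q n' q'. length n = k \<longrightarrow> length q = d \<longrightarrow> length n' = k \<longrightarrow> length q' = d
            \<longrightarrow> n @ q \<in> P \<longrightarrow> n' @ q' \<in> P
            \<longrightarrow> vector_space.dim scale (V n q) = vector_space.dim scale (V n' q')))"

definition supp :: "nat \<Rightarrow> (int list \<Rightarrow> int list \<Rightarrow> 'v::zero set) \<Rightarrow> int list \<Rightarrow> int list set" where
  "supp d V n = {q. length q = d \<and> V n q \<noteq> {0}}"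

text \<open>Length l(V_n) = sum of dim V_{nq}; it is finite iff only finitely many V_{nq} are nonzero.\<close>
definition finite_length_set :: "nat \<Rightarrow> nat \<Rightarrow> (int list \<Rightarrow> int list \<Rightarrow> 'v::zero set) \<Rightarrow> int list set" where
  "finite_length_set k d V = {n. length n = k \<and> finite (supp d V n)}"

definition glength :: "('k::field \<Rightarrow> 'v::ab_group_add \<Rightarrow> 'v) \<Rightarrow> nat
    \<Rightarrow> (int list \<Rightarrow> int list \<Rightarrow> 'v set) \<Rightarrow> int list \<Rightarrow> nat" where
  "glength scale d V n = (\<Sum>q\<in>supp d V n. vector_space.dim scale (V n q))"

definition pairing :: "int list \<Rightarrow> int list \<Rightarrow> int" where
  "pairing lam q = (\<Sum>i<length q. lam ! i * q ! i)"

definition Top :: "nat \<Rightarrow> nat \<Rightarrow> int list \<Rightarrow> (int list \<Rightarrow> int list \<Rightarrow> 'v::zero set) \<Rightarrow> int list set" where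
  "Top k d lam V = {n. length n = k \<and> supp d V n \<noteq> {} \<and> bdd_above (pairing lam ` supp d V n)}"

definition soc :: "nat \<Rightarrow> nat \<Rightarrow> int list \<Rightarrow> (int list \<Rightarrow> int list \<Rightarrow> 'v::zero set) \<Rightarrow> int list set" where
  "soc k d lam V = {n. length n = k \<and> supp d V n \<noteq> {} \<and> bdd_below (pairing lam ` supp d V n)}"

definition max_fun :: "nat \<Rightarrow> int list \<Rightarrow> (int list \<Rightarrow> int list \<Rightarrow> 'v::zero set) \<Rightarrow> int list \<Rightarrow> int" where
  "max_fun d lam V n = Sup (pairing lam ` supp d V n)"

definition min_fun :: "nat \<Rightarrow> int list \<Rightarrow> (int list \<Rightarrow> int list \<Rightarrow> 'v::zero set) \<Rightarrow> int list \<Rightarrow> int" where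
  "min_fun d lam V n = Inf (pairing lam ` supp d V n)"

definition poly_deg_le :: "nat \<Rightarrow> nat \<Rightarrow> (int list \<Rightarrow> rat) \<Rightarrow> bool" where
  "poly_deg_le k D p \<longleftrightarrow> (\<exists>c :: nat list \<Rightarrow> rat. \<forall>x. length x = k \<longrightarrow>
     p x = (\<Sum>e\<in>{e. length e = k \<and> sum_list e \<le> D}. c e * (\<Prod>i<k. (of_int (x ! i)) ^ (e ! i))))"

text \<open>Quasipolynomial on Z^k whose constituent polynomials have degree at most D:
  a rank-k sublattice Lambda (spanned by k linearly independent vectors bs) and one
  polynomial per coset of Lambda.\<close>
definition quasipoly_deg_le :: "nat \<Rightarrow> nat \<Rightarrow> (int list \<Rightarrow> rat) \<Rightarrow> bool" where
  "quasipoly_deg_le k D f \<longleftrightarrow> (\<exists>bs Pf. length bs = k \<and> lin_indep k bs \<and>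
     (\<forall>m. poly_deg_le k D (Pf m)) \<and>
     (\<forall>m cs. length m = k \<longrightarrow> length cs = k \<longrightarrow> Pf (vadd m (lincomb k cs bs)) = Pf m) \<and>
     (\<forall>n. length n = k \<longrightarrow> f n = Pf n n))"

definition polyhedron_pts :: "nat \<Rightarrow> (rat list \<times> rat) list \<Rightarrow> int list set" where
  "polyhedron_pts k H = {n. length n = k \<and>
     (\<forall>(a, b)\<in>set H. (\<Sum>i<k. a ! i * of_int (n ! i)) \<le> b)}"

definition piecewise_qp_deg_le :: "nat \<Rightarrow> nat \<Rightarrow> int list set \<Rightarrow> (int list \<Rightarrow> rat) \<Rightarrow> bool" where
  "piecewise_qp_deg_le k D T g \<longleftrightarrow>
     (\<exists>pieces :: ((rat list \<times> rat) list \<times> (int list \<Rightarrow> rat)) list.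
        (\<forall>(H, P)\<in>set pieces. (\<forall>(a, b)\<in>set H. length a = k) \<and> quasipoly_deg_le k D P) \<and>
        lattice k = (\<Union>(H, P)\<in>set pieces. polyhedron_pts k H) \<and>
        (\<forall>(H, P)\<in>set pieces. \<forall>n\<in>T \<inter> polyhedron_pts k H. g n = P n))"

abbreviation piecewise_quasilinear :: "nat \<Rightarrow> int list set \<Rightarrow> (int list \<Rightarrow> rat) \<Rightarrow> bool" where
  "piecewise_quasilinear k T g \<equiv> piecewise_qp_deg_le k 1 T g"

end

theory Submission
  imports Defs "HOL-Library.Disjoint_Sets"
begin

text \<open>
  Semisimple sets are exactly the Presburger sets, i.e. the sets whose membership relation depends
  only on finitely many affine inequalities and on the coordinates modulo some \<open>M\<close>. Presburger sets
  are closed under projection by Cooper's quantifier elimination, which also shows that a function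
  with Presburger graph is affine on each class of points satisfying the same inequalities with the
  same residues. This gives the statements about \<open>max\<close> and \<open>min\<close>. For the length, the variables in
  \<open>Q\<close> are summed out one at a time: over a class, each fibre is an arithmetic progression whose
  endpoints are affine on classes, so summing a polynomial over it yields a difference of values of
  an antidifference, which raises the degree by one.

  Conversely, a simple set is cut by a half-space into simple sets by rescaling the generators until
  the linear form takes only the values \<open>-w\<close>, \<open>0\<close>, \<open>w\<close> on them, and then comparing the coordinates of
  generators with opposite signs.

  Points of \<open>\<int>\<^sup>n\<close> are treated as functions \<open>nat \<Rightarrow> int\<close> of which only the coordinates in a finite set
  \<open>V\<close> matter, so that a variable can be eliminated without renumbering the others.
\<close>

section \<open>Presburger sets\<close>

text \<open>Semisimple sets ask for pieces that are disjoint and have independent generators, so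
  every step on simple sets must be a partition that preserves independence. Comparing the
  coordinates of two generators replaces one of them by their sum. This is progress only if the
  linear form vanishes on the sum, and the rescaling to a common absolute value \<open>w\<close>
  guarantees exactly that. A single analysis of one-dimensional fibres serves twice: nonemptiness of
  a fibre depends only on the class of the base point, and the point of a one-point fibre is given
  by a formula of degree one. Its slopes are rational, because it has the shape (threshold + shift)
  / \<open>c\<close>. The degree bound \<open>d\<close> arises because dimensions are constant on
  classes, hence of degree 0, and \<open>d\<close> variables are summed out. Finiteness of the
  length is not a first-order condition as it stands; it is replaced by the existence of a bound on
  the coordinates of the support.\<close>

definition lin :: "nat set \<Rightarrow> (nat \<Rightarrow> int) \<Rightarrow> (nat \<Rightarrow> int) \<Rightarrow> int" where
  "lin V a x = (\<Sum>i\<in>V. a i * x i)"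

text \<open>A class consists of the integer points that lie in a region cut out by the half-spaces
  in \<open>L\<close> and their complements, and in one coset of M Z^V. This is the kind of piece on
  which a piecewise quasipolynomial function is a single polynomial.\<close>

definition eqv :: "nat set \<Rightarrow> ((nat \<Rightarrow> int) \<times> int) set \<Rightarrow> int \<Rightarrow> (nat \<Rightarrow> int) \<Rightarrow> (nat \<Rightarrow> int) \<Rightarrow> bool" where
  "eqv V L M x y \<longleftrightarrow> (\<forall>(a, b)\<in>L. lin V a x \<le> b \<longleftrightarrow> lin V a y \<le> b) \<and> (\<forall>i\<in>V. M dvd x i - y i)"

text \<open>Invariance takes the place of formulas: \<open>S\<close> is a union of classes of some
  \<open>eqv\<close>. Boolean operations then only need a common refinement. Such a set is a
  cylinder: coordinates outside \<open>V\<close> do not matter.\<close>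

definition presb :: "nat set \<Rightarrow> (nat \<Rightarrow> int) set \<Rightarrow> bool" where
  "presb V S \<longleftrightarrow> (\<exists>L M. finite L \<and> M > 0 \<and> (\<forall>x y. eqv V L M x y \<longrightarrow> (x \<in> S \<longleftrightarrow> y \<in> S)))"

definition aff :: "nat set \<Rightarrow> ((nat \<Rightarrow> int) \<Rightarrow> int) \<Rightarrow> bool" where
  "aff V f \<longleftrightarrow> (\<exists>a b. \<forall>x. f x = lin V a x + b)"

lemma eqv_refl [simp]: "eqv V L M x x"
  by (auto simp: eqv_def)

lemma eqv_sym: "eqv V L M x y \<Longrightarrow> eqv V L M y x"
  by (auto simp: eqv_def dvd_diff_commute)

lemma eqv_trans: "eqv V L M x y \<Longrightarrow> eqv V L M y z \<Longrightarrow> eqv V L M x z"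
  unfolding eqv_def using dvd_add[of M "x i - y i" "y i - z i" for i] by force

lemma eqv_mono: "eqv V L' M' x y \<Longrightarrow> L \<subseteq> L' \<Longrightarrow> M dvd M' \<Longrightarrow> eqv V L M x y"
  unfolding eqv_def by (blast intro: dvd_trans)

lemma lin_cong: "(\<And>i. i \<in> V \<Longrightarrow> x i = y i) \<Longrightarrow> lin V a x = lin V a y"
  by (simp add: lin_def)

lemma lin_insert: "finite V \<Longrightarrow> n \<notin> V \<Longrightarrow> lin (insert n V) a (x(n := y)) = a n * y + lin V a x"
  by (auto simp: lin_def intro!: sum.cong)

lemma lin_dvd_diff: "(\<And>i. i \<in> V \<Longrightarrow> M dvd x i - y i) \<Longrightarrow> M dvd lin V a x - lin V a y"
  by (auto simp: lin_def sum_subtractf[symmetric] right_diff_distrib[symmetric] intro!: dvd_sum)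

lemma aff_lin: "aff V (lin V a)"
  unfolding aff_def by (metis add.right_neutral)

lemma aff_const: "aff V (\<lambda>x. c)"
  unfolding aff_def by (rule exI[of _ "\<lambda>_. 0"]) (auto simp: lin_def)

lemma aff_var: "finite V \<Longrightarrow> i \<in> V \<Longrightarrow> aff V (\<lambda>x. x i)"
  unfolding aff_def lin_def
  by (rule exI[of _ "\<lambda>j. if j = i then 1 else 0"], rule exI[of _ 0]) (auto simp: if_distrib if_distribR sum.delta cong: if_cong)

lemma aff_add: "aff V f \<Longrightarrow> aff V g \<Longrightarrow> aff V (\<lambda>x. f x + g x)"
  unfolding aff_def
proof (elim exE)
  fix a b a' b' assume "\<forall>x. f x = lin V a x + b" "\<forall>x. g x = lin V a' x + b'"
  then show "\<exists>a b. \<forall>x. f x + g x = lin V a x + b"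
    by (intro exI[of _ "\<lambda>i. a i + a' i"] exI[of _ "b + b'"]) (auto simp: lin_def algebra_simps sum.distrib)
qed

lemma aff_scale: "aff V f \<Longrightarrow> aff V (\<lambda>x. c * f x)"
  unfolding aff_def
proof (elim exE)
  fix a b assume "\<forall>x. f x = lin V a x + b"
  then show "\<exists>a b. \<forall>x. c * f x = lin V a x + b"
    by (intro exI[of _ "\<lambda>i. c * a i"] exI[of _ "c * b"]) (auto simp: lin_def algebra_simps sum_distrib_left)
qed

lemma aff_diff: "aff V f \<Longrightarrow> aff V g \<Longrightarrow> aff V (\<lambda>x. f x - g x)"
  using aff_add[of V f "\<lambda>x. (-1) * g x"] aff_scale[of V g "-1"] by simp

lemma aff_sum: "(\<And>i. i \<in> I \<Longrightarrow> aff V (f i)) \<Longrightarrow> aff V (\<lambda>x. \<Sum>i\<in>I. f i x)"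
proof (induction I rule: infinite_finite_induct)
  case (insert i I)
  then show ?case using aff_add[of V "f i" "\<lambda>x. \<Sum>i\<in>I. f i x"] by simp
qed (simp_all add: aff_const)

text \<open>Enlarging \<open>L\<close> and multiplying moduli refines the relation, so finitely many
  sets share one pair. Through \<open>L0\<close> and \<open>M0\<close> the caller prescribes
  inequalities and a divisor that the refinement must include.\<close>

lemma presb_common:
  assumes "finite \<S>" "\<And>S. S \<in> \<S> \<Longrightarrow> presb V S" "finite L0" "M0 > 0"
  obtains L M where "finite L" "M > 0" "L0 \<subseteq> L" "M0 dvd M"
    "\<And>S x y. S \<in> \<S> \<Longrightarrow> eqv V L M x y \<Longrightarrow> x \<in> S \<longleftrightarrow> y \<in> S"
proof -
  have "\<exists>L M. finite L \<and> M > 0 \<and> L0 \<subseteq> L \<and> M0 dvd M \<and> (\<forall>S\<in>\<S>. \<forall>x y. eqv V L M x y \<longrightarrow> (x \<in> S \<longleftrightarrow> y \<in> S))"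
    using assms(1,2)
  proof (induction \<S>)
    case empty
    then show ?case using assms(3,4) by (intro exI[of _ L0] exI[of _ M0]) auto
  next
    case (insert T \<S>)
    then obtain L M where LM: "finite L" "M > 0" "L0 \<subseteq> L" "M0 dvd M"
      "\<forall>S\<in>\<S>. \<forall>x y. eqv V L M x y \<longrightarrow> (x \<in> S \<longleftrightarrow> y \<in> S)" by auto
    have "presb V T" using insert by auto
    then obtain L' M' where LM': "finite L'" "M' > 0" "\<forall>x y. eqv V L' M' x y \<longrightarrow> (x \<in> T \<longleftrightarrow> y \<in> T)"
      unfolding presb_def by blast
    have "eqv V L M x y \<and> eqv V L' M' x y" if "eqv V (L \<union> L') (M * M') x y" for x y
      using that by (auto elim: eqv_mono)
    moreover have "L0 \<subseteq> L \<union> L'" "finite (L \<union> L')" "M * M' > 0" "M0 dvd M * M'"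
      using LM LM' by auto
    ultimately show ?case using LM(5) LM'(3)
      by (intro exI[of _ "L \<union> L'"] exI[of _ "M * M'"]) (metis insert_iff)
  qed
  then show ?thesis using that by blast
qed

lemma presb_mono: assumes "presb V S" "V \<subseteq> W" "finite W" shows "presb W S"
proof -
  obtain L M where LM: "finite L" "M > 0" "\<forall>x y. eqv V L M x y \<longrightarrow> (x \<in> S \<longleftrightarrow> y \<in> S)"
    using assms(1) unfolding presb_def by blast
  define t where "t = (\<lambda>(a::nat\<Rightarrow>int, b::int). ((\<lambda>i. if i \<in> V then a i else 0), b))"
  have *: "lin W (\<lambda>i. if i \<in> V then a i else 0) x = lin V a x" for a x
    unfolding lin_def using assms(2,3) by (intro sum.mono_neutral_cong_right) auto
  have "eqv V L M x y" if "eqv W (t ` L) M x y" for x y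
    unfolding eqv_def
  proof (intro conjI ballI)
    fix ab assume "ab \<in> L"
    then have "lin W (fst (t ab)) x \<le> snd (t ab) \<longleftrightarrow> lin W (fst (t ab)) y \<le> snd (t ab)"
      using that unfolding eqv_def by (auto simp: case_prod_beta)
    then show "case ab of (a, b) \<Rightarrow> lin V a x \<le> b \<longleftrightarrow> lin V a y \<le> b"
      by (simp add: t_def case_prod_beta *)
  qed (use that assms(2) in \<open>auto simp: eqv_def\<close>)
  then show ?thesis unfolding presb_def using LM by (intro exI[of _ "t ` L"] exI[of _ M]) auto
qed

lemma presb_determined: assumes "presb V S" "\<And>i. i \<in> V \<Longrightarrow> x i = y i" shows "x \<in> S \<longleftrightarrow> y \<in> S"
proof -
  have "eqv V L M x y" for L M
    using assms(2) lin_cong[of V x y] by (auto simp: eqv_def)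
  then show ?thesis using assms(1) unfolding presb_def by blast
qed

text \<open>Covers all connectives at once: \<open>P\<close> only has to depend on the truth values
  of membership in \<open>S\<close> and in \<open>T\<close>.\<close>

lemma presb_comb2:
  assumes "presb V S" "presb V T" "\<And>x y. (x \<in> S \<longleftrightarrow> y \<in> S) \<Longrightarrow> (x \<in> T \<longleftrightarrow> y \<in> T) \<Longrightarrow> P x \<longleftrightarrow> P y"
  shows "presb V {x. P x}"
proof -
  have pr: "presb V U" if "U \<in> {S, T}" for U using that assms(1,2) by blast
  obtain L M where LM: "finite L" "M > 0"
    "\<And>U x y. U \<in> {S, T} \<Longrightarrow> eqv V L M x y \<Longrightarrow> x \<in> U \<longleftrightarrow> y \<in> U"
    by (rule presb_common[OF _ pr, of "{S, T}" "{}" 1]) auto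
  have "P x \<longleftrightarrow> P y" if "eqv V L M x y" for x y
    by (intro assms(3) LM(3) that) simp_all
  then show ?thesis unfolding presb_def using LM(1,2)
    by (intro exI[of _ L] exI[of _ M]) simp
qed

lemma presb_not: "presb V {x. P x} \<Longrightarrow> presb V {x. \<not> P x}"
  by (rule presb_comb2[of V "{x. P x}" "{x. P x}"]) auto

lemma presb_conj: "presb V {x. P x} \<Longrightarrow> presb V {x. Q x} \<Longrightarrow> presb V {x. P x \<and> Q x}"
  by (rule presb_comb2[of V "{x. P x}" "{x. Q x}"]) auto

lemma presb_disj: "presb V {x. P x} \<Longrightarrow> presb V {x. Q x} \<Longrightarrow> presb V {x. P x \<or> Q x}"
  by (rule presb_comb2[of V "{x. P x}" "{x. Q x}"]) auto

lemma presb_imp: "presb V {x. P x} \<Longrightarrow> presb V {x. Q x} \<Longrightarrow> presb V {x. P x \<longrightarrow> Q x}"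
  by (rule presb_comb2[of V "{x. P x}" "{x. Q x}"]) auto

lemma presb_triv: "presb V {x. P}"
  unfolding presb_def by (rule exI[of _ "{}"], rule exI[of _ 1]) auto

lemma presb_ball: "finite I \<Longrightarrow> (\<And>i. i \<in> I \<Longrightarrow> presb V {x. P i x}) \<Longrightarrow> presb V {x. \<forall>i\<in>I. P i x}"
proof (induction I rule: finite_induct)
  case (insert i I)
  then show ?case using presb_conj[of V "P i" "\<lambda>x. \<forall>i\<in>I. P i x"] by simp
qed (use presb_triv[of V True] in simp)

lemma presb_bex: "finite I \<Longrightarrow> (\<And>i. i \<in> I \<Longrightarrow> presb V {x. P i x}) \<Longrightarrow> presb V {x. \<exists>i\<in>I. P i x}"
proof (induction I rule: finite_induct)
  case (insert i I)
  then show ?case using presb_disj[of V "P i" "\<lambda>x. \<exists>i\<in>I. P i x"] by simp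
qed (use presb_triv[of V False] in simp)

lemma presb_le: assumes "aff V f" "aff V g" shows "presb V {x. f x \<le> g x}"
proof -
  obtain a b where ab: "\<forall>x. f x - g x = lin V a x + b"
    using aff_diff[OF assms] unfolding aff_def by blast
  have "f x \<le> g x \<longleftrightarrow> lin V a x \<le> - b" for x
    using ab[rule_format, of x] by linarith
  then show ?thesis unfolding presb_def
    by (intro exI[of _ "{(a, -b)}"] exI[of _ 1]) (auto simp: eqv_def)
qed

lemma presb_eq: assumes "aff V f" "aff V g" shows "presb V {x. f x = g x}"
proof -
  have "{x. f x = g x} = {x. f x \<le> g x \<and> g x \<le> f x}" by auto
  then show ?thesis using presb_conj[OF presb_le[OF assms] presb_le[OF assms(2,1)]] by simp
qed

section \<open>Polynomial functions\<close>

text \<open>\<open>D\<close> is an upper bound for the total degree. Generation by constants, sums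
  and multiplication by a variable gives induction along the construction. Values are rational
  because antidifferences and solutions of linear conditions have denominators.\<close>

inductive pol :: "nat set \<Rightarrow> nat \<Rightarrow> ((nat \<Rightarrow> int) \<Rightarrow> rat) \<Rightarrow> bool" for V where
  pol_const: "pol V D (\<lambda>x. c)"
| pol_add: "pol V D p \<Longrightarrow> pol V D q \<Longrightarrow> pol V D (\<lambda>x. p x + q x)"
| pol_var_mult: "pol V D p \<Longrightarrow> i \<in> V \<Longrightarrow> pol V (Suc D) (\<lambda>x. of_int (x i) * p x)"
| pol_Suc: "pol V D p \<Longrightarrow> pol V (Suc D) p"

lemma pol_mono: assumes "pol V D p" "D \<le> E" shows "pol V E p"
  using assms(2,1) by (induction E rule: dec_induct) (simp_all add: pol_Suc)

lemma pol_mono_vars: "pol V D p \<Longrightarrow> V \<subseteq> W \<Longrightarrow> pol W D p"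
proof (induction rule: pol.induct)
  case (pol_add D p q)
  then show ?case using pol.pol_add by simp
next
  case (pol_var_mult D p i)
  then show ?case using pol.pol_var_mult[of W D p i] by auto
qed (simp_all add: pol.pol_const pol.pol_Suc)

lemma pol_determined: "pol V D p \<Longrightarrow> (\<And>i. i \<in> V \<Longrightarrow> x i = y i) \<Longrightarrow> p x = p y"
  by (induction rule: pol.induct) auto

lemma pol_scale: "pol V D p \<Longrightarrow> pol V D (\<lambda>x. c * p x)"
proof (induction rule: pol.induct)
  case (pol_var_mult D p i)
  then show ?case using pol.pol_var_mult[of V D "\<lambda>x. c * p x" i] by (simp add: mult.left_commute)
next
  case (pol_add D p q)
  then show ?case using pol.pol_add[of V D "\<lambda>x. c * p x" "\<lambda>x. c * q x"] by (simp add: distrib_left)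
qed (simp_all add: pol.pol_const pol.pol_Suc)

lemma pol_mult: "pol V D p \<Longrightarrow> pol V E q \<Longrightarrow> pol V (D + E) (\<lambda>x. p x * q x)"
proof (induction rule: pol.induct)
  case (pol_const D c)
  then show ?case using pol_scale[OF pol_mono[of V E q "D + E"], of c] by simp
next
  case (pol_var_mult D p i)
  then show ?case using pol.pol_var_mult[of V "D + E" "\<lambda>x. p x * q x" i] by (simp add: mult.assoc)
next
  case (pol_add D p q')
  then show ?case using pol.pol_add[of V "D + E" "\<lambda>x. p x * q x" "\<lambda>x. q' x * q x"] by (simp add: distrib_right)
qed (simp_all add: pol.pol_Suc)

lemma pol_sum: "(\<And>i. i \<in> I \<Longrightarrow> pol V D (f i)) \<Longrightarrow> pol V D (\<lambda>x. \<Sum>i\<in>I. f i x)"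
proof (induction I rule: infinite_finite_induct)
  case (insert i I)
  then show ?case using pol_add[of V D "f i" "\<lambda>x. \<Sum>i\<in>I. f i x"] by simp
qed (simp_all add: pol_const)

lemma pol_diff: "pol V D p \<Longrightarrow> pol V D q \<Longrightarrow> pol V D (\<lambda>x. p x - q x)"
  using pol_add[of V D p "\<lambda>x. (-1) * q x"] pol_scale[of V D q "-1"] by simp

lemma pol_var: "i \<in> V \<Longrightarrow> pol V 1 (\<lambda>x. of_int (x i))"
  using pol_var_mult[OF pol_const[of V 0 1]] by simp

lemma pol_power: "pol V D p \<Longrightarrow> pol V (e * D) (\<lambda>x. p x ^ e)"
proof (induction e)
  case (Suc e)
  then show ?case using pol_mult[of V D p "e * D" "\<lambda>x. p x ^ e"] by simp
qed (simp add: pol_const)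

lemma pol_aff: assumes "aff V f" shows "pol V 1 (\<lambda>x. of_int (f x))"
proof -
  obtain a b where ab: "\<And>x. f x = lin V a x + b" using assms unfolding aff_def by blast
  have "pol V 1 (\<lambda>x. (\<Sum>i\<in>V. of_int (a i) * of_int (x i)) + of_int b)"
    by (rule pol_add[OF pol_sum pol_const], rule pol_scale, rule pol_var)
  then show ?thesis by (simp add: ab lin_def)
qed

text \<open>As \<open>h\<close> has degree at most one, substitution keeps the degree bound. The
  identity is claimed only where \<open>h x\<close> is an integer, since \<open>h\<close> may have
  denominators while \<open>y\<close> is integral.\<close>

lemma pol_subst:
  assumes "pol (insert n V) D p" "pol V 1 h"
  obtains p' where "pol V D p'" "\<And>x y. of_int y = h x \<Longrightarrow> p (x(n := y)) = p' x"
proof -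
  have "\<exists>p'. pol V D p' \<and> (\<forall>x y. of_int y = h x \<longrightarrow> p (x(n := y)) = p' x)"
    using assms(1)
  proof (induction rule: pol.induct)
    case (pol_const D c)
    show ?case by (rule exI[of _ "\<lambda>x. c"]) (simp add: pol.intros(1))
  next
    case (pol_add D p q)
    then obtain p' q' where "pol V D p' \<and> (\<forall>x y. of_int y = h x \<longrightarrow> p (x(n := y)) = p' x)"
      "pol V D q' \<and> (\<forall>x y. of_int y = h x \<longrightarrow> q (x(n := y)) = q' x)" by blast
    then show ?case using pol.pol_add[of V D p' q']
      by (intro exI[of _ "\<lambda>x. p' x + q' x"]) (simp del: fun_upd_apply)
  next
    case (pol_var_mult D p i)
    then obtain p' where p': "pol V D p'" "\<forall>x y. of_int y = h x \<longrightarrow> p (x(n := y)) = p' x"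
      by blast
    show ?case
    proof (cases "i = n")
      case True
      then show ?thesis using p'(2) pol_mult[OF assms(2) p'(1)]
        by (intro exI[of _ "\<lambda>x. h x * p' x"]) (simp add: fun_upd_same del: fun_upd_apply)
    next
      case False
      then show ?thesis using p' pol_var_mult(2) pol.pol_var_mult[of V D p' i]
        by (intro exI[of _ "\<lambda>x. of_int (x i) * p' x"]) (simp add: fun_upd_other del: fun_upd_apply)
    qed
  next
    case (pol_Suc D p)
    then show ?case using pol.pol_Suc by blast
  qed
  then show ?thesis using that by blast
qed

section \<open>Quantifier elimination\<close>

text \<open>Cooper's trick: scaling the eliminated variable by \<open>c\<close> gives it the coefficients
  \<open>\<plusminus>c\<close> only, so it is compared with integral affine thresholds.\<close>
lemma thresholds:
  assumes "finite V" "n \<notin> V" "finite L" "M > 0"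
  obtains c :: int and \<Theta> where "c > 0" "finite \<Theta>" "\<And>\<theta>. \<theta> \<in> \<Theta> \<Longrightarrow> aff V \<theta>"
    "\<And>x x' y y'. eqv V {(a, b)\<in>L. a n = 0} M x x' \<Longrightarrow> \<forall>\<theta>\<in>\<Theta>. c * y \<le> \<theta> x \<longleftrightarrow> c * y' \<le> \<theta> x' \<Longrightarrow>
       M dvd y - y' \<Longrightarrow> eqv (insert n V) L M (x(n := y)) (x'(n := y'))"
proof -
  define L1 where "L1 = {(a, b)\<in>L. a n \<noteq> 0}"
  have fin: "finite L1" unfolding L1_def using assms(3) by (rule rev_finite_subset) auto
  \<comment> \<open>A common multiple of the absolute values of all coefficients of the eliminated
    variable.\<close>
  define c where "c = (\<Prod>(a, b)\<in>L1. \<bar>a n\<bar>)"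
  have c: "c > 0" unfolding c_def L1_def by (intro prod_pos) auto
  have dv: "\<bar>a n\<bar> dvd c" if "(a, b) \<in> L1" for a b
    unfolding c_def using dvd_prodI[OF fin that, of "\<lambda>(a, b). \<bar>a n\<bar>"] by simp
  \<comment> \<open>For a negative coefficient the inequality is a lower bound for
    \<open>c * y\<close>. Over the integers this is the negation of the upper bound by one less,
    whence the \<open>- 1\<close> here and the equivalence with \<open>a n > 0\<close>
    below.\<close>
  define t where "t = (\<lambda>(a::nat\<Rightarrow>int, b) x. if a n > 0 then (c div \<bar>a n\<bar>) * (b - lin V a x)
    else (c div \<bar>a n\<bar>) * (lin V a x - b) - 1)"
  have t: "lin (insert n V) a (x(n := y)) \<le> b \<longleftrightarrow> (a n > 0 \<longleftrightarrow> c * y \<le> t (a, b) x)"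
    if ab: "(a, b) \<in> L1" for a b x y
  proof -
    obtain e where e: "c = \<bar>a n\<bar> * e" using dv[OF ab] by blast
    have nz: "a n \<noteq> 0" using ab by (auto simp: L1_def)
    have epos: "e > 0" using c e nz by (metis zero_less_abs_iff zero_less_mult_pos)
    have ce: "c div \<bar>a n\<bar> = e" using e nz by simp
    have 1: "lin (insert n V) a (x(n := y)) \<le> b \<longleftrightarrow> e * (a n * y + lin V a x) \<le> e * b"
      using epos assms(1,2) by (simp add: lin_insert)
    show ?thesis
    proof (cases "a n > 0")
      case True
      then have "e * (a n * y + lin V a x) = c * y + e * lin V a x" using e by (simp add: algebra_simps)
      then show ?thesis unfolding 1 t_def using True ce by (simp add: right_diff_distrib) linarith
    next
      case False
      then have "e * (a n * y + lin V a x) = e * lin V a x - c * y" using e nz by (simp add: algebra_simps)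
      then show ?thesis unfolding 1 t_def using False ce by (simp add: right_diff_distrib) linarith
    qed
  qed
  show ?thesis
  proof (rule that[OF c, of "t ` L1"])
    show "finite (t ` L1)" using fin by simp
  next
    fix \<theta> assume "\<theta> \<in> t ` L1"
    then obtain a b where \<theta>: "\<theta> = t (a, b)" by auto
    have "aff V (\<lambda>x. (c div \<bar>a n\<bar>) * (b - lin V a x))"
      "aff V (\<lambda>x. (c div \<bar>a n\<bar>) * (lin V a x - b) - 1)"
      by (rule aff_scale[OF aff_diff[OF aff_const aff_lin]]
        aff_diff[OF aff_scale[OF aff_diff[OF aff_lin aff_const]] aff_const])+
    then show "aff V \<theta>" unfolding \<theta> t_def by (cases "a n > 0") simp_all
  next
    fix x x' :: "nat \<Rightarrow> int" and y y'
    assume E: "eqv V {(a, b)\<in>L. a n = 0} M x x'" and C: "\<forall>\<theta>\<in>t ` L1. c * y \<le> \<theta> x \<longleftrightarrow> c * y' \<le> \<theta> x'"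
      and D: "M dvd y - y'"
    have "lin (insert n V) a (x(n := y)) \<le> b \<longleftrightarrow> lin (insert n V) a (x'(n := y')) \<le> b" if ab: "(a, b) \<in> L" for a b
    proof (cases "a n = 0")
      case True
      then show ?thesis using E ab assms(1,2) by (auto simp: eqv_def lin_insert)
    next
      case False
      then have "(a, b) \<in> L1" using ab by (auto simp: L1_def)
      then show ?thesis using C by (simp add: t)
    qed
    moreover have "M dvd (x(n := y)) i - (x'(n := y')) i" if "i \<in> insert n V" for i
      using that D E assms(2) by (auto simp: eqv_def)
    ultimately show "eqv (insert n V) L M (x(n := y)) (x'(n := y'))"
      unfolding eqv_def by blast
  qed
qed

text \<open>A point of a fibre can be lowered in steps of \<open>M\<close> until it lies just above the largest threshold
  below it, where it is an affine function of \<open>x\<close>. Without such a threshold it can be lowered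
  indefinitely.\<close>
lemma fibre_witness:
  assumes "finite V" "n \<notin> V" "presb (insert n V) S"
  obtains L M where "finite L" "M > 0"
    "\<And>x y. x(n := y) \<in> S \<Longrightarrow>
      ((\<exists>y'. y' \<noteq> y \<and> x(n := y') \<in> S) \<and> (\<forall>x'. eqv V L M x x' \<longrightarrow> (\<exists>y'. x'(n := y') \<in> S))) \<or>
      (\<exists>h. pol V 1 h \<and> (\<forall>x'. eqv V L M x x' \<longrightarrow> (\<exists>y'. of_int y' = h x' \<and> x'(n := y') \<in> S)))"
proof -
  obtain L0 M0 where LM0: "finite L0" "M0 > 0"
    "\<And>x y. eqv (insert n V) L0 M0 x y \<Longrightarrow> (x \<in> S \<longleftrightarrow> y \<in> S)"
    using assms(3) unfolding presb_def by blast
  obtain c :: int and \<Theta> where c: "c > 0" and \<Theta>: "finite \<Theta>" "\<And>\<theta>. \<theta> \<in> \<Theta> \<Longrightarrow> aff V \<theta>"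
    and key: "\<And>x x' y y'. eqv V {(a, b)\<in>L0. a n = 0} M0 x x' \<Longrightarrow> \<forall>\<theta>\<in>\<Theta>. c * y \<le> \<theta> x \<longleftrightarrow> c * y' \<le> \<theta> x' \<Longrightarrow>
       M0 dvd y - y' \<Longrightarrow> eqv (insert n V) L0 M0 (x(n := y)) (x'(n := y'))"
    by (rule thresholds[OF assms(1,2) LM0(1,2)]) (rule that, assumption+)
  \<comment> \<open>These sets record how each threshold, shifted by at most one period
    \<open>c * M0\<close>, compares with the others. The witness will sit at such a shifted
    threshold, so its position among all thresholds becomes a property of the class of
    \<open>x\<close>.\<close>
  define T where "T = (\<lambda>(\<theta>, \<theta>', s). {x. \<theta> x + s \<le> \<theta>' x}) ` (\<Theta> \<times> \<Theta> \<times> {1..c * M0})"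
  have T: "finite T" "\<And>S. S \<in> T \<Longrightarrow> presb V S"
    unfolding T_def using \<Theta>(1) presb_le[OF aff_add[OF \<Theta>(2) aff_const] \<Theta>(2)] by auto
  have fin: "finite {(a, b)\<in>L0. a n = 0}" using LM0(1) by (rule rev_finite_subset) auto
  \<comment> \<open>The requirement \<open>c * M0 dvd M\<close> makes each threshold constant modulo
    \<open>c * M0\<close> on a class, so that one shift serves all its points.\<close>
  obtain L M where LM: "finite L" "M > 0" "{(a, b)\<in>L0. a n = 0} \<subseteq> L" "c * M0 dvd M"
    "\<And>S x y. S \<in> T \<Longrightarrow> eqv V L M x y \<Longrightarrow> x \<in> S \<longleftrightarrow> y \<in> S"
    by (rule presb_common[OF T fin mult_pos_pos[OF c LM0(2)]]) (assumption, rule that, assumption+)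
  have M0M: "M0 dvd M" using LM(4) by (rule dvd_mult_right)
  show ?thesis
  proof (rule that[OF LM(1,2)])
    fix x y assume xy: "x(n := y) \<in> S"
    show "((\<exists>y'. y' \<noteq> y \<and> x(n := y') \<in> S) \<and> (\<forall>x'. eqv V L M x x' \<longrightarrow> (\<exists>y'. x'(n := y') \<in> S))) \<or>
      (\<exists>h. pol V 1 h \<and> (\<forall>x'. eqv V L M x x' \<longrightarrow> (\<exists>y'. of_int y' = h x' \<and> x'(n := y') \<in> S)))"
    proof (cases "\<forall>\<theta>\<in>\<Theta>. c * y \<le> \<theta> x")
      \<comment> \<open>No threshold lies below \<open>c * y\<close>. Hence over any equivalent base
        point every sufficiently small value of the right residue satisfies the same
        comparisons.\<close>
      case True
      have low: "\<exists>y'. y' < y \<and> x'(n := y') \<in> S" if E: "eqv V L M x x'" for x'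
      proof -
        \<comment> \<open>Large enough for \<open>y - M0 * B\<close> to be negative and below every
          threshold at \<open>x'\<close>; being negative, it only decreases when multiplied by
          \<open>c\<close>.\<close>
        define B where "B = (\<Sum>\<theta>\<in>\<Theta>. \<bar>\<theta> x'\<bar>) + \<bar>y\<bar> + 1"
        define y' where "y' = y - M0 * B"
        have B: "\<bar>\<theta> x'\<bar> \<le> B - 1 - \<bar>y\<bar>" if "\<theta> \<in> \<Theta>" for \<theta>
          unfolding B_def using member_le_sum[OF that, of "\<lambda>\<theta>. \<bar>\<theta> x'\<bar>"] \<Theta>(1) by simp
        have Bpos: "B > 0" unfolding B_def by (simp add: add_nonneg_pos sum_nonneg)
        have "M0 * B \<ge> B" using LM0(2) Bpos by (simp add: mult_le_cancel_right1)
        then have yB: "y' \<le> y - B" unfolding y'_def by simp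
        have "0 \<le> (\<Sum>\<theta>\<in>\<Theta>. \<bar>\<theta> x'\<bar>)" by (intro sum_nonneg) simp
        then have "y - B < 0" unfolding B_def by linarith
        then have "y' < 0" using yB by simp
        then have "c * y' \<le> y'" using c by (simp add: mult_le_cancel_right1)
        then have "c * y' \<le> \<theta> x'" if "\<theta> \<in> \<Theta>" for \<theta> using B[OF that] yB by linarith
        then have "eqv (insert n V) L0 M0 (x(n := y)) (x'(n := y'))"
          using True eqv_mono[OF E LM(3) M0M] by (intro key) (auto simp: y'_def)
        then show ?thesis using LM0(3) xy yB Bpos by (intro exI[of _ y']) auto
      qed
      moreover have "\<exists>y'. y' \<noteq> y \<and> x(n := y') \<in> S" using low[OF eqv_refl] by (metis less_irrefl)
      ultimately show ?thesis by blast
    next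
      case False
      define \<Theta>' where "\<Theta>' = {\<theta>\<in>\<Theta>. \<theta> x < c * y}"
      have "finite \<Theta>'" "\<Theta>' \<noteq> {}" using \<Theta>(1) False by (auto simp: \<Theta>'_def not_le)
      then have "\<exists>\<theta>\<in>\<Theta>'. Max ((\<lambda>\<theta>. \<theta> x) ` \<Theta>') = \<theta> x"
        using Max_in[of "(\<lambda>\<theta>. \<theta> x) ` \<Theta>'"] by blast
      then obtain \<theta> where \<theta>: "\<theta> \<in> \<Theta>'" "\<And>\<theta>'. \<theta>' \<in> \<Theta>' \<Longrightarrow> \<theta>' x \<le> \<theta> x"
        by (metis Max_ge \<open>finite \<Theta>'\<close> finite_imageI imageI)
      \<comment> \<open>The distance from the largest lower threshold is reduced modulo
        \<open>c * M0\<close> into the range from 1 to \<open>c * M0\<close>, and not from 0,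
        because the point has to stay strictly above the threshold. Then
        \<open>\<theta> x + s\<close> is divisible by \<open>c\<close>, with quotient congruent to
        \<open>y\<close> modulo \<open>M0\<close>.\<close>
      define s where "s = (c * y - \<theta> x - 1) mod (c * M0) + 1"
      have cM: "c * M0 > 0" using c LM0(2) by simp
      have s: "s \<in> {1..c * M0}" unfolding s_def using cM by (simp add: add1_zle_eq)
      have dv: "c * M0 dvd c * y - \<theta> x - s" unfolding s_def
        by (metis diff_diff_eq2 diff_diff_eq dvd_minus_mod add.commute)
      have sle: "\<theta> x + s \<le> c * y" unfolding s_def using \<theta>(1) zmod_le_nonneg_dividend[of "c * y - \<theta> x - 1" "c * M0"]
        by (auto simp: \<Theta>'_def)
      define h where "h = (\<lambda>x. (1 / of_int c) * (of_int (\<theta> x + s) :: rat))"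
      have "pol V 1 h" unfolding h_def
        using \<theta>(1) by (intro pol_scale pol_aff aff_add aff_const \<Theta>(2)) (auto simp: \<Theta>'_def)
      moreover have "\<exists>y'. of_int y' = h x' \<and> x'(n := y') \<in> S" if E: "eqv V L M x x'" for x'
      proof -
        have "aff V \<theta>" using \<theta> \<Theta> by (auto simp: \<Theta>'_def)
        then obtain a b where ab: "\<And>x. \<theta> x = lin V a x + b" unfolding aff_def by blast
        have "M dvd lin V a x - lin V a x'"
          using E by (intro lin_dvd_diff) (auto simp: eqv_def)
        then have "c * M0 dvd \<theta> x - \<theta> x'" using LM(4) by (auto simp: ab)
        then have "c * M0 dvd (c * y - \<theta> x - s) + (\<theta> x - \<theta> x')" using dv by (rule dvd_add[rotated])
        moreover have "(c * y - \<theta> x - s) + (\<theta> x - \<theta> x') = c * y - (\<theta> x' + s)" by simp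
        ultimately obtain u where u: "c * y - (\<theta> x' + s) = c * M0 * u" by (metis dvdE)
        define y' where "y' = y - M0 * u"
        have cy': "c * y' = \<theta> x' + s" using u by (simp add: y'_def algebra_simps)
        have "c * y \<le> \<theta>' x \<longleftrightarrow> c * y' \<le> \<theta>' x'" if t': "\<theta>' \<in> \<Theta>" for \<theta>'
        proof -
          have "c * y \<le> \<theta>' x \<longleftrightarrow> \<theta> x + s \<le> \<theta>' x"
            using sle \<theta>(2)[of \<theta>'] t' s by (fastforce simp: \<Theta>'_def)
          also have "\<dots> \<longleftrightarrow> \<theta> x' + s \<le> \<theta>' x'"
            using LM(5)[OF _ E, of "{x. \<theta> x + s \<le> \<theta>' x}"] t' s \<theta>(1) unfolding T_def \<Theta>'_def
            by (fastforce intro: image_eqI[of _ _ "(\<theta>, \<theta>', s)"])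
          finally show ?thesis by (simp add: cy')
        qed
        then have "eqv (insert n V) L0 M0 (x(n := y)) (x'(n := y'))"
          using eqv_mono[OF E LM(3) M0M] by (intro key) (auto simp: y'_def)
        moreover have "of_int y' = h x'"
          unfolding h_def cy'[symmetric] using c by simp
        ultimately show ?thesis using LM0(3) xy by blast
      qed
      ultimately show ?thesis by blast
    qed
  qed
qed

text \<open>Either alternative of \<open>fibre_witness\<close> yields a point over every equivalent
  base point, so by symmetry of \<open>eqv\<close> nonemptiness of the fibre is a property of the
  class.\<close>

lemma presb_ex:
  assumes "finite V" "n \<notin> V" "presb (insert n V) S"
  shows "presb V {x. \<exists>y. x(n := y) \<in> S}"
proof -
  obtain L M where LM: "finite L" "M > 0" and w:
    "\<And>x y. x(n := y) \<in> S \<Longrightarrow>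
      ((\<exists>y'. y' \<noteq> y \<and> x(n := y') \<in> S) \<and> (\<forall>x'. eqv V L M x x' \<longrightarrow> (\<exists>y'. x'(n := y') \<in> S))) \<or>
      (\<exists>h. pol V 1 h \<and> (\<forall>x'. eqv V L M x x' \<longrightarrow> (\<exists>y'. of_int y' = h x' \<and> x'(n := y') \<in> S)))"
    using fibre_witness[OF assms] by blast
  have "\<exists>y. x'(n := y) \<in> S" if "eqv V L M x x'" "x(n := y) \<in> S" for x x' y
    using w[OF that(2)] that(1) by blast
  then have "x \<in> {x. \<exists>y. x(n := y) \<in> S} \<longleftrightarrow> x' \<in> {x. \<exists>y. x(n := y) \<in> S}" if "eqv V L M x x'" for x x'
    using that eqv_sym[OF that] by blast
  then show ?thesis unfolding presb_def using LM by blast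
qed

lemma presb_all:
  assumes "finite V" "n \<notin> V" "presb (insert n V) {x. P x}"
  shows "presb V {x. \<forall>y. P (x(n := y))}"
  using presb_not[OF presb_ex[OF assms(1,2) presb_not[OF assms(3)]]] by simp

text \<open>Uniqueness excludes the alternative of \<open>fibre_witness\<close> that supplies a
  second point; the other one is the formula. Uniqueness is assumed at \<open>x\<close> only, and
  the formula still produces a point over each equivalent \<open>x'\<close>.\<close>

lemma function_affine_on_classes:
  assumes "finite V" "n \<notin> V" "presb (insert n V) S"
  obtains L M where "finite L" "M > 0"
    "\<And>x. \<exists>!y. x(n := y) \<in> S \<Longrightarrow>
      \<exists>h. pol V 1 h \<and> (\<forall>x'. eqv V L M x x' \<longrightarrow> (\<exists>y'. of_int y' = h x' \<and> x'(n := y') \<in> S))"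
proof -
  obtain L M where LM: "finite L" "M > 0" and w:
    "\<And>x y. x(n := y) \<in> S \<Longrightarrow>
      ((\<exists>y'. y' \<noteq> y \<and> x(n := y') \<in> S) \<and> (\<forall>x'. eqv V L M x x' \<longrightarrow> (\<exists>y'. x'(n := y') \<in> S))) \<or>
      (\<exists>h. pol V 1 h \<and> (\<forall>x'. eqv V L M x x' \<longrightarrow> (\<exists>y'. of_int y' = h x' \<and> x'(n := y') \<in> S)))"
    using fibre_witness[OF assms] by blast
  show ?thesis
  proof (rule that[OF LM])
    fix x assume "\<exists>!y. x(n := y) \<in> S"
    then obtain y where y: "x(n := y) \<in> S" "\<And>y'. x(n := y') \<in> S \<Longrightarrow> y' = y" by blast
    show "\<exists>h. pol V 1 h \<and> (\<forall>x'. eqv V L M x x' \<longrightarrow> (\<exists>y'. of_int y' = h x' \<and> x'(n := y') \<in> S))"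
      using w[OF y(1)] y(2) by blast
  qed
qed

lemma presb_ex_many:
  assumes "finite W" "finite V" "V \<inter> W = {}" "presb (V \<union> W) S"
  shows "presb V {x. \<exists>y. override_on x y W \<in> S}"
  using assms(1,3,4)
proof (induction W arbitrary: S rule: finite_induct)
  case empty
  then show ?case by simp
next
  case (insert w W)
  define S' where "S' = {x. \<exists>z. x(w := z) \<in> S}"
  have "presb (V \<union> W) S'" unfolding S'_def
    using insert assms(2) by (intro presb_ex) auto
  then have IH: "presb V {x. \<exists>y. override_on x y W \<in> S'}"
    using insert by auto
  have "(\<exists>y. override_on x y W \<in> S') \<longleftrightarrow> (\<exists>y. override_on x y (insert w W) \<in> S)" for x
  proof
    assume "\<exists>y. override_on x y W \<in> S'"
    then obtain y z where "(override_on x y W)(w := z) \<in> S" by (auto simp: S'_def)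
    moreover have "(override_on x y W)(w := z) = override_on x (y(w := z)) (insert w W)"
      using insert(2) by (auto simp: override_on_def)
    ultimately show "\<exists>y. override_on x y (insert w W) \<in> S" by metis
  next
    assume "\<exists>y. override_on x y (insert w W) \<in> S"
    then obtain y where "override_on x y (insert w W) \<in> S" by blast
    moreover have "override_on x y (insert w W) = (override_on x y W)(w := y w)"
      by (auto simp: override_on_def)
    ultimately show "\<exists>y. override_on x y W \<in> S'" unfolding S'_def by (metis mem_Collect_eq)
  qed
  then show ?case using IH by simp
qed

lemma presb_all_many:
  assumes "finite W" "finite V" "V \<inter> W = {}" "presb (V \<union> W) {x. P x}"
  shows "presb V {x. \<forall>y. P (override_on x y W)}"
  using presb_not[OF presb_ex_many[OF assms(1-3) presb_not[OF assms(4)]]] by simp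

text \<open>A class is determined by which inequalities of \<open>L\<close> hold and by the residues
  modulo \<open>M\<close>; both range over finite sets.\<close>

lemma finite_eqv_classes:
  assumes "finite V" "finite L" "M > 0"
  shows "finite (range (\<lambda>x. {y. eqv V L M x y}))"
proof -
  define sig where "sig x = ({ab\<in>L. lin V (fst ab) x \<le> snd ab}, restrict (\<lambda>i. x i mod M) V)" for x
  have *: "eqv V L M x y \<longleftrightarrow> sig x = sig y" for x y
  proof -
    have "{ab\<in>L. lin V (fst ab) x \<le> snd ab} = {ab\<in>L. lin V (fst ab) y \<le> snd ab} \<longleftrightarrow>
      (\<forall>(a, b)\<in>L. lin V a x \<le> b \<longleftrightarrow> lin V a y \<le> b)" by (auto simp: set_eq_iff)
    moreover have "restrict (\<lambda>i. x i mod M) V = restrict (\<lambda>i. y i mod M) V \<longleftrightarrow> (\<forall>i\<in>V. M dvd x i - y i)"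
      by (auto simp: fun_eq_iff restrict_def mod_eq_dvd_iff[symmetric])
    ultimately show ?thesis by (simp add: eqv_def sig_def)
  qed
  have "range sig \<subseteq> Pow L \<times> (\<Pi>\<^sub>E i\<in>V. {0..<M})"
    using assms(3) by (auto simp: sig_def)
  then have "finite (range sig)"
    by (rule finite_subset) (use assms in \<open>auto intro: finite_PiE\<close>)
  moreover have "range (\<lambda>x. {y. eqv V L M x y}) = (\<lambda>s. {y. s = sig y}) ` range sig"
    by (auto simp: *)
  ultimately show ?thesis by simp
qed

section \<open>Summation over fibres\<close>

text \<open>In (t + m)^(e+1) - t^(e+1) the leading term is (e+1) m t^e. The remaining lower powers
  of t have antidifferences by strong induction; subtracting these and dividing leaves t^e.\<close>

lemma antidifference_power:
  assumes "m \<noteq> (0::rat)"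
  shows "\<exists>g. pol {n} (Suc e) (\<lambda>x. g (of_int (x n))) \<and> (\<forall>t. g (t + m) - g t = t ^ e)"
proof (induction e rule: less_induct)
  case (less e)
  then have "\<forall>j. \<exists>g. j < e \<longrightarrow> pol {n} (Suc j) (\<lambda>x. g (of_int (x n))) \<and> (\<forall>t. g (t + m) - g t = t ^ j)"
    by blast
  then obtain g where g: "\<And>j. j < e \<Longrightarrow> pol {n} (Suc j) (\<lambda>x. g j (of_int (x n)))"
    "\<And>j t. j < e \<Longrightarrow> g j (t + m) - g j t = t ^ j" by metis
  define c where "c j = of_nat (Suc e choose j) * m ^ (Suc e - j)" for j
  define h where "h t = (1 / (of_nat (Suc e) * m)) * (t ^ Suc e - (\<Sum>j<e. c j * g j t))" for t
  have "pol {n} (Suc e) (\<lambda>x. (of_int (x n)) ^ Suc e)"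
    using pol_power[OF pol_var[of n "{n}"], of "Suc e"] by simp
  moreover have "pol {n} (Suc e) (\<lambda>x. \<Sum>j<e. c j * g j (of_int (x n)))"
    by (rule pol_sum, rule pol_scale, rule pol_mono[OF g(1)]) auto
  ultimately have "pol {n} (Suc e) (\<lambda>x. h (of_int (x n)))"
    unfolding h_def by (intro pol_scale pol_diff)
  moreover have "h (t + m) - h t = t ^ e" for t
  proof -
    have "(t + m) ^ Suc e = (\<Sum>j\<le>Suc e. c j * t ^ j)"
      unfolding binomial_ring c_def by (intro sum.cong) (auto simp: mult_ac)
    also have "\<dots> = (\<Sum>j<e. c j * t ^ j) + c e * t ^ e + c (Suc e) * t ^ Suc e"
      by (simp add: lessThan_Suc_atMost[symmetric])
    finally have 1: "(t + m) ^ Suc e - t ^ Suc e = (\<Sum>j<e. c j * t ^ j) + of_nat (Suc e) * m * t ^ e"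
      by (simp add: c_def)
    have 2: "(\<Sum>j<e. c j * g j (t + m)) - (\<Sum>j<e. c j * g j t) = (\<Sum>j<e. c j * t ^ j)"
      by (simp add: sum_subtractf[symmetric] right_diff_distrib[symmetric] g(2))
    have "h (t + m) - h t = (1 / (of_nat (Suc e) * m)) *
      (((t + m) ^ Suc e - t ^ Suc e) - ((\<Sum>j<e. c j * g j (t + m)) - (\<Sum>j<e. c j * g j t)))"
      unfolding h_def by (simp only: right_diff_distrib)
    also have "\<dots> = t ^ e" unfolding 1 2 using assms by (simp add: field_simps del: of_nat_Suc)
    finally show ?thesis .
  qed
  ultimately show ?case by (intro exI[of _ h]) simp
qed

text \<open>The bound \<open>D - e\<close> for the coefficient of the \<open>e\<close>-th power is
  what later controls the total degree. Since subtraction is truncated, vanishing of the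
  coefficients beyond \<open>D\<close> has to be carried through the induction separately.\<close>

lemma pol_expand:
  assumes "pol (insert n V) D p"
  shows "\<exists>P. (\<forall>e. pol V (D - e) (P e)) \<and> (\<forall>e>D. P e = (\<lambda>x. 0)) \<and>
    (\<forall>x. p x = (\<Sum>e\<le>D. P e x * of_int (x n) ^ e))"
  using assms
proof (induction rule: pol.induct)
  case (pol_const D c)
  have "(\<Sum>e\<le>D. (if e = 0 then c else 0) * of_int (x n) ^ e) = c" for x :: "nat \<Rightarrow> int"
    by (subst sum.remove[of _ 0]) (auto intro!: sum.neutral)
  then show ?case by (intro exI[of _ "\<lambda>e x. if e = 0 then c else 0"]) (simp add: pol.intros(1))
next
  case (pol_add D p q)
  then obtain P Q where
    P: "\<forall>e. pol V (D - e) (P e)" "\<forall>e>D. P e = (\<lambda>x. 0)" "\<forall>x. p x = (\<Sum>e\<le>D. P e x * of_int (x n) ^ e)" and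
    Q: "\<forall>e. pol V (D - e) (Q e)" "\<forall>e>D. Q e = (\<lambda>x. 0)" "\<forall>x. q x = (\<Sum>e\<le>D. Q e x * of_int (x n) ^ e)"
    by blast
  show ?case
    by (rule exI[of _ "\<lambda>e x. P e x + Q e x"]) (simp add: P Q pol.pol_add distrib_right sum.distrib)
next
  case (pol_var_mult D p i)
  then obtain P where
    P: "\<forall>e. pol V (D - e) (P e)" "\<forall>e>D. P e = (\<lambda>x. 0)" "\<forall>x. p x = (\<Sum>e\<le>D. P e x * of_int (x n) ^ e)"
    by blast
  show ?case
  proof (cases "i = n")
    case True
    define P' where "P' e = (if e = 0 then (\<lambda>x. 0) else P (e - 1))" for e
    have "pol V (Suc D - e) (P' e)" for e
      unfolding P'_def using P(1) pol_const[of V "Suc D" 0] by (cases e) auto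
    moreover have "P' e = (\<lambda>x. 0)" if "e > Suc D" for e
      using P(2) that by (auto simp: P'_def)
    moreover have "of_int (x i) * p x = (\<Sum>e\<le>Suc D. P' e x * of_int (x n) ^ e)" for x
      using True by (subst sum.atMost_Suc_shift) (simp add: P'_def P(3) sum_distrib_left mult_ac)
    ultimately show ?thesis by blast
  next
    case False
    define P' where "P' e = (\<lambda>x. of_int (x i) * P e x)" for e
    have "pol V (Suc D - e) (P' e)" for e
    proof (cases "e \<le> D")
      case True
      then show ?thesis unfolding P'_def
        using pol.pol_var_mult[of V "D - e" "P e" i] P(1) pol_var_mult(2) False by (simp add: Suc_diff_le)
    next
      case F: False
      then show ?thesis unfolding P'_def using P(2) by (simp add: pol.intros(1))
    qed
    moreover have "P' e = (\<lambda>x. 0)" if "e > Suc D" for e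
      using P(2) that by (simp add: P'_def)
    moreover have "of_int (x i) * p x = (\<Sum>e\<le>Suc D. P' e x * of_int (x n) ^ e)" for x
      using P(2) by (simp add: P'_def P(3) sum_distrib_left mult_ac)
    ultimately show ?thesis by blast
  qed
next
  case (pol_Suc D p)
  then obtain P where
    P: "\<forall>e. pol V (D - e) (P e)" "\<forall>e>D. P e = (\<lambda>x. 0)" "\<forall>x. p x = (\<Sum>e\<le>D. P e x * of_int (x n) ^ e)"
    by blast
  have "pol V (Suc D - e) (P e)" for e
    by (rule pol_mono[of V "D - e"]) (use P in auto)
  moreover have "p x = (\<Sum>e\<le>Suc D. P e x * of_int (x n) ^ e)" for x
    using P by simp
  ultimately show ?case using P(2) by (intro exI[of _ P]) simp
qed

text \<open>The coefficient of the \<open>e\<close>-th power has degree at most \<open>D - e\<close>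
  and is unaffected by a step in the variable \<open>n\<close>; the antidifference of that power has
  degree \<open>Suc e\<close>. The product stays within \<open>Suc D\<close>.\<close>

lemma antidifference:
  assumes "n \<notin> V" "pol (insert n V) D p" "m \<noteq> (0::int)"
  obtains G where "pol (insert n V) (Suc D) G"
    "\<And>x y. G (x(n := y + m)) - G (x(n := y)) = p (x(n := y))"
proof -
  obtain P where
    P: "\<forall>e. pol V (D - e) (P e)" "\<forall>x. p x = (\<Sum>e\<le>D. P e x * of_int (x n) ^ e)"
    using pol_expand[OF assms(2)] by blast
  have "\<forall>e. \<exists>g. pol {n} (Suc e) (\<lambda>x. g (of_int (x n))) \<and> (\<forall>t. g (t + of_int m) - g t = t ^ e)"
    using antidifference_power[of "of_int m"] assms(3) by simp
  then obtain g where g: "\<And>e. pol {n} (Suc e) (\<lambda>x. g e (of_int (x n)))"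
    "\<And>e t. g e (t + of_int m) - g e t = t ^ e" by metis
  define G where "G x = (\<Sum>e\<le>D. P e x * g e (of_int (x n)))" for x
  have G1: "pol (insert n V) (Suc D) G" unfolding G_def
  proof (rule pol_sum)
    fix e assume "e \<in> {..D}"
    then have "D - e + Suc e = Suc D" by simp
    moreover have "pol (insert n V) (D - e) (P e)" using P(1) by (auto intro: pol_mono_vars)
    moreover have "pol (insert n V) (Suc e) (\<lambda>x. g e (of_int (x n)))"
      by (rule pol_mono_vars[OF g(1)]) simp
    ultimately show "pol (insert n V) (Suc D) (\<lambda>x. P e x * g e (of_int (x n)))"
      using pol_mult[of "insert n V" "D - e" "P e" "Suc e"] by metis
  qed
  have G2: "G (x(n := y + m)) - G (x(n := y)) = p (x(n := y))" for x y
  proof -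
    have "P e (x(n := z)) = P e x" for e z
      by (rule pol_determined[of V "D - e"]) (use P assms(1) in auto)
    then show ?thesis
      by (simp add: G_def P(2) sum_subtractf[symmetric] right_diff_distrib[symmetric] g(2)
          fun_upd_same del: fun_upd_apply)
  qed
  show ?thesis by (rule that[OF G1 G2])
qed

lemma antidifference_sum:
  assumes "\<And>x y. G (x(n := y + m)) - G (x(n := y)) = (p (x(n := y)) :: rat)"
  shows "(\<Sum>j<J. p (x(n := a + m * int j))) = G (x(n := a + m * int J)) - G (x(n := a))"
proof (induction J)
  case (Suc J)
  have "a + m * int (Suc J) = (a + m * int J) + m" by (simp add: algebra_simps)
  then show ?case using Suc assms[of x "a + m * int J"] by (simp add: algebra_simps del: fun_upd_apply)
qed simp

text \<open>The candidate value is stored in the fresh coordinate \<open>t\<close>, so that being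
  extremal in the fibre is expressed by quantifiers over the coordinate \<open>n\<close>
  alone.\<close>

lemma presb_max_graph:
  assumes "finite V" "n \<notin> V" "t \<notin> insert n V" "presb (insert n V) S"
  shows "presb (insert t V) {x. (\<exists>y. x(n := y) \<in> S \<and> y = x t) \<and> (\<forall>y. x(n := y) \<in> S \<longrightarrow> y \<le> x t)}"
    and "presb (insert t V) {x. (\<exists>y. x(n := y) \<in> S \<and> y = x t) \<and> (\<forall>y. x(n := y) \<in> S \<longrightarrow> x t \<le> y)}"
proof -
  let ?W = "insert n (insert t V)"
  have S: "presb ?W {u. u \<in> S}" using presb_mono[OF assms(4)] assms(1) by auto
  have tn: "aff ?W (\<lambda>x. x n)" "aff ?W (\<lambda>x. x t)" using assms(1) by (auto intro: aff_var)
  have "presb (insert t V) {x. \<exists>y. x(n := y) \<in> {u. u \<in> S \<and> u n = u t}}"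
    by (rule presb_ex[OF _ _ presb_conj[OF S presb_eq[OF tn]]]) (use assms in auto)
  then have 1: "presb (insert t V) {x. \<exists>y. x(n := y) \<in> S \<and> y = x t}"
    using assms(3) by (simp add: fun_upd_other fun_upd_same del: fun_upd_apply)
  have "presb (insert t V) {x. \<forall>y. x(n := y) \<in> S \<longrightarrow> (x(n := y)) n \<le> (x(n := y)) t}"
    by (rule presb_all[OF _ _ presb_imp[OF S presb_le[OF tn]]]) (use assms in auto)
  then have 2: "presb (insert t V) {x. \<forall>y. x(n := y) \<in> S \<longrightarrow> y \<le> x t}"
    using assms(3) by simp
  have "presb (insert t V) {x. \<forall>y. x(n := y) \<in> S \<longrightarrow> (x(n := y)) t \<le> (x(n := y)) n}"
    by (rule presb_all[OF _ _ presb_imp[OF S presb_le[OF tn(2,1)]]]) (use assms in auto)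
  then have 3: "presb (insert t V) {x. \<forall>y. x(n := y) \<in> S \<longrightarrow> x t \<le> y}"
    using assms(3) by simp
  show "presb (insert t V) {x. (\<exists>y. x(n := y) \<in> S \<and> y = x t) \<and> (\<forall>y. x(n := y) \<in> S \<longrightarrow> y \<le> x t)}"
    by (rule presb_conj[OF 1 2])
  show "presb (insert t V) {x. (\<exists>y. x(n := y) \<in> S \<and> y = x t) \<and> (\<forall>y. x(n := y) \<in> S \<longrightarrow> x t \<le> y)}"
    by (rule presb_conj[OF 1 3])
qed

section \<open>Functions that are polynomial on each class, and their sums over fibres\<close>

definition pqp :: "nat set \<Rightarrow> nat \<Rightarrow> ((nat \<Rightarrow> int) \<Rightarrow> rat) \<Rightarrow> bool" where
  "pqp V D F \<longleftrightarrow> (\<exists>L M. finite L \<and> M > 0 \<and>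
     (\<forall>x. \<exists>p. pol V D p \<and> (\<forall>y. eqv V L M x y \<longrightarrow> F y = p y)))"

lemma pqp_zero: "pqp V D (\<lambda>x. 0)"
  unfolding pqp_def using pol_const[of V D 0]
  by (intro exI[of _ "{}"] exI[of _ 1]) auto

lemma pqp_add: assumes "pqp V D F" "pqp V D F'" shows "pqp V D (\<lambda>x. F x + F' x)"
proof -
  obtain L M where LM: "finite L" "M > 0" "\<And>x. \<exists>p. pol V D p \<and> (\<forall>y. eqv V L M x y \<longrightarrow> F y = p y)"
    using assms(1) unfolding pqp_def by blast
  obtain L' M' where LM': "finite L'" "M' > 0" "\<And>x. \<exists>p. pol V D p \<and> (\<forall>y. eqv V L' M' x y \<longrightarrow> F' y = p y)"
    using assms(2) unfolding pqp_def by blast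
  have "\<exists>p. pol V D p \<and> (\<forall>y. eqv V (L \<union> L') (M * M') x y \<longrightarrow> F y + F' y = p y)" for x
  proof -
    obtain p p' where p: "pol V D p" "\<And>y. eqv V L M x y \<Longrightarrow> F y = p y"
      "pol V D p'" "\<And>y. eqv V L' M' x y \<Longrightarrow> F' y = p' y" using LM(3) LM'(3) by meson
    have "F y + F' y = p y + p' y" if "eqv V (L \<union> L') (M * M') x y" for y
      using p(2)[OF eqv_mono[OF that]] p(4)[OF eqv_mono[OF that]] by simp
    then show ?thesis using pol_add[OF p(1,3)] by (intro exI[of _ "\<lambda>x. p x + p' x"]) simp
  qed
  then show ?thesis unfolding pqp_def using LM(1,2) LM'(1,2)
    by (intro exI[of _ "L \<union> L'"] exI[of _ "M * M'"]) simp
qed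

lemma pqp_sum: "(\<And>i. i \<in> I \<Longrightarrow> pqp V D (f i)) \<Longrightarrow> pqp V D (\<lambda>x. \<Sum>i\<in>I. f i x)"
proof (induction I rule: infinite_finite_induct)
  case (insert i I)
  then show ?case using pqp_add[of V D "f i" "\<lambda>x. \<Sum>i\<in>I. f i x"] by simp
qed (simp_all add: pqp_zero)

text \<open>By \<open>dv\<close> and \<open>conv\<close> a finite nonempty fibre is {a, a + m, ...,
  b}, and the sum telescopes to the difference of an antidifference at b + m and at a, both of
  degree one on classes. Infinite fibres are harmless: \<open>sum\<close> is then 0, and having a
  finite nonempty fibre is a property of the class.\<close>

lemma pqp_sum_progression:
  assumes V: "finite V" "n \<notin> V" and S: "presb (insert n V) S" and p: "pol (insert n V) D p" and m: "m > 0"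
    and dv: "\<And>x y z. x(n := y) \<in> S \<Longrightarrow> x(n := z) \<in> S \<Longrightarrow> m dvd y - z"
    and conv: "\<And>x y z w. x(n := y) \<in> S \<Longrightarrow> x(n := z) \<in> S \<Longrightarrow> y \<le> w \<Longrightarrow> w \<le> z \<Longrightarrow> m dvd w - y \<Longrightarrow> x(n := w) \<in> S"
  shows "pqp V (Suc D) (\<lambda>x. \<Sum>y\<in>{y. x(n := y) \<in> S}. p (x(n := y)))"
proof -
  define fib where "fib x = {y. x(n := y) \<in> S}" for x
  obtain t where t: "t \<notin> insert n V" using ex_new_if_finite[of "insert n V"] V(1) by auto
  have fibt: "fib (x(t := z)) = fib x" for x z
  proof -
    have "x(t := z, n := y) \<in> S \<longleftrightarrow> x(n := y) \<in> S" for y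
      by (rule presb_determined[OF S]) (use t in auto)
    then show ?thesis by (simp add: fib_def)
  qed
  define A where "A = {x. x t \<in> fib x \<and> (\<forall>y\<in>fib x. y \<le> x t)}"
  define B where "B = {x. x t \<in> fib x \<and> (\<forall>y\<in>fib x. x t \<le> y)}"
  have A: "presb (insert t V) A"
    using presb_max_graph(1)[OF V t S] unfolding A_def fib_def by (simp add: Ball_def)
  have B: "presb (insert t V) B"
    using presb_max_graph(2)[OF V t S] unfolding B_def fib_def by (simp add: Ball_def)
  have inA: "x(t := z) \<in> A \<longleftrightarrow> z \<in> fib x \<and> (\<forall>y\<in>fib x. y \<le> z)" for x z
    unfolding A_def using fibt by auto
  have inB: "x(t := z) \<in> B \<longleftrightarrow> z \<in> fib x \<and> (\<forall>y\<in>fib x. z \<le> y)" for x z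
    unfolding B_def using fibt by auto
  obtain L1 M1 where 1: "finite L1" "M1 > 0" "\<And>x. \<exists>!z. x(t := z) \<in> A \<Longrightarrow>
      \<exists>h. pol V 1 h \<and> (\<forall>x'. eqv V L1 M1 x x' \<longrightarrow> (\<exists>z. of_int z = h x' \<and> x'(t := z) \<in> A))"
    using function_affine_on_classes[OF V(1) _ A] t by blast
  obtain L2 M2 where 2: "finite L2" "M2 > 0" "\<And>x. \<exists>!z. x(t := z) \<in> B \<Longrightarrow>
      \<exists>h. pol V 1 h \<and> (\<forall>x'. eqv V L2 M2 x x' \<longrightarrow> (\<exists>z. of_int z = h x' \<and> x'(t := z) \<in> B))"
    using function_affine_on_classes[OF V(1) _ B] t by blast
  define L M where "L = L1 \<union> L2" and "M = M1 * M2"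
  have e1: "eqv V L1 M1 x y" and e2: "eqv V L2 M2 x y" if "eqv V L M x y" for x y
    using eqv_mono[OF that] by (simp_all add: L_def M_def)
  obtain G where G: "pol (insert n V) (Suc D) G"
    "\<And>x y. G (x(n := y + m)) - G (x(n := y)) = p (x(n := y))"
    using antidifference[OF V(2) p, of m] m by (metis less_irrefl)
  have main: "\<exists>P. pol V (Suc D) P \<and> (\<forall>x'. eqv V L M x x' \<longrightarrow> (\<Sum>y\<in>fib x'. p (x'(n := y))) = P x')" for x
  proof (cases "finite (fib x) \<and> fib x \<noteq> {}")
    case True
    have uA: "\<exists>!z. x(t := z) \<in> A"
      unfolding inA using True by (intro ex1I[of _ "Max (fib x)"]) (auto intro: Max_eqI[symmetric])
    obtain h1 where h1: "pol V 1 h1" "\<And>x'. eqv V L1 M1 x x' \<Longrightarrow> \<exists>z. of_int z = h1 x' \<and> x'(t := z) \<in> A"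
      using 1(3)[OF uA] by blast
    have uB: "\<exists>!z. x(t := z) \<in> B"
      unfolding inB using True by (intro ex1I[of _ "Min (fib x)"]) (auto intro: Min_eqI[symmetric])
    obtain h2 where h2: "pol V 1 h2" "\<And>x'. eqv V L2 M2 x x' \<Longrightarrow> \<exists>z. of_int z = h2 x' \<and> x'(t := z) \<in> B"
      using 2(3)[OF uB] by blast
    \<comment> \<open>Telescoping ends one step beyond the maximum, hence the added
      \<open>m\<close>; the minimum is used as it is.\<close>
    obtain G1 where G1: "pol V (Suc D) G1" "\<And>x y. of_int y = h1 x + of_int m \<Longrightarrow> G (x(n := y)) = G1 x"
      using pol_subst[OF G(1) pol_add[OF h1(1) pol_const]] by metis
    obtain G2 where G2: "pol V (Suc D) G2" "\<And>x y. of_int y = h2 x \<Longrightarrow> G (x(n := y)) = G2 x"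
      using pol_subst[OF G(1) h2(1)] by metis
    have "(\<Sum>y\<in>fib x'. p (x'(n := y))) = G1 x' - G2 x'" if E: "eqv V L M x x'" for x'
    proof -
      obtain a where a: "of_int a = h2 x'" "a \<in> fib x'" "\<And>y. y \<in> fib x' \<Longrightarrow> a \<le> y"
        using h2(2)[OF e2[OF E]] inB by blast
      obtain b where b: "of_int b = h1 x'" "b \<in> fib x'" "\<And>y. y \<in> fib x' \<Longrightarrow> y \<le> b"
        using h1(2)[OF e1[OF E]] inA by blast
      have "m dvd b - a" using dv a(2) b(2) by (auto simp: fib_def)
      then obtain j where j: "b - a = m * j" by blast
      have "b - a \<ge> 0" using a(3)[OF b(2)] by simp
      then have "j \<ge> 0" using j m by (simp add: zero_le_mult_iff)
      define J where "J = Suc (nat j)"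
      have J: "a + m * int J = b + m" using j \<open>j \<ge> 0\<close> by (simp add: J_def algebra_simps)
      have "fib x' = (\<lambda>i. a + m * int i) ` {..<J}"
      proof (intro set_eqI iffI)
        fix y assume y: "y \<in> fib x'"
        then have "m dvd y - a" using dv a(2) by (auto simp: fib_def)
        then obtain i where i: "y - a = m * i" by blast
        have "i \<ge> 0" using a(3)[OF y] i m by (metis diff_ge_0_iff_ge zero_le_mult_iff not_less)
        moreover have "m * i \<le> m * j" using b(3)[OF y] i j by simp
        then have "i \<le> j" using m by simp
        ultimately show "y \<in> (\<lambda>i. a + m * int i) ` {..<J}"
          using i by (intro image_eqI[of _ _ "nat i"]) (auto simp: J_def)
      next
        fix y assume "y \<in> (\<lambda>i. a + m * int i) ` {..<J}"
        then obtain i where i: "y = a + m * int i" "i < J" by auto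
        have "int i \<le> j" using i(2) \<open>j \<ge> 0\<close> by (auto simp: J_def)
        then have "m * int i \<le> m * j" using m by simp
        then have "a + m * int i \<le> b" using j by linarith
        then show "y \<in> fib x'"
          using conv[of x' a b y] a(2) b(2) i(1) j m by (auto simp: fib_def)
      qed
      moreover have "inj_on (\<lambda>i. a + m * int i) {..<J}" using m by (auto simp: inj_on_def)
      ultimately have "(\<Sum>y\<in>fib x'. p (x'(n := y))) = (\<Sum>i<J. p (x'(n := a + m * int i)))"
        by (simp add: sum.reindex del: fun_upd_apply)
      also have "\<dots> = G (x'(n := b + m)) - G (x'(n := a))"
        using antidifference_sum[OF G(2), of x' a J] unfolding J .
      also have "\<dots> = G1 x' - G2 x'" using G1(2)[of "b + m" x'] G2(2)[of a x'] a(1) b(1) by simp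
      finally show ?thesis .
    qed
    then show ?thesis using pol_diff[OF G1(1) G2(1)] by (intro exI[of _ "\<lambda>x. G1 x - G2 x"]) simp
  next
    case False
    \<comment> \<open>A nonzero sum forces the fibre over \<open>x'\<close> to be finite and
      nonempty. Its maximum and minimum, carried back along the symmetric equivalence, would make
      the fibre over \<open>x\<close> bounded and nonempty.\<close>
    have "(\<Sum>y\<in>fib x'. p (x'(n := y))) = 0" if E: "eqv V L M x x'" for x'
    proof (rule ccontr)
      assume "(\<Sum>y\<in>fib x'. p (x'(n := y))) \<noteq> 0"
      then have f: "finite (fib x')" "fib x' \<noteq> {}" by (metis sum.infinite, metis sum.empty)
      have uA: "\<exists>!z. x'(t := z) \<in> A"
        unfolding inA using f by (intro ex1I[of _ "Max (fib x')"]) (auto intro: Max_eqI[symmetric])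
      have uB: "\<exists>!z. x'(t := z) \<in> B"
        unfolding inB using f by (intro ex1I[of _ "Min (fib x')"]) (auto intro: Min_eqI[symmetric])
      obtain b where "b \<in> fib x" "\<And>y. y \<in> fib x \<Longrightarrow> y \<le> b"
        using 1(3)[OF uA] e1[OF eqv_sym[OF E]] inA by blast
      moreover obtain a where "\<And>y. y \<in> fib x \<Longrightarrow> a \<le> y"
        using 2(3)[OF uB] e2[OF eqv_sym[OF E]] inB by blast
      ultimately have "fib x \<subseteq> {a..b}" "fib x \<noteq> {}" by auto
      then show False using False finite_subset by blast
    qed
    then show ?thesis using pol_const[of V "Suc D" 0] by (intro exI[of _ "\<lambda>x. 0"]) simp
  qed
  show ?thesis unfolding pqp_def fib_def[symmetric]
    using main 1(1,2) 2(1,2) by (intro exI[of _ L] exI[of _ M]) (auto simp: L_def M_def)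
qed

lemma presb_eqv_class: "finite L \<Longrightarrow> M > 0 \<Longrightarrow> presb V {y. eqv V L M x y}"
  unfolding presb_def by (auto intro!: exI[of _ L] exI[of _ M] dest: eqv_trans eqv_sym)

text \<open>In the direction of \<open>n\<close> an inequality defines a half-line, everything or
  nothing, so a truth value shared by the two ends is shared by all points between them.\<close>

lemma eqv_fun_upd_between:
  assumes "finite V" "n \<notin> V" "eqv (insert n V) L M u (x(n := y))" "eqv (insert n V) L M u (x(n := z))"
    "y \<le> w" "w \<le> z" "M dvd w - y"
  shows "eqv (insert n V) L M u (x(n := w))"
proof -
  have "eqv (insert n V) L M (x(n := y)) (x(n := w))"
    unfolding eqv_def
  proof (intro conjI ballI)
    fix ab assume "ab \<in> L"
    obtain a b where ab: "ab = (a, b)" by fastforce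
    have yz: "a n * y + lin V a x \<le> b \<longleftrightarrow> a n * z + lin V a x \<le> b"
      using \<open>ab \<in> L\<close> ab assms(1-4) unfolding eqv_def by (auto simp: lin_insert)
    have "a n * y \<le> a n * w \<and> a n * w \<le> a n * z \<or> a n * z \<le> a n * w \<and> a n * w \<le> a n * y"
      using assms(5,6) by (cases "a n \<ge> 0") (auto intro: mult_left_mono mult_left_mono_neg)
    then show "case ab of (a, b) \<Rightarrow> lin (insert n V) a (x(n := y)) \<le> b \<longleftrightarrow> lin (insert n V) a (x(n := w)) \<le> b"
      using yz assms(1,2) by (auto simp: ab lin_insert)
  qed (use assms(7) in \<open>auto simp: dvd_diff_commute\<close>)
  then show ?thesis using assms(3) eqv_trans by blast
qed

text \<open>After a common refinement \<open>S\<close> is a union of finitely many classes, on each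
  of which \<open>F\<close> is a polynomial. Over an infinite fibre \<open>G\<close> may differ from
  the sum, which is then 0: classes meeting the fibre in a finite set still contribute to
  \<open>G\<close>.\<close>

lemma pqp_fibre_sum:
  assumes V: "finite V" "n \<notin> V" and S: "presb (insert n V) S" and F: "pqp (insert n V) D F"
  obtains G where "pqp V (Suc D) G"
    "\<And>x. finite {y. x(n := y) \<in> S} \<Longrightarrow> G x = (\<Sum>y\<in>{y. x(n := y) \<in> S}. F (x(n := y)))"
proof -
  let ?W = "insert n V"
  obtain L1 M1 where 1: "finite L1" "M1 > 0" "\<And>x y. eqv ?W L1 M1 x y \<Longrightarrow> x \<in> S \<longleftrightarrow> y \<in> S"
    using S unfolding presb_def by blast
  obtain L2 M2 where 2: "finite L2" "M2 > 0" "\<And>x. \<exists>p. pol ?W D p \<and> (\<forall>y. eqv ?W L2 M2 x y \<longrightarrow> F y = p y)"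
    using F unfolding pqp_def by blast
  define L M where "L = L1 \<union> L2" and "M = M1 * M2"
  have LM: "finite L" "M > 0" using 1 2 by (auto simp: L_def M_def)
  have e1: "eqv ?W L1 M1 x y" and e2: "eqv ?W L2 M2 x y" if "eqv ?W L M x y" for x y
    using eqv_mono[OF that] by (simp_all add: L_def M_def)
  define C where "C = {{y. eqv ?W L M x y} | x. x \<in> S}"
  have finC: "finite C"
    by (rule finite_subset[OF _ finite_eqv_classes[OF _ LM, of ?W]]) (use V in \<open>auto simp: C_def\<close>)
  have "\<forall>c\<in>C. \<exists>p. pol ?W D p \<and> (\<forall>y\<in>c. F y = p y)"
    unfolding C_def using 2(3) e2 by fastforce
  then obtain p where p: "\<And>c. c \<in> C \<Longrightarrow> pol ?W D (p c)" "\<And>c y. c \<in> C \<Longrightarrow> y \<in> c \<Longrightarrow> F y = p c y"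
    by metis
  have SC: "x \<in> S \<longleftrightarrow> (\<exists>c\<in>C. x \<in> c)" for x
  proof
    assume "x \<in> S"
    then show "\<exists>c\<in>C. x \<in> c"
      unfolding C_def by (intro bexI[of _ "{y. eqv ?W L M x y}"]) auto
  next
    assume "\<exists>c\<in>C. x \<in> c"
    then show "x \<in> S" unfolding C_def using 1(3)[OF e1] by blast
  qed
  have disj: "c = c'" if "c \<in> C" "c' \<in> C" "x \<in> c" "x \<in> c'" for c c' x
    using that unfolding C_def by (auto dest: eqv_trans eqv_sym)
  define G where "G x = (\<Sum>c\<in>C. \<Sum>y\<in>{y. x(n := y) \<in> c}. p c (x(n := y)))" for x
  have "pqp V (Suc D) G" unfolding G_def
  proof (rule pqp_sum)
    fix c assume c: "c \<in> C"
    then obtain u where u: "c = {y. eqv ?W L M u y}" unfolding C_def by blast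
    show "pqp V (Suc D) (\<lambda>x. \<Sum>y\<in>{y. x(n := y) \<in> c}. p c (x(n := y)))"
    proof (rule pqp_sum_progression[OF V _ p(1)[OF c] LM(2)])
      show "presb ?W c" unfolding u using LM by (rule presb_eqv_class)
    next
      fix x y z assume "x(n := y) \<in> c" "x(n := z) \<in> c"
      then have "M dvd u n - y" "M dvd u n - z" by (auto simp: u eqv_def)
      then show "M dvd y - z" using dvd_diff by fastforce
    next
      fix x y z w assume "x(n := y) \<in> c" "x(n := z) \<in> c" "y \<le> w" "w \<le> z" "M dvd w - y"
      then show "x(n := w) \<in> c"
        unfolding u using eqv_fun_upd_between[OF V, of L M u x y z w] by simp
    qed
  qed
  moreover have "G x = (\<Sum>y\<in>{y. x(n := y) \<in> S}. F (x(n := y)))" if "finite {y. x(n := y) \<in> S}" for x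
  proof -
    have un: "{y. x(n := y) \<in> S} = (\<Union>c\<in>C. {y. x(n := y) \<in> c})" using SC by auto
    have "(\<Sum>y\<in>{y. x(n := y) \<in> S}. F (x(n := y))) = (\<Sum>c\<in>C. \<Sum>y\<in>{y. x(n := y) \<in> c}. F (x(n := y)))"
      unfolding un
    proof (rule sum.UNION_disjoint[OF finC])
      show "\<forall>c\<in>C. finite {y. x(n := y) \<in> c}"
        using that unfolding un by (metis UN_upper finite_subset)
      show "\<forall>i\<in>C. \<forall>j\<in>C. i \<noteq> j \<longrightarrow> {y. x(n := y) \<in> i} \<inter> {y. x(n := y) \<in> j} = {}"
        using disj by blast
    qed
    also have "\<dots> = G x" unfolding G_def using p(2) by (intro sum.cong) auto
    finally show ?thesis by simp
  qed
  ultimately show ?thesis by (rule that)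
qed

text \<open>\<open>extensional W\<close> contains exactly one function for each point of Z^W, so
  finiteness and summation refer to points of the fibre.\<close>

lemma pqp_fibre_sum_many:
  assumes "finite W" "finite V" "V \<inter> W = {}" "presb (V \<union> W) S" "pqp (V \<union> W) D F"
  shows "\<exists>G. pqp V (D + card W) G \<and> (\<forall>x. finite {y\<in>extensional W. override_on x y W \<in> S} \<longrightarrow>
    G x = (\<Sum>y\<in>{y\<in>extensional W. override_on x y W \<in> S}. F (override_on x y W)))"
  using assms(1,3,4,5)
proof (induction W arbitrary: S F D rule: finite_induct)
  case empty
  have "{y \<in> extensional {}. x \<in> S} = (if x \<in> S then {\<lambda>_. undefined} else {})" for x
    by (auto simp: extensional_def)
  then have *: "(\<Sum>y\<in>{y\<in>extensional {}. override_on x y {} \<in> S}. F (override_on x y {})) = (if x \<in> S then F x else 0)" for x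
    by simp
  obtain L1 M1 where 1: "finite L1" "M1 > 0" "\<And>x y. eqv V L1 M1 x y \<Longrightarrow> x \<in> S \<longleftrightarrow> y \<in> S"
    using empty(2) unfolding presb_def by auto
  obtain L2 M2 where 2: "finite L2" "M2 > 0" "\<And>x. \<exists>p. pol V D p \<and> (\<forall>y. eqv V L2 M2 x y \<longrightarrow> F y = p y)"
    using empty(3) unfolding pqp_def by auto
  have "\<exists>p. pol V D p \<and> (\<forall>y. eqv V (L1 \<union> L2) (M1 * M2) x y \<longrightarrow> (if y \<in> S then F y else 0) = p y)" for x
  proof -
    have e1: "eqv V L1 M1 x y" and e2: "eqv V L2 M2 x y" if "eqv V (L1 \<union> L2) (M1 * M2) x y" for x y
      using eqv_mono[OF that] by simp_all
    show ?thesis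
    proof (cases "x \<in> S")
      case True
      then show ?thesis using 1(3)[OF e1] 2(3)[of x] e2 by metis
    next
      case False
      then show ?thesis using 1(3)[OF e1] pol_const[of V D 0] by (intro exI[of _ "\<lambda>x. 0"]) auto
    qed
  qed
  then have "pqp V D (\<lambda>x. if x \<in> S then F x else 0)"
    unfolding pqp_def using 1(1,2) 2(1,2) by (intro exI[of _ "L1 \<union> L2"] exI[of _ "M1 * M2"]) simp
  then show ?case unfolding * by (intro exI[of _ "\<lambda>x. if x \<in> S then F x else 0"]) simp
next
  case (insert w W)
  have VW: "finite (V \<union> W)" "w \<notin> V \<union> W" "V \<union> insert w W = insert w (V \<union> W)"
    using insert assms(2) by auto
  define S' where "S' = {x. \<exists>z. x(w := z) \<in> S}"
  have S': "presb (V \<union> W) S'" unfolding S'_def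
    using VW insert by (intro presb_ex) auto
  obtain F' where F': "pqp (V \<union> W) (Suc D) F'"
    "\<And>x. finite {z. x(w := z) \<in> S} \<Longrightarrow> F' x = (\<Sum>z\<in>{z. x(w := z) \<in> S}. F (x(w := z)))"
    using pqp_fibre_sum[OF VW(1,2), of S D F] insert(5,6) VW(3) by metis
  obtain G where G: "pqp V (Suc D + card W) G"
    "\<And>x. finite {y\<in>extensional W. override_on x y W \<in> S'} \<Longrightarrow>
      G x = (\<Sum>y\<in>{y\<in>extensional W. override_on x y W \<in> S'}. F' (override_on x y W))"
    using insert.IH[OF _ S' F'(1)] insert(4) by blast
  have "G x = (\<Sum>y\<in>{y\<in>extensional (insert w W). override_on x y (insert w W) \<in> S}. F (override_on x y (insert w W)))"
    if fin: "finite {y\<in>extensional (insert w W). override_on x y (insert w W) \<in> S}" for x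
  proof -
    define Y where "Y = {y\<in>extensional (insert w W). override_on x y (insert w W) \<in> S}"
    define Y' where "Y' = {y\<in>extensional W. override_on x y W \<in> S'}"
    define Z where "Z y = {z. (override_on x y W)(w := z) \<in> S}" for y
    have ov: "override_on x (y(w := z)) (insert w W) = (override_on x y W)(w := z)" for y z
      using insert(2) by (auto simp: override_on_def)
    have ov': "override_on x (restrict y W) W = override_on x y W" for y
      by (auto simp: override_on_def)
    have upd: "(restrict y W)(w := y w) = y" if "y \<in> extensional (insert w W)" for y
      using that by (auto simp: extensional_def restrict_def)
    have res: "restrict (y(w := z)) W = y" if "y \<in> extensional W" for y z
      using that insert(2) by (auto simp: extensional_def restrict_def)
    have ext: "y(w := z) \<in> extensional (insert w W)" if "y \<in> extensional W" for y z
      using that by (auto simp: extensional_def)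
    have YZ: "y(w := z) \<in> Y" if "y \<in> Y'" "z \<in> Z y" for y z
      using that by (simp add: Y_def Y'_def Z_def ov ext del: fun_upd_apply)
    have Ydec: "restrict y W \<in> Y' \<and> y w \<in> Z (restrict y W)" if "y \<in> Y" for y
    proof -
      have "(override_on x (restrict y W) W)(w := y w) \<in> S"
        using that unfolding Y_def by (metis (no_types, lifting) mem_Collect_eq ov upd)
      then show ?thesis by (auto simp: Y'_def Z_def S'_def)
    qed
    have finY: "finite Y" using fin by (simp add: Y_def)
    \<comment> \<open>The formulas for \<open>G\<close> and \<open>F'\<close> hold over finite
      fibres only. Every point of the projection lifts to \<open>Y\<close>, so finiteness passes
      from \<open>Y\<close> to \<open>Y'\<close>; the inner fibres \<open>Z y\<close> inherit it in
      the same way.\<close>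
    have "Y' \<subseteq> (\<lambda>y. restrict y W) ` Y"
    proof
      fix y assume y: "y \<in> Y'"
      then obtain z where "z \<in> Z y" by (auto simp: Y'_def S'_def Z_def)
      then show "y \<in> (\<lambda>y. restrict y W) ` Y"
        using YZ[OF y] res[of y z] y by (intro image_eqI[of _ _ "y(w := z)"]) (auto simp: Y'_def)
    qed
    then have finY': "finite Y'" using finY finite_surj by blast
    have finZ: "finite (Z y)" if "y \<in> Y'" for y
    proof (rule finite_subset)
      show "Z y \<subseteq> (\<lambda>y. y w) ` Y"
        using YZ[OF that] by (metis fun_upd_same image_eqI subsetI)
    qed (use finY in simp)
    have "G x = (\<Sum>y\<in>Y'. F' (override_on x y W))"
      using G(2)[of x] finY' by (simp add: Y'_def)
    also have "\<dots> = (\<Sum>y\<in>Y'. \<Sum>z\<in>Z y. F ((override_on x y W)(w := z)))"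
      using F'(2) finZ by (intro sum.cong) (auto simp: Z_def)
    also have "\<dots> = (\<Sum>(y, z)\<in>Sigma Y' Z. F ((override_on x y W)(w := z)))"
      using finY' finZ by (intro sum.Sigma) auto
    also have "\<dots> = (\<Sum>y\<in>Y. F (override_on x y (insert w W)))"
    proof (rule sum.reindex_bij_witness[of _ "\<lambda>y. (restrict y W, y w)" "\<lambda>(y, z). y(w := z)"])
      fix a assume "a \<in> Sigma Y' Z"
      then show "(restrict (case a of (y, z) \<Rightarrow> y(w := z)) W, (case a of (y, z) \<Rightarrow> y(w := z)) w) = a"
        "(case a of (y, z) \<Rightarrow> y(w := z)) \<in> Y"
        using YZ res by (auto simp: Y'_def simp del: fun_upd_apply simp add: fun_upd_same)
      show "F (override_on x (case a of (y, z) \<Rightarrow> y(w := z)) (insert w W)) = (case a of (y, z) \<Rightarrow> F ((override_on x y W)(w := z)))"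
        by (simp add: case_prod_beta ov del: fun_upd_apply)
    next
      fix y assume y: "y \<in> Y"
      then show "(case (restrict y W, y w) of (y, z) \<Rightarrow> y(w := z)) = y"
        using upd[of y] by (simp add: Y_def del: fun_upd_apply)
      show "(restrict y W, y w) \<in> Sigma Y' Z" using Ydec[OF y] by simp
    qed
    finally show ?thesis by (simp add: Y_def)
  qed
  then show ?case using G(1) insert(1,2) by (intro exI[of _ G]) simp
qed

section \<open>Decomposition of Presburger sets into simple sets\<close>

definition point :: "nat set \<Rightarrow> (nat \<Rightarrow> int) \<Rightarrow> (nat \<Rightarrow> nat \<Rightarrow> int) \<Rightarrow> (nat \<Rightarrow> int) \<Rightarrow> (nat \<Rightarrow> int)" where
  "point I q v c = (\<lambda>j. q j + (\<Sum>i\<in>I. c i * v i j))"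

definition cone :: "nat set \<Rightarrow> (nat \<Rightarrow> int) \<Rightarrow> (nat \<Rightarrow> nat \<Rightarrow> int) \<Rightarrow> (nat \<Rightarrow> int) set" where
  "cone I q v = point I q v ` {c. \<forall>i\<in>I. c i \<ge> 0}"

text \<open>Presburger sets are cylinders and simple sets are not; vanishing outside
  \<open>V\<close> picks one representative of each point of Z^V.\<close>

definition vectors :: "nat set \<Rightarrow> (nat \<Rightarrow> int) set" where
  "vectors V = {x. \<forall>j. j \<notin> V \<longrightarrow> x j = 0}"

definition frame :: "nat set \<Rightarrow> nat set \<Rightarrow> (nat \<Rightarrow> nat \<Rightarrow> int) \<Rightarrow> bool" where
  "frame V I v \<longleftrightarrow> finite I \<and> (\<forall>i\<in>I. v i \<in> vectors V) \<and>
     (\<forall>c. (\<forall>j. (\<Sum>i\<in>I. c i * v i j) = 0) \<longrightarrow> (\<forall>i\<in>I. c i = 0))"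

definition decomposable :: "nat set \<Rightarrow> (nat \<Rightarrow> int) set \<Rightarrow> bool" where
  "decomposable V A \<longleftrightarrow> (\<exists>\<S>. finite \<S> \<and> disjoint \<S> \<and> A = \<Union>\<S> \<and>
     (\<forall>S\<in>\<S>. \<exists>I q v. q \<in> vectors V \<and> frame V I v \<and> S = cone I q v))"

lemma decomposable_cone: "q \<in> vectors V \<Longrightarrow> frame V I v \<Longrightarrow> decomposable V (cone I q v)"
  unfolding decomposable_def by (rule exI[of _ "{cone I q v}"]) auto

lemma decomposable_empty: "decomposable V {}"
  unfolding decomposable_def by (rule exI[of _ "{}"]) auto

lemma decomposable_Un:
  assumes "decomposable V A" "decomposable V B" "A \<inter> B = {}"
  shows "decomposable V (A \<union> B)"
proof -
  obtain \<A> where A: "finite \<A>" "disjoint \<A>" "A = \<Union>\<A>"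
    "\<forall>S\<in>\<A>. \<exists>I q v. q \<in> vectors V \<and> frame V I v \<and> S = cone I q v"
    using assms(1) unfolding decomposable_def by blast
  obtain \<B> where B: "finite \<B>" "disjoint \<B>" "B = \<Union>\<B>"
    "\<forall>S\<in>\<B>. \<exists>I q v. q \<in> vectors V \<and> frame V I v \<and> S = cone I q v"
    using assms(2) unfolding decomposable_def by blast
  have "disjoint (\<A> \<union> \<B>)"
    using A(2,3) B(2,3) assms(3) by (intro disjoint_union) auto
  then show ?thesis unfolding decomposable_def using A B
    by (intro exI[of _ "\<A> \<union> \<B>"]) auto
qed

lemma decomposable_UN:
  assumes "finite R" "\<And>r. r \<in> R \<Longrightarrow> decomposable V (A r)" "disjoint_family_on A R"
  shows "decomposable V (\<Union>r\<in>R. A r)"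
  using assms
proof (induction R rule: finite_induct)
  case (insert r R)
  have "A r \<inter> A r' = {}" if "r' \<in> R" for r'
    using insert(2,5) that unfolding disjoint_family_on_def by (metis insertI1 insertI2)
  then have "A r \<inter> (\<Union>r\<in>R. A r) = {}" by blast
  moreover have "disjoint_family_on A R"
    using insert(5) unfolding disjoint_family_on_def by blast
  then have "decomposable V (\<Union>r\<in>R. A r)" using insert.IH insert.prems(1) by blast
  ultimately show ?case using insert.prems(1) decomposable_Un[of V "A r" "\<Union>r\<in>R. A r"] by simp
qed (simp add: decomposable_empty)

section \<open>Cutting simple sets by half-spaces and congruences\<close>

definition splits :: "nat set \<Rightarrow> (nat \<Rightarrow> int) set \<Rightarrow> (nat \<Rightarrow> int) set \<Rightarrow> bool" where
  "splits V H A \<longleftrightarrow> decomposable V (A \<inter> H) \<and> decomposable V (A - H)"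

lemma splits_Un: "splits V H A \<Longrightarrow> splits V H B \<Longrightarrow> A \<inter> B = {} \<Longrightarrow> splits V H (A \<union> B)"
  unfolding splits_def Int_Un_distrib2 Un_Diff
  using decomposable_Un[of V "A \<inter> H" "B \<inter> H"] decomposable_Un[of V "A - H" "B - H"] by blast

lemma splits_UN:
  assumes "finite R" "\<And>r. r \<in> R \<Longrightarrow> splits V H (A r)" "disjoint_family_on A R"
  shows "splits V H (\<Union>r\<in>R. A r)"
proof -
  have disj: "disjoint_family_on (\<lambda>r. A r \<inter> H) R" "disjoint_family_on (\<lambda>r. A r - H) R"
    using assms(3) unfolding disjoint_family_on_def by blast+
  have dec: "decomposable V (A r \<inter> H)" "decomposable V (A r - H)" if "r \<in> R" for r
    using assms(2)[OF that] unfolding splits_def by blast+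
  have eq: "(\<Union>r\<in>R. A r) \<inter> H = (\<Union>r\<in>R. A r \<inter> H)" "(\<Union>r\<in>R. A r) - H = (\<Union>r\<in>R. A r - H)" by blast+
  show ?thesis unfolding splits_def eq
    by (intro conjI decomposable_UN[OF assms(1)] dec disj)
qed

lemma splits_trivial: assumes "decomposable V A" "A \<subseteq> H \<or> A \<inter> H = {}" shows "splits V H A"
proof -
  from assms(2) show ?thesis
  proof
    assume "A \<subseteq> H"
    then have "A \<inter> H = A" "A - H = {}" by auto
    then show ?thesis using assms(1) decomposable_empty unfolding splits_def by metis
  next
    assume "A \<inter> H = {}"
    then have "A \<inter> H = {}" "A - H = A" by auto
    then show ?thesis using assms(1) decomposable_empty unfolding splits_def by metis
  qed
qed

lemma frame_zero: "frame V I v \<Longrightarrow> (\<And>j. (\<Sum>i\<in>I. c i * v i j) = 0) \<Longrightarrow> \<forall>i\<in>I. c i = 0"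
  unfolding frame_def by blast

lemma frame_finite: "frame V I v \<Longrightarrow> finite I"
  unfolding frame_def by blast

lemma frame_vectors: "frame V I v \<Longrightarrow> i \<in> I \<Longrightarrow> v i \<in> vectors V"
  unfolding frame_def by blast

lemma point_cong: "(\<And>i. i \<in> I \<Longrightarrow> c i = c' i) \<Longrightarrow> point I q v c = point I q v c'"
  by (simp add: point_def)

text \<open>Uniqueness of coordinates: the pieces of a cone below are described by conditions on
  coordinates, and this is why incompatible conditions give disjoint pieces.\<close>

lemma point_inj: assumes "frame V I v" "point I q v c = point I q v c'" "i \<in> I" shows "c i = c' i"
proof -
  have "(\<Sum>i\<in>I. (c i - c' i) * v i j) = 0" for j
    using fun_cong[OF assms(2), of j] by (simp add: point_def left_diff_distrib sum_subtractf)
  then have "\<forall>i\<in>I. c i - c' i = 0"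
    by (intro frame_zero[OF assms(1)]) simp
  then show ?thesis using assms(3) by simp
qed

lemma point_in_vectors: "q \<in> vectors V \<Longrightarrow> frame V I v \<Longrightarrow> point I q v c \<in> vectors V"
  using frame_vectors[of V I v] by (auto simp: point_def vectors_def intro!: sum.neutral)

lemma lin_point: "lin V a (point I q v c) = lin V a q + (\<Sum>i\<in>I. c i * lin V a (v i))"
proof -
  have "(\<Sum>j\<in>V. a j * (\<Sum>i\<in>I. c i * v i j)) = (\<Sum>j\<in>V. \<Sum>i\<in>I. a j * (c i * v i j))"
    by (simp only: sum_distrib_left)
  also have "\<dots> = (\<Sum>i\<in>I. \<Sum>j\<in>V. a j * (c i * v i j))" by (rule sum.swap)
  also have "\<dots> = (\<Sum>i\<in>I. c i * lin V a (v i))"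
    unfolding lin_def sum_distrib_left by (intro sum.cong refl) (rule mult.left_commute)
  finally show ?thesis by (simp add: lin_def point_def distrib_left sum.distrib)
qed

lemma frame_scale:
  assumes "frame V I v" "\<And>i. i \<in> I \<Longrightarrow> m i \<noteq> 0"
  shows "frame V I (\<lambda>i j. m i * v i j)"
proof -
  have "\<forall>i\<in>I. c i = 0" if "\<forall>j. (\<Sum>i\<in>I. c i * (m i * v i j)) = 0" for c
  proof -
    have "\<forall>j. (\<Sum>i\<in>I. (c i * m i) * v i j) = 0" using that by (simp add: mult.assoc)
    then have "\<forall>i\<in>I. c i * m i = 0" by (intro frame_zero[OF assms(1)]) simp
    then show ?thesis using assms(2) by simp
  qed
  moreover have "finite I" "\<forall>i\<in>I. (\<lambda>j. m i * v i j) \<in> vectors V"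
    using frame_finite[OF assms(1)] frame_vectors[OF assms(1)] by (simp_all add: vectors_def)
  ultimately show ?thesis unfolding frame_def by blast
qed

lemma frame_remove:
  assumes "frame V I v" shows "frame V (I - {i}) v"
proof -
  have "\<forall>l\<in>I - {i}. c l = 0" if "\<forall>j. (\<Sum>l\<in>I - {i}. c l * v l j) = 0" for c
  proof -
    have eq: "(\<Sum>l\<in>I. (c(i := 0)) l * v l j) = (\<Sum>l\<in>I - {i}. c l * v l j)" for j
      by (rule sum.mono_neutral_cong_right) (use frame_finite[OF assms] in auto)
    have "\<forall>l\<in>I. (c(i := 0)) l = 0"
      by (rule frame_zero[OF assms], unfold eq) (rule spec[OF that])
    then show ?thesis by (metis DiffE fun_upd_other singletonI)
  qed
  moreover have "finite (I - {i})" "\<forall>l\<in>I - {i}. v l \<in> vectors V"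
    using frame_finite[OF assms] frame_vectors[OF assms] by simp_all
  ultimately show ?thesis unfolding frame_def by blast
qed

text \<open>Adding one generator to another is dual to adding the coefficient of the second to that
  of the first.\<close>

lemma sum_shear:
  fixes I :: "nat set" and c :: "nat \<Rightarrow> int"
  assumes "finite I" "i \<in> I" "j \<in> I" "i \<noteq> j"
  shows "(\<Sum>l\<in>I. c l * (v(j := \<lambda>x. v i x + v j x)) l x) = (\<Sum>l\<in>I. (c(i := c i + c j)) l * (v l x :: int))"
proof -
  have *: "(\<Sum>l\<in>I. f l) = f i + f j + (\<Sum>l\<in>I - {i} - {j}. f l)" for f :: "nat \<Rightarrow> int"
    using sum.remove[of I i f] sum.remove[of "I - {i}" j f] assms by simp
  have "(\<Sum>l\<in>I - {i} - {j}. c l * (v(j := \<lambda>x. v i x + v j x)) l x) = (\<Sum>l\<in>I - {i} - {j}. (c(i := c i + c j)) l * v l x)"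
    by (rule sum.cong) auto
  then have "(\<Sum>l\<in>I. c l * (v(j := \<lambda>x. v i x + v j x)) l x) = c i * v i x + c j * (v i x + v j x) +
      (\<Sum>l\<in>I - {i} - {j}. (c(i := c i + c j)) l * v l x)"
    using assms(4) by (subst *) simp
  also have "\<dots> = (c i + c j) * v i x + c j * v j x + (\<Sum>l\<in>I - {i} - {j}. (c(i := c i + c j)) l * v l x)"
    by (simp add: algebra_simps)
  also have "\<dots> = (\<Sum>l\<in>I. (c(i := c i + c j)) l * v l x)"
    using assms(4) by (subst *) simp
  finally show ?thesis .
qed

lemma sum_fun_upd:
  fixes c :: "nat \<Rightarrow> int"
  assumes "finite I" "j \<in> I"
  shows "(\<Sum>l\<in>I. (c(j := t)) l * v l x) = (\<Sum>l\<in>I. c l * v l x) + (t - c j) * v j x"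
proof -
  have "(\<Sum>l\<in>I - {j}. (c(j := t)) l * v l x) = (\<Sum>l\<in>I - {j}. c l * v l x)"
    by (rule sum.cong) auto
  then show ?thesis
    using sum.remove[OF assms, of "\<lambda>l. (c(j := t)) l * v l x"] sum.remove[OF assms, of "\<lambda>l. c l * v l x"]
    by (simp add: algebra_simps)
qed

lemma frame_shear:
  assumes "frame V I v" "i \<in> I" "j \<in> I" "i \<noteq> j"
  shows "frame V I (v(j := \<lambda>x. v i x + v j x))"
proof -
  have fin: "finite I" using assms frame_finite by blast
  have "\<forall>l\<in>I. c l = 0" if "\<forall>x. (\<Sum>l\<in>I. c l * (v(j := \<lambda>x. v i x + v j x)) l x) = 0" for c
  proof -
    have "(\<Sum>l\<in>I. (c(i := c i + c j)) l * v l x) = 0" for x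
      using spec[OF that, of x] sum_shear[OF fin assms(2-4), of c v x] by (simp only:)
    then have "\<forall>l\<in>I. (c(i := c i + c j)) l = 0" by (rule frame_zero[OF assms(1)])
    then have *: "(c(i := c i + c j)) l = 0" if "l \<in> I" for l using that by blast
    have "c j = 0" using *[OF assms(3)] assms(4) by simp
    moreover have "c i + c j = 0" using *[OF assms(2)] by simp
    moreover have "c l = 0" if "l \<in> I" "l \<noteq> i" for l using *[OF that(1)] that(2) by simp
    ultimately show ?thesis by (metis add.right_neutral)
  qed
  moreover have "\<forall>l\<in>I. (v(j := \<lambda>x. v i x + v j x)) l \<in> vectors V"
    using frame_vectors[OF assms(1)] assms(2,3) by (simp add: vectors_def)
  ultimately show ?thesis unfolding frame_def using fin by blast
qed

text \<open>The pieces are c_i \<ge> c_j and c_i < c_j, because c_i v_i + c_j v_j equals (c_i - c_j)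
  v_i + c_j (v_i + v_j) and also v_j + (c_j - c_i - 1) v_j + c_i (v_i + v_j). The shift of the base
  point by \<open>v j\<close> accounts for the strict inequality.\<close>

lemma cone_shear:
  fixes V I :: "nat set" and q :: "nat \<Rightarrow> int" and v :: "nat \<Rightarrow> nat \<Rightarrow> int" and i j :: nat
  assumes "frame V I v" "i \<in> I" "j \<in> I" "i \<noteq> j"
  defines "A \<equiv> cone I q (v(j := \<lambda>x. v i x + v j x))"
    and "B \<equiv> cone I (\<lambda>x. q x + v j x) (v(i := \<lambda>x. v j x + v i x))"
  shows "cone I q v = A \<union> B" "A \<inter> B = {}"
proof -
  have fin: "finite I" using assms frame_finite by blast
  have pA: "point I q (v(j := \<lambda>x. v i x + v j x)) c = point I q v (c(i := c i + c j))" for c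
    unfolding point_def by (rule ext) (simp only: sum_shear[OF fin assms(2-4)])
  have pB: "point I (\<lambda>x. q x + v j x) (v(i := \<lambda>x. v j x + v i x)) c = point I q v (c(j := c j + c i + 1))" for c
  proof -
    have "v j x + (\<Sum>l\<in>I. (c(j := c j + c i)) l * v l x) = (\<Sum>l\<in>I. (c(j := c j + c i + 1)) l * v l x)" for x
      unfolding sum_fun_upd[OF fin assms(3)] by (simp add: algebra_simps)
    then show ?thesis unfolding point_def
      by (intro ext) (simp only: sum_shear[OF fin assms(3,2) assms(4)[symmetric]] add.assoc)
  qed
  have A: "A = point I q v ` {c. (\<forall>i\<in>I. c i \<ge> 0) \<and> c i \<ge> c j}"
  proof (intro equalityI subsetI)
    fix x assume "x \<in> A"
    then obtain c where c: "\<forall>i\<in>I. c i \<ge> 0" "x = point I q v (c(i := c i + c j))"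
      unfolding A_def cone_def by (auto simp: pA)
    then show "x \<in> point I q v ` {c. (\<forall>i\<in>I. c i \<ge> 0) \<and> c i \<ge> c j}"
      using assms(2-4) by auto
  next
    fix x assume "x \<in> point I q v ` {c. (\<forall>i\<in>I. c i \<ge> 0) \<and> c i \<ge> c j}"
    then obtain c where c: "\<forall>i\<in>I. c i \<ge> 0" "c i \<ge> c j" "x = point I q v c" by auto
    define c' where "c' = c(i := c i - c j)"
    have "c'(i := c' i + c' j) = c" using assms(4) by (auto simp: c'_def)
    then have "x = point I q (v(j := \<lambda>x. v i x + v j x)) c'" unfolding pA c(3) by simp
    then show "x \<in> A" unfolding A_def cone_def using c by (auto simp: c'_def)
  qed
  have B: "B = point I q v ` {c. (\<forall>i\<in>I. c i \<ge> 0) \<and> c i < c j}"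
  proof (intro equalityI subsetI)
    fix x assume "x \<in> B"
    then obtain c where c: "\<forall>i\<in>I. c i \<ge> 0" "x = point I q v (c(j := c j + c i + 1))"
      unfolding B_def cone_def by (auto simp: pB)
    moreover have "\<forall>l\<in>I. (c(j := c j + c i + 1)) l \<ge> 0" using c(1) assms(2,3) by auto
    moreover have "(c(j := c j + c i + 1)) i < (c(j := c j + c i + 1)) j" using c(1) assms(2-4) by auto
    ultimately show "x \<in> point I q v ` {c. (\<forall>i\<in>I. c i \<ge> 0) \<and> c i < c j}" by blast
  next
    fix x assume "x \<in> point I q v ` {c. (\<forall>i\<in>I. c i \<ge> 0) \<and> c i < c j}"
    then obtain c where c: "\<forall>i\<in>I. c i \<ge> 0" "c i < c j" "x = point I q v c" by auto
    define c' where "c' = c(j := c j - c i - 1)"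
    have "c'(j := c' j + c' i + 1) = c" using assms(4) by (auto simp: c'_def)
    then have "x = point I (\<lambda>x. q x + v j x) (v(i := \<lambda>x. v j x + v i x)) c'" unfolding pB c(3) by simp
    then show "x \<in> B" unfolding B_def cone_def using c by (auto simp: c'_def)
  qed
  show "cone I q v = A \<union> B" unfolding A B unfolding cone_def image_Un[symmetric]
    by (rule arg_cong[of _ _ "image (point I q v)"]) auto
  show "A \<inter> B = {}"
  proof (rule ccontr)
    assume "A \<inter> B \<noteq> {}"
    then obtain c c' where "c i \<ge> c j" "c' i < c' j" "point I q v c = point I q v c'"
      unfolding A B by auto
    moreover from this have "c i = c' i" "c j = c' j"
      using point_inj[OF assms(1)] assms(2,3) by blast+
    ultimately show False by simp
  qed
qed

text \<open>The pieces are those with coordinate zero and with positive coordinate at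
  \<open>i\<close>. Iteration slides the cone along \<open>v i\<close> and leaves behind slices with
  one generator fewer.\<close>

lemma cone_peel:
  assumes "frame V I v" "i \<in> I"
  shows "cone I q v = cone (I - {i}) q v \<union> cone I (\<lambda>x. q x + v i x) v"
    "cone (I - {i}) q v \<inter> cone I (\<lambda>x. q x + v i x) v = {}"
proof -
  have fin: "finite I" using assms frame_finite by blast
  have pA: "point (I - {i}) q v c = point I q v (c(i := 0))" for c
  proof -
    have "(\<Sum>l\<in>I. (c(i := 0)) l * v l x) = (\<Sum>l\<in>I - {i}. c l * v l x)" for x
      unfolding sum_fun_upd[OF fin assms(2)] sum.remove[OF fin assms(2)] by simp
    then show ?thesis unfolding point_def by (simp only:)
  qed
  have pB: "point I (\<lambda>x. q x + v i x) v c = point I q v (c(i := c i + 1))" for c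
    unfolding point_def sum_fun_upd[OF fin assms(2)] by (simp add: algebra_simps)
  have A: "cone (I - {i}) q v = point I q v ` {c. (\<forall>i\<in>I. c i \<ge> 0) \<and> c i = 0}"
  proof (intro equalityI subsetI)
    fix x assume "x \<in> cone (I - {i}) q v"
    then show "x \<in> point I q v ` {c. (\<forall>i\<in>I. c i \<ge> 0) \<and> c i = 0}"
      unfolding cone_def pA by auto
  next
    fix x assume "x \<in> point I q v ` {c. (\<forall>i\<in>I. c i \<ge> 0) \<and> c i = 0}"
    then obtain c where c: "\<forall>i\<in>I. c i \<ge> 0" "c i = 0" "x = point I q v c" by auto
    moreover have "c(i := 0) = c" using c(2) by auto
    ultimately show "x \<in> cone (I - {i}) q v"
      unfolding cone_def pA by (intro image_eqI[of _ _ c]) auto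
  qed
  have B: "cone I (\<lambda>x. q x + v i x) v = point I q v ` {c. (\<forall>i\<in>I. c i \<ge> 0) \<and> c i > 0}"
  proof (intro equalityI subsetI)
    fix x assume "x \<in> cone I (\<lambda>x. q x + v i x) v"
    then obtain c where "\<forall>i\<in>I. c i \<ge> 0" "x = point I q v (c(i := c i + 1))"
      unfolding cone_def by (auto simp: pB)
    then show "x \<in> point I q v ` {c. (\<forall>i\<in>I. c i \<ge> 0) \<and> c i > 0}"
      using assms(2) by (intro image_eqI[of _ _ "c(i := c i + 1)"]) auto
  next
    fix x assume "x \<in> point I q v ` {c. (\<forall>i\<in>I. c i \<ge> 0) \<and> c i > 0}"
    then obtain c where c: "\<forall>i\<in>I. c i \<ge> 0" "c i > 0" "x = point I q v c" by auto
    define c' where "c' = c(i := c i - 1)"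
    have "c'(i := c' i + 1) = c" by (auto simp: c'_def)
    then have "x = point I (\<lambda>x. q x + v i x) v c'" unfolding pB c(3) by simp
    then show "x \<in> cone I (\<lambda>x. q x + v i x) v" unfolding cone_def using c by (auto simp: c'_def)
  qed
  show "cone I q v = cone (I - {i}) q v \<union> cone I (\<lambda>x. q x + v i x) v"
    unfolding A B unfolding cone_def image_Un[symmetric]
    using assms(2) by (intro arg_cong[of _ _ "image (point I q v)"]) auto
  show "cone (I - {i}) q v \<inter> cone I (\<lambda>x. q x + v i x) v = {}"
  proof (rule ccontr)
    assume "cone (I - {i}) q v \<inter> cone I (\<lambda>x. q x + v i x) v \<noteq> {}"
    then obtain c c' where "c i = 0" "c' i > 0" "point I q v c = point I q v c'"
      unfolding A B by auto
    moreover from this have "c i = c' i"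
      using point_inj[OF assms(1)] assms(2) by blast
    ultimately show False by simp
  qed
qed

text \<open>Division of each coordinate by \<open>m i\<close>: the remainders move the base point
  and the quotients are the new coordinates. Remainder vectors are extensional, so different ones
  differ at some index in \<open>I\<close>.\<close>

lemma cone_scale:
  fixes V I :: "nat set" and q :: "nat \<Rightarrow> int" and v :: "nat \<Rightarrow> nat \<Rightarrow> int" and m :: "nat \<Rightarrow> int"
  assumes "frame V I v" "\<And>i. i \<in> I \<Longrightarrow> m i > 0"
  defines "A \<equiv> \<lambda>r. cone I (point I q v r) (\<lambda>i j. m i * v i j)"
  shows "cone I q v = (\<Union>r\<in>(\<Pi>\<^sub>E i\<in>I. {0..<m i}). A r)"
    "disjoint_family_on A (\<Pi>\<^sub>E i\<in>I. {0..<m i})"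
proof -
  have p: "point I (point I q v r) (\<lambda>i j. m i * v i j) c = point I q v (\<lambda>i. r i + m i * c i)" for r c
    by (simp add: point_def algebra_simps sum.distrib)
  show "cone I q v = (\<Union>r\<in>(\<Pi>\<^sub>E i\<in>I. {0..<m i}). A r)"
  proof (intro equalityI subsetI)
    fix x assume "x \<in> cone I q v"
    then obtain c where c: "\<forall>i\<in>I. c i \<ge> 0" "x = point I q v c" unfolding cone_def by auto
    define r where "r = restrict (\<lambda>i. c i mod m i) I"
    have "x = point I (point I q v r) (\<lambda>i j. m i * v i j) (\<lambda>i. c i div m i)"
      unfolding p c(2) by (rule point_cong) (simp add: r_def)
    then have "x \<in> A r" unfolding A_def cone_def using c(1) assms(2)
      by (auto simp: pos_imp_zdiv_nonneg_iff)
    moreover have "r \<in> (\<Pi>\<^sub>E i\<in>I. {0..<m i})" using assms(2) by (auto simp: r_def)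
    ultimately show "x \<in> (\<Union>r\<in>(\<Pi>\<^sub>E i\<in>I. {0..<m i}). A r)" by blast
  next
    fix x assume "x \<in> (\<Union>r\<in>(\<Pi>\<^sub>E i\<in>I. {0..<m i}). A r)"
    then obtain r c where r: "r \<in> (\<Pi>\<^sub>E i\<in>I. {0..<m i})" and c: "\<forall>i\<in>I. c i \<ge> 0"
      "x = point I q v (\<lambda>i. r i + m i * c i)" unfolding A_def cone_def by (auto simp: p)
    have "r i + m i * c i \<ge> 0" if "i \<in> I" for i
    proof -
      have "r i \<ge> 0" using r that by (auto simp: PiE_def Pi_def)
      moreover have "m i * c i \<ge> 0" using c(1) assms(2) that by (intro mult_nonneg_nonneg) (auto simp: less_imp_le)
      ultimately show ?thesis by simp
    qed
    then show "x \<in> cone I q v" unfolding cone_def c(2) by blast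
  qed
  show "disjoint_family_on A (\<Pi>\<^sub>E i\<in>I. {0..<m i})"
    unfolding disjoint_family_on_def
  proof (intro ballI impI, rule ccontr)
    fix r r' assume r: "r \<in> (\<Pi>\<^sub>E i\<in>I. {0..<m i})" "r' \<in> (\<Pi>\<^sub>E i\<in>I. {0..<m i})" and "r \<noteq> r'" "A r \<inter> A r' \<noteq> {}"
    then obtain c c' where "point I q v (\<lambda>i. r i + m i * c i) = point I q v (\<lambda>i. r' i + m i * c' i)"
      unfolding A_def cone_def by (auto simp: p)
    then have *: "r i + m i * c i = r' i + m i * c' i" if "i \<in> I" for i
      using point_inj[OF assms(1)] that by meson
    have "r i = r' i" if "i \<in> I" for i
    proof -
      have "(r i + m i * c i) mod m i = (r' i + m i * c' i) mod m i" using *[OF that] by simp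
      moreover have "r i \<in> {0..<m i}" "r' i \<in> {0..<m i}" using r that by (auto simp: PiE_def Pi_def)
      ultimately show ?thesis by simp
    qed
    then show False using r \<open>r \<noteq> r'\<close> by (metis PiE_ext)
  qed
qed

text \<open>The sign of a mixed pair of coefficients is resolved by comparing the two cone coordinates:
  in either case one of the two coefficients becomes zero.\<close>
lemma splits_halfspace_unit:
  assumes "q \<in> vectors V" "frame V I v" "w > 0" "\<And>i. i \<in> I \<Longrightarrow> lin V a (v i) \<in> {- w, 0, w}"
  shows "splits V {x. lin V a x \<le> b} (cone I q v)"
  using assms
proof (induction "card {i\<in>I. lin V a (v i) \<noteq> 0}" arbitrary: I q v rule: less_induct)
  case less
  let ?H = "{x. lin V a x \<le> b}" and ?N = "\<lambda>I v. {i\<in>I. lin V a (v i) \<noteq> 0}"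
  have fin: "finite I" using less.prems frame_finite by blast
  have lin_add: "lin V a (\<lambda>x. f x + g x) = lin V a f + lin V a g" for f g
    by (simp add: lin_def distrib_left sum.distrib)
  show ?case
  proof (cases "\<exists>i\<in>I. \<exists>j\<in>I. lin V a (v i) = w \<and> lin V a (v j) = - w")
    case True
    then obtain i j where ij: "i \<in> I" "j \<in> I" "lin V a (v i) = w" "lin V a (v j) = - w" by blast
    have ne: "i \<noteq> j" using ij(3,4) less.prems(3) by auto
    let ?v1 = "v(j := \<lambda>x. v i x + v j x)" and ?v2 = "v(i := \<lambda>x. v j x + v i x)"
    \<comment> \<open>The form vanishes on the new generator, since w - w = 0, and the other
      generators are unchanged. So in both pieces the form is nonzero on fewer generators.\<close>
    have "?N I ?v1 \<subseteq> ?N I v - {j}" "?N I ?v2 \<subseteq> ?N I v - {i}"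
      using ij by (auto simp: lin_add)
    moreover have "i \<in> ?N I v" "j \<in> ?N I v" using ij less.prems(3) by auto
    ultimately have "?N I ?v1 \<subset> ?N I v" "?N I ?v2 \<subset> ?N I v" by blast+
    then have card: "card (?N I ?v1) < card (?N I v)" "card (?N I ?v2) < card (?N I v)"
      by (auto intro!: psubset_card_mono simp: fin simp del: fun_upd_apply)
    have frames: "frame V I ?v1" "frame V I ?v2"
      by (rule frame_shear[OF less.prems(2)]; use ij(1,2) ne in simp)+
    have q': "(\<lambda>x. q x + v j x) \<in> vectors V"
      using less.prems(1) frame_vectors[OF less.prems(2) ij(2)] by (auto simp: vectors_def)
    have vals: "lin V a (?v1 l) \<in> {- w, 0, w}" "lin V a (?v2 l) \<in> {- w, 0, w}" if "l \<in> I" for l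
      using less.prems(4)[OF that] ij by (auto simp: lin_add)
    have "splits V ?H (cone I q ?v1)"
      by (rule less.hyps[OF card(1) less.prems(1) frames(1) less.prems(3) vals(1)])
    moreover have "splits V ?H (cone I (\<lambda>x. q x + v j x) ?v2)"
      by (rule less.hyps[OF card(2) q' frames(2) less.prems(3) vals(2)])
    ultimately have "splits V ?H (cone I q ?v1 \<union> cone I (\<lambda>x. q x + v j x) ?v2)"
      by (rule splits_Un[OF _ _ cone_shear(2)[OF less.prems(2) ij(1,2) ne]])
    then show ?thesis
      unfolding cone_shear(1)[OF less.prems(2) ij(1,2) ne]
      .
  next
    \<comment> \<open>All nonzero values now have the same sign, so a translation far enough along a
      generator with nonzero value brings the whole cone to one side.\<close>
    case F: False
    show ?thesis
    proof (cases "?N I v = {}")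
      case True
      then have "lin V a x = lin V a q" if "x \<in> cone I q v" for x
        using that by (auto simp: cone_def lin_point)
      then show ?thesis
        using less.prems(1,2) by (intro splits_trivial decomposable_cone) auto
    next
      case False
      then obtain i where i: "i \<in> I" "lin V a (v i) \<noteq> 0" by blast
      have "?N (I - {i}) v \<subset> ?N I v" using i by auto
      then have c: "card (?N (I - {i}) v) < card (?N I v)" using fin by (simp add: psubset_card_mono)
      define s where "s n = (\<lambda>x. q x + int n * v i x)" for n
      have s: "s n \<in> vectors V" for n
        using less.prems(1) frame_vectors[OF less.prems(2) i(1)] by (auto simp: vectors_def s_def)
      have ls: "lin V a (s n) = lin V a q + int n * lin V a (v i)" for n
        unfolding s_def lin_add by (simp add: lin_def sum_distrib_left mult.left_commute)
      have peeled: "splits V ?H (cone (I - {i}) (s n) v)" for n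
        using less.hyps[OF c s frame_remove[OF less.prems(2)] less.prems(3)] less.prems(4) by blast
      \<comment> \<open>Going back one step of the translation only adds the slice without the
        generator \<open>i\<close>, which the induction hypothesis covers.\<close>
      have down: "splits V ?H (cone I (s n) v)" if "splits V ?H (cone I (s (Suc n)) v)" for n
      proof -
        have "s (Suc n) = (\<lambda>x. s n x + v i x)" by (auto simp: s_def algebra_simps)
        then show ?thesis
          using cone_peel[OF less.prems(2) i(1), of "s n"] splits_Un[OF peeled that] by simp
      qed
      \<comment> \<open>Since \<open>w\<close> is at least 1, moving \<open>n\<close> steps changes
        the form by more than the distance between \<open>b\<close> and its value at
        \<open>q\<close>; this works for either sign.\<close>
      define n where "n = nat (\<bar>b - lin V a q\<bar> + 1)"
      have n: "int n > \<bar>b - lin V a q\<bar>" by (simp add: n_def)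
      have nw: "int n * w \<ge> int n" using less.prems(3) by (simp add: mult_le_cancel_left1)
      have "cone I (s n) v \<subseteq> ?H \<or> cone I (s n) v \<inter> ?H = {}"
      proof (cases "lin V a (v i) = w")
        case True
        then have "\<forall>j\<in>I. lin V a (v j) \<ge> 0" using F less.prems(3,4) i(1) by fastforce
        then have "lin V a x \<ge> lin V a (s n)" if "x \<in> cone I (s n) v" for x
          using that by (auto simp: cone_def lin_point intro!: sum_nonneg)
        moreover have "lin V a (s n) > b" using n nw by (simp add: ls True)
        ultimately show ?thesis by fastforce
      next
        case False
        then have iw: "lin V a (v i) = - w" using less.prems(4)[OF i(1)] i(2) by auto
        then have "\<forall>j\<in>I. lin V a (v j) \<le> 0" using F less.prems(3,4) i(1) by fastforce
        then have "lin V a x \<le> lin V a (s n)" if "x \<in> cone I (s n) v" for x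
          using that by (auto simp: cone_def lin_point intro!: sum_nonpos mult_nonneg_nonpos)
        moreover have "lin V a (s n) \<le> b" using n nw by (simp add: ls iw)
        ultimately show ?thesis by fastforce
      qed
      then have "splits V ?H (cone I (s n) v)"
        by (intro splits_trivial decomposable_cone s less.prems(2))
      then have "splits V ?H (cone I (s 0) v)" by (induction n) (auto intro: down)
      then show ?thesis by (simp add: s_def)
    qed
  qed
qed

lemma splits_halfspace:
  assumes "q \<in> vectors V" "frame V I v"
  shows "splits V {x. lin V a x \<le> b} (cone I q v)"
proof -
  have fin: "finite I" using assms frame_finite by blast
  define u where "u i = lin V a (v i)" for i
  \<comment> \<open>A common multiple of the nonzero values of the form; \<open>m i\<close> is the
    complementary factor, and it is 1 where the form vanishes.\<close>
  define w where "w = (\<Prod>i\<in>{i\<in>I. u i \<noteq> 0}. \<bar>u i\<bar>)"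
  define m where "m i = (if u i = 0 then 1 else w div \<bar>u i\<bar>)" for i
  have w: "w > 0" unfolding w_def by (intro prod_pos) auto
  have dv: "m i * \<bar>u i\<bar> = w" if "i \<in> I" "u i \<noteq> 0" for i
  proof -
    have "\<bar>u i\<bar> dvd w" unfolding w_def using fin that by (intro dvd_prodI) auto
    then show ?thesis using that by (simp add: m_def)
  qed
  have m: "m i > 0" if "i \<in> I" for i
    using dv[OF that] w by (cases "u i = 0") (simp add: m_def, metis zero_less_abs_iff zero_less_mult_pos2)
  have fs: "frame V I (\<lambda>i j. m i * v i j)"
    by (rule frame_scale[OF assms(2)]) (use m in fastforce)
  have "splits V {x. lin V a x \<le> b} (\<Union>r\<in>(\<Pi>\<^sub>E i\<in>I. {0..<m i}). cone I (point I q v r) (\<lambda>i j. m i * v i j))"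
  proof (rule splits_UN[OF _ _ cone_scale(2)[OF assms(2) m]])
    show "finite (\<Pi>\<^sub>E i\<in>I. {0..<m i})" using fin by (intro finite_PiE) auto
  next
    fix r
    have "lin V a (\<lambda>j. m i * v i j) \<in> {- w, 0, w}" if "i \<in> I" for i
    proof -
      have "lin V a (\<lambda>j. m i * v i j) = m i * u i"
        by (simp add: lin_def u_def sum_distrib_left mult.left_commute)
      then show ?thesis using dv[OF that] by (cases "u i > 0"; cases "u i = 0") (auto simp: abs_if)
    qed
    then show "splits V {x. lin V a x \<le> b} (cone I (point I q v r) (\<lambda>i j. m i * v i j))"
      by (intro splits_halfspace_unit[OF point_in_vectors[OF assms] fs w])
  qed auto
  then show ?thesis using cone_scale(1)[OF assms(2) m] by simp
qed

lemma decomposable_splits_halfspace: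
  assumes "decomposable V A" shows "splits V {x. lin V a x \<le> b} A"
proof -
  obtain \<A> where A: "finite \<A>" "disjoint \<A>" "A = \<Union>\<A>"
    "\<forall>S\<in>\<A>. \<exists>I q v. q \<in> vectors V \<and> frame V I v \<and> S = cone I q v"
    using assms unfolding decomposable_def by blast
  have "splits V {x. lin V a x \<le> b} (\<Union>S\<in>\<A>. S)"
  proof (rule splits_UN[OF A(1)])
    show "splits V {x. lin V a x \<le> b} S" if SA: "S \<in> \<A>" for S
    proof -
      obtain I q v where "q \<in> vectors V" "frame V I v" "S = cone I q v"
        using bspec[OF A(4) SA] by blast
      then show ?thesis using splits_halfspace by simp
    qed
    show "disjoint_family_on (\<lambda>S. S) \<A>"
      using A(2) by (auto simp: disjoint_family_on_def disjoint_def)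
  qed
  then show ?thesis by (simp add: A(3))
qed

text \<open>Once all generators are multiplied by \<open>M\<close>, the points of a cone are
  congruent modulo \<open>M\<close> to its base point, so the cone lies entirely inside or entirely
  outside \<open>S\<close>.\<close>

lemma decomposable_inter_congruence:
  assumes "decomposable V A" "M > 0" "\<And>x y. eqv V {} M x y \<Longrightarrow> x \<in> S \<longleftrightarrow> y \<in> S"
  shows "decomposable V (A \<inter> S)"
proof -
  obtain \<A> where A: "finite \<A>" "disjoint \<A>" "A = \<Union>\<A>"
    "\<forall>S\<in>\<A>. \<exists>I q v. q \<in> vectors V \<and> frame V I v \<and> S = cone I q v"
    using assms(1) unfolding decomposable_def by blast
  have "splits V S T" if TA: "T \<in> \<A>" for T
  proof -
    obtain I q v where T: "q \<in> vectors V" "frame V I v" "T = cone I q v"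
      using bspec[OF A(4) TA] by blast
    note scale = cone_scale[OF T(2), of "\<lambda>_. M", OF assms(2)]
    have fs: "frame V I (\<lambda>i j. M * v i j)"
      using frame_scale[OF T(2), of "\<lambda>_. M"] assms(2) by simp
    have "splits V S (\<Union>r\<in>(\<Pi>\<^sub>E i\<in>I. {0..<M}). cone I (point I q v r) (\<lambda>i j. M * v i j))"
    proof (rule splits_UN[OF _ _ scale(2)])
      show "finite (\<Pi>\<^sub>E i\<in>I. {0..<M})" using frame_finite[OF T(2)] by (intro finite_PiE) auto
    next
      fix r
      have "x \<in> S \<longleftrightarrow> point I q v r \<in> S" if "x \<in> cone I (point I q v r) (\<lambda>i j. M * v i j)" for x
      proof (rule assms(3))
        obtain c where "x = point I (point I q v r) (\<lambda>i j. M * v i j) c"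
          using \<open>x \<in> _\<close> unfolding cone_def by blast
        then show "eqv V {} M x (point I q v r)"
          unfolding eqv_def by (simp add: point_def dvd_sum)
      qed
      then have "cone I (point I q v r) (\<lambda>i j. M * v i j) \<subseteq> S \<or> cone I (point I q v r) (\<lambda>i j. M * v i j) \<inter> S = {}"
        by blast
      then show "splits V S (cone I (point I q v r) (\<lambda>i j. M * v i j))"
        by (intro splits_trivial decomposable_cone point_in_vectors[OF T(1,2)] fs)
    qed
    then show ?thesis using scale(1) T(3) by simp
  qed
  moreover have "disjoint_family_on (\<lambda>T. T) \<A>"
    using A(2) by (auto simp: disjoint_family_on_def disjoint_def)
  ultimately have "splits V S (\<Union>T\<in>\<A>. T)" by (rule splits_UN[OF A(1)])
  then show ?thesis by (simp add: A(3) splits_def)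
qed

lemma decomposable_inter_presb:
  assumes "decomposable V A" "presb V S" shows "decomposable V (A \<inter> S)"
proof -
  obtain L M where LM: "finite L" "M > 0" "\<forall>x y. eqv V L M x y \<longrightarrow> (x \<in> S \<longleftrightarrow> y \<in> S)"
    using assms(2) unfolding presb_def by blast
  show ?thesis using LM(1) assms(1) LM(3)
  proof (induction L arbitrary: A S rule: finite_induct)
    case empty
    then show ?case using decomposable_inter_congruence[OF _ LM(2)] by blast
  next
    case (insert ab L)
    obtain a b where ab: "ab = (a, b)" by fastforce
    define H where "H = {x. lin V a x \<le> b}"
    \<comment> \<open>\<open>S\<close> need not be invariant under the relation with one inequality
      fewer, so the induction is applied to the saturations of its two halves. A class of the finer
      relation is a class of the coarser one cut by \<open>H\<close> or by its complement, hence the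
      saturations cut back to \<open>S \<inter> H\<close> and \<open>S - H\<close>.\<close>
    define S1 where "S1 = {x. \<exists>y\<in>S \<inter> H. eqv V L M x y}"
    define S2 where "S2 = {x. \<exists>y\<in>S - H. eqv V L M x y}"
    have inv: "\<forall>x y. eqv V L M x y \<longrightarrow> (x \<in> S1 \<longleftrightarrow> y \<in> S1)" "\<forall>x y. eqv V L M x y \<longrightarrow> (x \<in> S2 \<longleftrightarrow> y \<in> S2)"
      unfolding S1_def S2_def by (blast intro: eqv_trans eqv_sym)+
    have ins: "eqv V (insert ab L) M x y \<longleftrightarrow> eqv V L M x y \<and> (x \<in> H \<longleftrightarrow> y \<in> H)" for x y
      by (auto simp: eqv_def ab H_def)
    have eq: "S1 \<inter> H = S \<inter> H" "S2 - H = S - H"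
      using insert.prems(2) eqv_refl[of V L M] unfolding S1_def S2_def ins by blast+
    have sp: "decomposable V (A \<inter> H)" "decomposable V (A - H)"
      using decomposable_splits_halfspace[OF insert.prems(1)] by (auto simp: splits_def H_def)
    have "decomposable V ((A \<inter> H) \<inter> S1)" "decomposable V ((A - H) \<inter> S2)"
      using insert.IH[OF sp(1) inv(1)] insert.IH[OF sp(2) inv(2)] by auto
    then have "decomposable V (((A \<inter> H) \<inter> S1) \<union> ((A - H) \<inter> S2))"
      by (rule decomposable_Un) blast
    moreover have "((A \<inter> H) \<inter> S1) \<union> ((A - H) \<inter> S2) = A \<inter> S" using eq by blast
    ultimately show ?case by simp
  qed
qed

text \<open>Z^V is partitioned by the set \<open>J\<close> of negative coordinates. On
  \<open>J\<close> the base point is -1 and the generators point downwards, so that 0 belongs to the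
  nonnegative side only.\<close>

lemma decomposable_vectors: assumes "finite V" shows "decomposable V (vectors V)"
proof -
  define e where "e J = (\<lambda>i j. if i = j then (if i \<in> J then -1 else 1 :: int) else 0)" for J :: "nat set"
  define q where "q J = (\<lambda>j. if j \<in> J then -1 else 0 :: int)" for J :: "nat set"
  have sum: "(\<Sum>i\<in>V. c i * e J i j) = (if j \<in> V then (if j \<in> J then - c j else c j) else 0)" for J c j
  proof -
    have "(\<Sum>i\<in>V. c i * e J i j) = (\<Sum>i\<in>V. if i = j then (if j \<in> J then - c j else c j) else 0)"
      by (rule sum.cong) (auto simp: e_def)
    then show ?thesis using assms by simp
  qed
  have frame: "frame V V (e J)" for J
    unfolding frame_def sum using assms by (auto simp: vectors_def e_def split: if_splits)
  have point: "point V (q J) (e J) c = (\<lambda>j. if j \<in> V then (if j \<in> J then - 1 - c j else c j) else 0)"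
    if "J \<subseteq> V" for J c
    unfolding point_def sum q_def using that by (intro ext) auto
  have cone: "cone V (q J) (e J) = {x\<in>vectors V. {j\<in>V. x j < 0} = J}" if "J \<subseteq> V" for J
  proof (intro equalityI subsetI)
    fix x assume "x \<in> cone V (q J) (e J)"
    then show "x \<in> {x\<in>vectors V. {j\<in>V. x j < 0} = J}"
    proof -
      obtain c where c: "\<forall>i\<in>V. c i \<ge> 0" "x = point V (q J) (e J) c"
        using \<open>x \<in> cone V (q J) (e J)\<close> unfolding cone_def by blast
      have "x j < 0 \<longleftrightarrow> j \<in> J" if "j \<in> V" for j
        using bspec[OF c(1) that] that unfolding c(2) point[OF \<open>J \<subseteq> V\<close>] by simp
      then show ?thesis using that unfolding c(2) point[OF that] vectors_def by auto
    qed
  next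
    fix x assume x: "x \<in> {x\<in>vectors V. {j\<in>V. x j < 0} = J}"
    define c where "c j = (if j \<in> J then - 1 - x j else x j)" for j
    have "x = point V (q J) (e J) c" unfolding point[OF that] using x by (auto simp: c_def vectors_def)
    moreover have "\<forall>i\<in>V. c i \<ge> 0" using x by (auto simp: c_def)
    ultimately show "x \<in> cone V (q J) (e J)" unfolding cone_def by blast
  qed
  have "decomposable V (\<Union>J\<in>Pow V. cone V (q J) (e J))"
  proof (rule decomposable_UN)
    show "decomposable V (cone V (q J) (e J))" if "J \<in> Pow V" for J
      using that by (intro decomposable_cone frame) (auto simp: vectors_def q_def)
    show "disjoint_family_on (\<lambda>J. cone V (q J) (e J)) (Pow V)"
      unfolding disjoint_family_on_def
    proof (intro ballI impI)
      fix J J' assume "J \<in> Pow V" "J' \<in> Pow V" "J \<noteq> J'"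
      then show "cone V (q J) (e J) \<inter> cone V (q J') (e J') = {}"
        using cone[of J] cone[of J'] by blast
    qed
  qed (use assms in simp)
  moreover have "(\<Union>J\<in>Pow V. cone V (q J) (e J)) = vectors V"
  proof -
    have "(\<Union>J\<in>Pow V. cone V (q J) (e J)) = (\<Union>J\<in>Pow V. {x\<in>vectors V. {j\<in>V. x j < 0} = J})"
      by (intro SUP_cong refl cone) simp
    also have "\<dots> = vectors V"
    proof (intro equalityI subsetI)
      fix x assume "x \<in> vectors V"
      then show "x \<in> (\<Union>J\<in>Pow V. {x\<in>vectors V. {j\<in>V. x j < 0} = J})"
        by (intro UN_I[of "{j\<in>V. x j < 0}"]) auto
    qed blast
    finally show ?thesis .
  qed
  ultimately show ?thesis by simp
qed

section \<open>Semisimple sets of lists and Presburger sets\<close>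

abbreviation listing :: "nat \<Rightarrow> (nat \<Rightarrow> int) \<Rightarrow> int list" where
  "listing k x \<equiv> map x [0..<k]"

lemma simple_set_cone:
  assumes "q \<in> vectors {..<k}" "frame {..<k} I v"
  shows "simple_set k (listing k ` cone I q v)"
proof -
  have fin: "finite I" using assms frame_finite by blast
  define xs where "xs = sorted_list_of_set I"
  have ii: "set xs = I" "distinct xs" using fin by (auto simp: xs_def)
  define vs where "vs = map (\<lambda>i. listing k (v i)) xs"
  have bij: "bij_betw (\<lambda>t. xs ! t) {..<length xs} I"
    using bij_betw_nth[OF ii(2) refl] ii(1) by simp
  have comb: "lincomb k (map c xs) vs = listing k (\<lambda>j. \<Sum>i\<in>I. c i * v i j)" for c
  proof -
    have "(\<Sum>t<length xs. c (xs ! t) * v (xs ! t) j) = (\<Sum>i\<in>I. c i * v i j)" for j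
      using sum.reindex_bij_betw[OF bij, of "\<lambda>i. c i * v i j"] .
    then show ?thesis by (simp add: lincomb_def vs_def)
  qed
  \<comment> \<open>The enumeration \<open>xs\<close> has no repetitions, so every list of
    coefficients is read off from a function on \<open>I\<close>; \<open>pos\<close> inverts the
    enumeration.\<close>
  have all: "\<exists>c. cs = map c xs" if "length cs = length vs" for cs :: "int list"
  proof -
    have "\<forall>i\<in>I. \<exists>!t. t < length xs \<and> xs ! t = i"
      using ii by (metis distinct_Ex1)
    define pos where "pos i = (THE t. t < length xs \<and> xs ! t = i)" for i
    have "pos (xs ! t) = t" if "t < length xs" for t
      unfolding pos_def using that ii(2) by (auto simp: nth_eq_iff_index_eq)
    then have "cs = map (\<lambda>i. cs ! pos i) xs"
      using that by (intro nth_equalityI) (auto simp: vs_def)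
    then show ?thesis by blast
  qed
  have "lin_indep k vs"
    unfolding lin_indep_def
  proof (intro conjI allI impI)
    fix cs assume cs: "length cs = length vs" "lincomb k cs vs = replicate k 0"
    obtain c where c: "cs = map c xs" using all[OF cs(1)] by blast
    have "(\<Sum>i\<in>I. c i * v i j) = 0" for j
    proof (cases "j < k")
      case True
      then show ?thesis using arg_cong[OF cs(2), of "\<lambda>l. l ! j"] by (simp add: c comb)
    next
      case False
      then show ?thesis using frame_vectors[OF assms(2)] by (auto simp: vectors_def intro!: sum.neutral)
    qed
    then have "\<forall>i\<in>I. c i = 0" by (rule frame_zero[OF assms(2)])
    then show "\<forall>c\<in>set cs. c = 0" using ii by (auto simp: c)
  qed (auto simp: vs_def)
  moreover have "listing k ` cone I q v =
    {vadd (listing k q) (lincomb k cs vs) | cs. length cs = length vs \<and> (\<forall>c\<in>set cs. c \<ge> 0)}" (is "_ = ?R")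
  proof (intro equalityI subsetI)
    have vadd: "vadd (listing k q) (listing k f) = listing k (\<lambda>j. q j + f j)" for f
      by (auto simp: vadd_def intro!: nth_equalityI)
    {
      fix x assume "x \<in> listing k ` cone I q v"
      then obtain c where c: "\<forall>i\<in>I. c i \<ge> 0" "x = listing k (point I q v c)" unfolding cone_def by blast
      have "x = vadd (listing k q) (lincomb k (map c xs) vs)"
        by (simp add: comb vadd c(2) point_def)
      then show "x \<in> ?R" using c(1) ii(1) by (auto intro!: exI[of _ "map c xs"] simp: vs_def)
    next
      fix x assume "x \<in> ?R"
      then obtain cs where cs: "x = vadd (listing k q) (lincomb k cs vs)" "length cs = length vs" "\<forall>c\<in>set cs. c \<ge> 0"
        by blast
      obtain c where c: "cs = map c xs" using all[OF cs(2)] by blast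
      have "x = listing k (point I q v c)" by (simp add: cs(1) c comb vadd point_def)
      moreover have "\<forall>i\<in>I. c i \<ge> 0" using cs(3) ii(1) by (auto simp: c)
      ultimately show "x \<in> listing k ` cone I q v" unfolding cone_def by blast
    }
  qed
  moreover have "length (listing k q) = k" by simp
  ultimately show ?thesis unfolding simple_set_def by blast
qed

lemma listing_nth: "length n = k \<Longrightarrow> listing k ((!) n) = n"
  by (metis map_nth)

lemma semisimple_presb:
  assumes "presb {..<k} S" shows "semisimple k {n. length n = k \<and> (!) n \<in> S}"
proof -
  let ?V = "{..<k}"
  have "decomposable ?V (vectors ?V \<inter> S)"
    by (intro decomposable_inter_presb decomposable_vectors assms) simp
  then obtain \<A> where A: "finite \<A>" "disjoint \<A>" "vectors ?V \<inter> S = \<Union>\<A>"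
    "\<forall>T\<in>\<A>. \<exists>I q v. q \<in> vectors ?V \<and> frame ?V I v \<and> T = cone I q v"
    unfolding decomposable_def by blast
  \<comment> \<open>Repetitions are excluded because \<open>semisimple\<close> demands disjointness
    for different positions of the list.\<close>
  obtain ts where ts: "set ts = \<A>" "distinct ts" using finite_distinct_list[OF A(1)] by blast
  have inj: "x = y" if "x \<in> vectors ?V" "y \<in> vectors ?V" "listing k x = listing k y" for x y
  proof
    fix j
    show "x j = y j"
      using that arg_cong[OF that(3), of "\<lambda>l. l ! j"] by (cases "j < k") (auto simp: vectors_def)
  qed
  have "{n. length n = k \<and> (!) n \<in> S} = listing k ` (vectors ?V \<inter> S)"
  proof (intro equalityI subsetI)
    fix n assume n: "n \<in> {n. length n = k \<and> (!) n \<in> S}"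
    define x where "x j = (if j < k then n ! j else 0)" for j
    have "x \<in> S \<longleftrightarrow> (!) n \<in> S" by (rule presb_determined[OF assms]) (simp add: x_def)
    moreover have "listing k x = n" using n by (intro nth_equalityI) (auto simp: x_def)
    moreover have "x \<in> vectors ?V" by (auto simp: x_def vectors_def)
    ultimately show "n \<in> listing k ` (vectors ?V \<inter> S)" using n by blast
  next
    fix n assume "n \<in> listing k ` (vectors ?V \<inter> S)"
    then obtain x where x: "x \<in> S" "n = listing k x" by auto
    have "x \<in> S \<longleftrightarrow> (!) n \<in> S" by (rule presb_determined[OF assms]) (simp add: x)
    then show "n \<in> {n. length n = k \<and> (!) n \<in> S}" using x by simp
  qed
  also have "\<dots> = \<Union>(set (map ((`) (listing k)) ts))" using A(3) ts(1) by auto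
  finally have 1: "{n. length n = k \<and> (!) n \<in> S} = \<Union>(set (map ((`) (listing k)) ts))" .
  have 2: "\<forall>T\<in>set (map ((`) (listing k)) ts). simple_set k T"
    using A(4) ts(1) simple_set_cone by fastforce
  have 3: "map ((`) (listing k)) ts ! i \<inter> map ((`) (listing k)) ts ! j = {}"
    if "i < length ts" "j < length ts" "i \<noteq> j" for i j
  proof -
    have "ts ! i \<in> \<A>" "ts ! j \<in> \<A>" "ts ! i \<noteq> ts ! j"
      using ts that by (auto simp: nth_eq_iff_index_eq)
    then have "ts ! i \<inter> ts ! j = {}" "ts ! i \<subseteq> vectors ?V" "ts ! j \<subseteq> vectors ?V"
      using A(2,3) by (auto simp: disjoint_def)
    then have "listing k ` (ts ! i) \<inter> listing k ` (ts ! j) = {}"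
      using inj by (blast dest: subsetD)
    then show ?thesis using that by simp
  qed
  show ?thesis unfolding semisimple_def
    by (rule exI[of _ "map ((`) (listing k)) ts"]) (use 1 2 3 in simp)
qed

text \<open>The coefficients of the generators become additional variables from \<open>k\<close> on,
  subject to linear equations and sign conditions, and are then projected away.\<close>

lemma presb_simple_set: assumes "simple_set k A" shows "presb {..<k} {x. listing k x \<in> A}"
proof -
  obtain q vs where q: "length q = k" "lin_indep k vs"
    "A = {vadd q (lincomb k cs vs) | cs. length cs = length vs \<and> (\<forall>c\<in>set cs. c \<ge> 0)}"
    using assms unfolding simple_set_def by blast
  let ?W = "{k..<k + length vs}" and ?U = "{..<k} \<union> {k..<k + length vs}"
  define P where "P x \<longleftrightarrow> (\<forall>i\<in>?W. 0 \<le> x i) \<and>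
    (\<forall>j\<in>{..<k}. x j = q ! j + (\<Sum>i<length vs. vs ! i ! j * x (k + i)))" for x
  have "presb ?U {x. \<forall>i\<in>?W. 0 \<le> x i}"
  proof (rule presb_ball)
    show "presb ?U {x. 0 \<le> x i}" if "i \<in> ?W" for i
      by (rule presb_le[OF aff_const aff_var]) (use that in auto)
  qed simp
  moreover have "presb ?U {x. \<forall>j\<in>{..<k}. x j = q ! j + (\<Sum>i<length vs. vs ! i ! j * x (k + i))}"
  proof (rule presb_ball)
    fix j assume j: "j \<in> {..<k}"
    have "aff ?U (\<lambda>x. \<Sum>i<length vs. vs ! i ! j * x (k + i))"
    proof (rule aff_sum)
      fix i assume "i \<in> {..<length vs}"
      then show "aff ?U (\<lambda>x. vs ! i ! j * x (k + i))" by (intro aff_scale aff_var) auto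
    qed
    moreover have "aff ?U (\<lambda>x. x j)" by (rule aff_var) (use j in auto)
    ultimately show "presb ?U {x. x j = q ! j + (\<Sum>i<length vs. vs ! i ! j * x (k + i))}"
      by (intro presb_eq aff_add aff_const)
  qed simp
  ultimately have "presb ?U {x. P x}" unfolding P_def by (rule presb_conj)
  then have "presb {..<k} {x. \<exists>y. override_on x y ?W \<in> {x. P x}}"
    by (intro presb_ex_many) auto
  moreover have "(\<exists>y. override_on x y ?W \<in> {x. P x}) \<longleftrightarrow> listing k x \<in> A" for x
  proof
    assume "\<exists>y. override_on x y ?W \<in> {x. P x}"
    then obtain y where y: "\<forall>i\<in>?W. 0 \<le> y i" "\<forall>j<k. x j = q ! j + (\<Sum>i<length vs. vs ! i ! j * y (k + i))"
      by (auto simp: P_def override_on_def)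
    define cs where "cs = map (\<lambda>i. y (k + i)) [0..<length vs]"
    have "listing k x = vadd q (lincomb k cs vs)"
      using y(2) q(1) by (intro nth_equalityI) (auto simp: vadd_def lincomb_def cs_def mult.commute)
    moreover have "length cs = length vs" "\<forall>c\<in>set cs. c \<ge> 0" using y(1) by (auto simp: cs_def)
    ultimately show "listing k x \<in> A" unfolding q(3) by blast
  next
    assume "listing k x \<in> A"
    then obtain cs where cs: "listing k x = vadd q (lincomb k cs vs)" "length cs = length vs" "\<forall>c\<in>set cs. c \<ge> 0"
      unfolding q(3) by blast
    have "x j = q ! j + (\<Sum>i<length vs. vs ! i ! j * cs ! i)" if "j < k" for j
      using arg_cong[OF cs(1), of "\<lambda>l. l ! j"] that q(1) by (simp add: vadd_def lincomb_def mult.commute)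
    then have "override_on x (\<lambda>i. cs ! (i - k)) ?W \<in> {x. P x}"
      using cs(2,3) by (auto simp: P_def override_on_def)
    then show "\<exists>y. override_on x y ?W \<in> {x. P x}" by blast
  qed
  ultimately show ?thesis by simp
qed

lemma presb_semisimple: assumes "semisimple k A" shows "presb {..<k} {x. listing k x \<in> A}"
proof -
  obtain Ss where Ss: "\<forall>S\<in>set Ss. simple_set k S" "A = \<Union>(set Ss)"
    using assms unfolding semisimple_def by blast
  have "presb {..<k} {x. \<exists>S\<in>set Ss. listing k x \<in> S}"
    by (rule presb_bex) (use Ss(1) presb_simple_set in auto)
  then show ?thesis by (simp add: Ss(2))
qed

section \<open>Polynomials and polyhedra in list coordinates\<close>

lemma finite_exponents: "finite {e :: nat list. length e = k \<and> sum_list e \<le> D}"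
proof (rule finite_subset)
  show "{e :: nat list. length e = k \<and> sum_list e \<le> D} \<subseteq> {e. set e \<subseteq> {..D} \<and> length e = k}"
    by (auto dest: member_le_sum_list)
  show "finite {e :: nat list. set e \<subseteq> {..D} \<and> length e = k}"
    by (rule finite_lists_length_eq) simp
qed

lemma poly_deg_le_pol: "pol {..<k} D p \<Longrightarrow> poly_deg_le k D (\<lambda>n. p ((!) n))"
proof (induction rule: pol.induct)
  case (pol_const D c)
  let ?E = "{e :: nat list. length e = k \<and> sum_list e \<le> D}"
  define C where "C e = (if e = replicate k 0 then c else 0)" for e :: "nat list"
  have "(\<Sum>e\<in>?E. C e * (\<Prod>i<k. (of_int (x ! i)) ^ (e ! i))) = c" for x :: "int list"
  proof -
    have "replicate k 0 \<in> ?E" by (simp add: sum_list_replicate)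
    then have "(\<Sum>e\<in>?E. C e * (\<Prod>i<k. (of_int (x ! i)) ^ (e ! i))) =
      C (replicate k 0) * (\<Prod>i<k. (of_int (x ! i)) ^ (replicate k 0 ! i)) +
      (\<Sum>e\<in>?E - {replicate k 0}. C e * (\<Prod>i<k. (of_int (x ! i)) ^ (e ! i)))"
      by (rule sum.remove[OF finite_exponents])
    also have "(\<Sum>e\<in>?E - {replicate k 0}. C e * (\<Prod>i<k. (of_int (x ! i)) ^ (e ! i))) = 0"
      by (rule sum.neutral) (simp add: C_def)
    also have "(\<Prod>i<k. (of_int (x ! i) :: rat) ^ (replicate k 0 ! i)) = 1"
      by (rule prod.neutral) simp
    finally show ?thesis by (simp add: C_def)
  qed
  then show ?case unfolding poly_deg_le_def by (intro exI[of _ C]) simp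
next
  case (pol_add D p q)
  let ?E = "{e :: nat list. length e = k \<and> sum_list e \<le> D}"
  let ?m = "\<lambda>(x :: int list) e. (\<Prod>i<k. (of_int (x ! i)) ^ (e ! i)) :: rat"
  obtain c c' where "\<forall>x. length x = k \<longrightarrow> p ((!) x) = (\<Sum>e\<in>?E. c e * ?m x e)"
    "\<forall>x. length x = k \<longrightarrow> q ((!) x) = (\<Sum>e\<in>?E. c' e * ?m x e)"
    using pol_add.IH unfolding poly_deg_le_def by blast
  then have "\<forall>x. length x = k \<longrightarrow> p ((!) x) + q ((!) x) = (\<Sum>e\<in>?E. (c e + c' e) * ?m x e)"
    by (simp add: distrib_right sum.distrib)
  then show ?case unfolding poly_deg_le_def by (rule exI[of _ "\<lambda>e. c e + c' e"])
next
  case (pol_var_mult D p i)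
  let ?E = "\<lambda>D. {e :: nat list. length e = k \<and> sum_list e \<le> D}"
  let ?m = "\<lambda>(x :: int list) e. (\<Prod>i<k. (of_int (x ! i)) ^ (e ! i)) :: rat"
  obtain c where c: "\<And>x. length x = k \<Longrightarrow> p ((!) x) = (\<Sum>e\<in>?E D. c e * ?m x e)"
    using pol_var_mult.IH unfolding poly_deg_le_def by blast
  have i: "i < k" using pol_var_mult(2) by simp
  \<comment> \<open>Multiplication by the \<open>i\<close>-th variable moves each coefficient to the
    exponent raised by one at \<open>i\<close>. Exponents with entry 0 there receive nothing and
    must be excluded, as \<open>e ! i - 1\<close> is truncated.\<close>
  define C where "C e = (if e ! i = 0 then 0 else c (e[i := e ! i - 1]))" for e :: "nat list"
  have up: "f[i := Suc (f ! i)] \<in> ?E (Suc D)" if "f \<in> ?E D" for f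
    using that i by (auto simp: sum_list_update)
  have mon: "?m x (f[i := Suc (f ! i)]) = of_int (x ! i) * ?m x f" if "length f = k" for x f
  proof -
    have "(\<Prod>j\<in>{..<k} - {i}. (of_int (x ! j) :: rat) ^ (f[i := Suc (f ! i)] ! j)) = (\<Prod>j\<in>{..<k} - {i}. of_int (x ! j) ^ (f ! j))"
      by (rule prod.cong) auto
    then show ?thesis
      using i that by (simp add: prod.remove[of "{..<k}" i "\<lambda>j. of_int (x ! j) ^ _ j"] mult.assoc)
  qed
  have "of_int (x ! i) * p ((!) x) = (\<Sum>e\<in>?E (Suc D). C e * ?m x e)" if x: "length x = k" for x
  proof -
    have "(\<Sum>e\<in>?E (Suc D). C e * ?m x e) = (\<Sum>e\<in>{e\<in>?E (Suc D). e ! i \<noteq> 0}. C e * ?m x e)"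
      by (rule sum.mono_neutral_right[OF finite_exponents]) (auto simp: C_def)
    also have "\<dots> = (\<Sum>f\<in>?E D. of_int (x ! i) * (c f * ?m x f))"
    proof (rule sum.reindex_bij_witness[of _ "\<lambda>f. f[i := Suc (f ! i)]" "\<lambda>e. e[i := e ! i - 1]"])
      fix e assume e: "e \<in> {e\<in>?E (Suc D). e ! i \<noteq> 0}"
      show "(e[i := e ! i - 1])[i := Suc (e[i := e ! i - 1] ! i)] = e" using e i by simp
      have "e ! i \<le> sum_list e" using e i by (intro member_le_sum_list) auto
      then show "e[i := e ! i - 1] \<in> ?E D" using e i by (auto simp: sum_list_update)
      have "?m x e = of_int (x ! i) * ?m x (e[i := e ! i - 1])"
        using mon[of "e[i := e ! i - 1]" x] e i by simp
      then show "of_int (x ! i) * (c (e[i := e ! i - 1]) * ?m x (e[i := e ! i - 1])) = C e * ?m x e"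
        using e by (simp add: C_def)
    next
      fix f assume f: "f \<in> ?E D"
      show "(f[i := Suc (f ! i)])[i := f[i := Suc (f ! i)] ! i - 1] = f" using f i by simp
      show "f[i := Suc (f ! i)] \<in> {e\<in>?E (Suc D). e ! i \<noteq> 0}" using up[OF f] f i by simp
    qed
    also have "\<dots> = of_int (x ! i) * p ((!) x)" by (simp add: c[OF x] sum_distrib_left)
    finally show ?thesis by simp
  qed
  then show ?case unfolding poly_deg_le_def by (intro exI[of _ C]) simp
next
  case (pol_Suc D p)
  let ?E = "\<lambda>D. {e :: nat list. length e = k \<and> sum_list e \<le> D}"
  let ?m = "\<lambda>(x :: int list) e. (\<Prod>i<k. (of_int (x ! i)) ^ (e ! i)) :: rat"
  obtain c where c: "\<And>x. length x = k \<Longrightarrow> p ((!) x) = (\<Sum>e\<in>?E D. c e * ?m x e)"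
    using pol_Suc.IH unfolding poly_deg_le_def by blast
  define C where "C e = (if sum_list e \<le> D then c e else 0)" for e :: "nat list"
  have "(\<Sum>e\<in>?E D. c e * ?m x e) = (\<Sum>e\<in>?E (Suc D). C e * ?m x e)" for x
    by (rule sum.mono_neutral_cong_left[OF finite_exponents]) (auto simp: C_def)
  then show ?case unfolding poly_deg_le_def using c by (intro exI[of _ C]) simp
qed

lemma scaled_basis:
  fixes M :: int and k :: nat
  assumes "M > 0"
  defines "bs \<equiv> map (\<lambda>i. map (\<lambda>j. if i = j then M else 0) [0..<k]) [0..<k]"
  shows "length bs = k" "lin_indep k bs"
    "\<And>cs. length cs = k \<Longrightarrow> lincomb k cs bs = map (\<lambda>j. cs ! j * M) [0..<k]"
proof -
  show len: "length bs = k" by (simp add: bs_def)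
  show lc: "lincomb k cs bs = map (\<lambda>j. cs ! j * M) [0..<k]" if "length cs = k" for cs
  proof (rule nth_equalityI)
    fix j assume "j < length (lincomb k cs bs)"
    then have j: "j < k" by (simp add: lincomb_def)
    have "(\<Sum>i<k. cs ! i * (bs ! i ! j)) = (\<Sum>i<k. if i = j then cs ! j * M else 0)"
      using j by (intro sum.cong) (auto simp: bs_def)
    then show "lincomb k cs bs ! j = map (\<lambda>j. cs ! j * M) [0..<k] ! j"
      using j by (simp add: lincomb_def len)
  qed (simp add: lincomb_def)
  show "lin_indep k bs"
    unfolding lin_indep_def
  proof (intro conjI allI impI)
    fix cs assume cs: "length cs = length bs" "lincomb k cs bs = replicate k 0"
    have "cs ! j = 0" if "j < k" for j
      using arg_cong[OF cs(2), of "\<lambda>l. l ! j"] that lc[of cs] cs(1) assms(1) by (simp add: len)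
    then show "\<forall>c\<in>set cs. c = 0" using cs(1) by (auto simp: len in_set_conv_nth)
  qed (auto simp: bs_def)
qed

lemma lin_list: "lin {..<k} a ((!) n) = (\<Sum>i<k. a i * n ! i)"
  by (simp add: lin_def)

text \<open>A class is cut out by a polyhedron and a coset: the set \<sigma> of those inequalities
  of \<open>L\<close> that hold determines the polyhedron, and the residue modulo \<open>M\<close>
  selects the polynomial on it.\<close>

lemma piecewise_qp_pqp:
  assumes "pqp {..<k} D F" "\<And>n. n \<in> T \<Longrightarrow> length n = k \<Longrightarrow> g n = F ((!) n)"
  shows "piecewise_qp_deg_le k D T g"
proof -
  let ?V = "{..<k}"
  obtain L M where LM: "finite L" "M > 0"
    "\<forall>x. \<exists>p. pol ?V D p \<and> (\<forall>y. eqv ?V L M x y \<longrightarrow> F y = p y)"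
    using assms(1) unfolding pqp_def by blast
  then obtain p where p: "\<And>x. pol ?V D (p x)" "\<And>x y. eqv ?V L M x y \<Longrightarrow> F y = p x y"
    by metis
  define sig where "sig x = {ab\<in>L. lin ?V (fst ab) x \<le> snd ab}" for x
  define near where "near \<sigma> m x \<longleftrightarrow> sig x = \<sigma> \<and> (\<forall>i<k. M dvd x i - m ! i)" for \<sigma> m x
  \<comment> \<open>The polynomial is taken from a chosen point with the given sign pattern and
    residue, and is 0 if there is none. Since \<open>near\<close> sees \<open>m\<close> only modulo
    \<open>M\<close>, it is constant on cosets.\<close>
  define Pf where "Pf \<sigma> m = (\<lambda>n. if Ex (near \<sigma> m) then p (SOME x. near \<sigma> m x) ((!) n) else 0)" for \<sigma> m and n :: "int list"
  \<comment> \<open>Polyhedra are closed, so a failing inequality is expressed over the integers by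
    its negative being at most \<open>- b - 1\<close>.\<close>
  define half where "half \<sigma> ab = (if ab \<in> \<sigma> then (map (\<lambda>i. of_int (fst ab i)) [0..<k], of_int (snd ab))
      else (map (\<lambda>i. of_int (- fst ab i)) [0..<k], of_int (- snd ab - 1)) :: rat list \<times> rat)" for \<sigma> ab
  obtain ls where ls: "set ls = L" using finite_list[OF LM(1)] by blast
  define H where "H \<sigma> = map (half \<sigma>) ls" for \<sigma>
  obtain sub where sub: "set sub = Pow L" using finite_list[of "Pow L"] LM(1) by auto
  have half: "(\<Sum>i<k. fst (half \<sigma> ab) ! i * of_int (n ! i)) \<le> snd (half \<sigma> ab) \<longleftrightarrow>
    (ab \<in> \<sigma> \<longleftrightarrow> lin ?V (fst ab) ((!) n) \<le> snd ab)" for \<sigma> ab n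
  proof (cases "ab \<in> \<sigma>")
    case True
    have "(\<Sum>i<k. fst (half \<sigma> ab) ! i * of_int (n ! i)) = (of_int (lin ?V (fst ab) ((!) n)) :: rat)"
      using True by (simp add: half_def lin_list)
    then show ?thesis using True by (simp add: half_def)
  next
    case False
    have "(\<Sum>i<k. fst (half \<sigma> ab) ! i * of_int (n ! i)) = (of_int (- lin ?V (fst ab) ((!) n)) :: rat)"
      using False by (simp add: half_def lin_list sum_negf)
    moreover have "snd (half \<sigma> ab) = of_int (- snd ab - 1)" using False by (simp add: half_def)
    moreover have "- lin ?V (fst ab) ((!) n) \<le> - snd ab - 1 \<longleftrightarrow> \<not> lin ?V (fst ab) ((!) n) \<le> snd ab" by linarith
    ultimately show ?thesis using False by (simp only: of_int_le_iff) simp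
  qed
  have pts: "polyhedron_pts k (H \<sigma>) = {n. length n = k \<and> sig ((!) n) = \<sigma>}" if "\<sigma> \<subseteq> L" for \<sigma>
  proof -
    have "(\<forall>(a, b)\<in>set (H \<sigma>). (\<Sum>i<k. a ! i * of_int (n ! i)) \<le> b) \<longleftrightarrow>
      (\<forall>ab\<in>L. ab \<in> \<sigma> \<longleftrightarrow> lin ?V (fst ab) ((!) n) \<le> snd ab)" for n
      unfolding H_def by (simp add: ls case_prod_beta half)
    also have "\<dots> n \<longleftrightarrow> sig ((!) n) = \<sigma>" for n
      unfolding sig_def using that by blast
    finally show ?thesis by (simp add: polyhedron_pts_def)
  qed
  define bs where "bs = map (\<lambda>i. map (\<lambda>j. if i = j then M else 0) [0..<k]) [0..<k]"
  note basis = scaled_basis[OF LM(2), where k = k, folded bs_def]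
  have "quasipoly_deg_le k D (\<lambda>n. Pf \<sigma> n n)" for \<sigma>
    unfolding quasipoly_deg_le_def
  proof (intro exI[of _ bs] exI[of _ "Pf \<sigma>"] conjI allI impI)
    show "poly_deg_le k D (Pf \<sigma> m)" for m
    proof (cases "Ex (near \<sigma> m)")
      case True
      then have "Pf \<sigma> m = (\<lambda>n. p (SOME x. near \<sigma> m x) ((!) n))" by (simp only: Pf_def if_True)
      then show ?thesis using poly_deg_le_pol[OF p(1)] by simp
    next
      case False
      then have "Pf \<sigma> m = (\<lambda>n. 0)" by (simp only: Pf_def if_False)
      then show ?thesis using poly_deg_le_pol[OF pol_const[of ?V D 0]] by simp
    qed
  next
    fix m cs :: "int list" assume mc: "length m = k" "length cs = k"
    have nth: "vadd m (lincomb k cs bs) ! i = m ! i + cs ! i * M" if "i < k" for i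
      using that mc by (simp add: basis(3) vadd_def)
    have "M dvd x i - vadd m (lincomb k cs bs) ! i \<longleftrightarrow> M dvd x i - m ! i" if "i < k" for x :: "nat \<Rightarrow> int" and i
    proof -
      have eq: "x i - vadd m (lincomb k cs bs) ! i = (x i - m ! i) - cs ! i * M"
        using nth[OF that] by simp
      show ?thesis unfolding eq by (rule dvd_diff_left_iff) simp
    qed
    then have "near \<sigma> (vadd m (lincomb k cs bs)) = near \<sigma> m"
      by (auto simp: near_def fun_eq_iff)
    then show "Pf \<sigma> (vadd m (lincomb k cs bs)) = Pf \<sigma> m" unfolding Pf_def by (simp only:)
  qed (use basis in auto)
  moreover have "g n = Pf \<sigma> n n" if "\<sigma> \<subseteq> L" "n \<in> T" "n \<in> polyhedron_pts k (H \<sigma>)" for \<sigma> n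
  proof -
    have n: "length n = k" "sig ((!) n) = \<sigma>" using that(3) pts[OF that(1)] by auto
    have ex: "near \<sigma> n ((!) n)" using n by (simp add: near_def)
    define x where "x = (SOME x. near \<sigma> n x)"
    have x: "near \<sigma> n x" unfolding x_def using someI[of "near \<sigma> n", OF ex] .
    have "sig x = sig ((!) n)" using x n by (simp add: near_def)
    then have "eqv ?V L M x ((!) n)"
      using x unfolding eqv_def near_def sig_def by (auto simp: set_eq_iff)
    then have "F ((!) n) = p x ((!) n)" by (rule p(2))
    moreover have "Pf \<sigma> n n = p x ((!) n)" unfolding Pf_def x_def using ex by auto
    ultimately show ?thesis using assms(2)[OF that(2) n(1)] by simp
  qed
  moreover have "lattice k = (\<Union>\<sigma>\<in>Pow L. polyhedron_pts k (H \<sigma>))"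
  proof -
    have "(\<Union>\<sigma>\<in>Pow L. polyhedron_pts k (H \<sigma>)) = (\<Union>\<sigma>\<in>Pow L. {n. length n = k \<and> sig ((!) n) = \<sigma>})"
      by (intro SUP_cong refl pts) simp
    also have "\<dots> = lattice k"
    proof (intro equalityI subsetI)
      fix n assume "n \<in> lattice k"
      moreover have "sig ((!) n) \<in> Pow L" by (auto simp: sig_def)
      ultimately show "n \<in> (\<Union>\<sigma>\<in>Pow L. {n. length n = k \<and> sig ((!) n) = \<sigma>})" by (auto simp: lattice_def)
    qed (auto simp: lattice_def)
    finally show ?thesis by simp
  qed
  moreover have "length a = k" if "(a, b) \<in> set (H \<sigma>)" for a b \<sigma>
    using that by (auto simp: H_def half_def split: if_splits)
  ultimately show ?thesis
    unfolding piecewise_qp_deg_le_def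
    by (intro exI[of _ "map (\<lambda>\<sigma>. (H \<sigma>, \<lambda>n. Pf \<sigma> n n)) sub"]) (auto simp: sub)
qed

lemma pqp_uminus: assumes "pqp V D F" shows "pqp V D (\<lambda>x. - F x)"
proof -
  obtain L M where LM: "finite L" "M > 0" "\<And>x. \<exists>p. pol V D p \<and> (\<forall>y. eqv V L M x y \<longrightarrow> F y = p y)"
    using assms unfolding pqp_def by blast
  have "\<exists>p. pol V D p \<and> (\<forall>y. eqv V L M x y \<longrightarrow> - F y = p y)" for x
  proof -
    obtain p where "pol V D p" "\<forall>y. eqv V L M x y \<longrightarrow> F y = p y" using LM(3) by blast
    then show ?thesis using pol_scale[of V D p "-1"] by (intro exI[of _ "\<lambda>x. - p x"]) simp
  qed
  then show ?thesis unfolding pqp_def using LM(1,2) by blast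
qed

text \<open>The function with graph \<open>\<Gamma>\<close> may be partial. Being defined is a
  property of the class, so extending by 0 keeps a single polynomial on each class.\<close>

lemma pqp_presb_function:
  assumes "finite V" "t \<notin> V" "presb (insert t V) \<Gamma>"
    "\<And>x b b'. x(t := b) \<in> \<Gamma> \<Longrightarrow> x(t := b') \<in> \<Gamma> \<Longrightarrow> b = b'"
  obtains G where "pqp V 1 G" "\<And>x b. x(t := b) \<in> \<Gamma> \<Longrightarrow> G x = of_int b"
proof -
  obtain L M where LM: "finite L" "M > 0" "\<And>x. \<exists>!b. x(t := b) \<in> \<Gamma> \<Longrightarrow>
      \<exists>h. pol V 1 h \<and> (\<forall>x'. eqv V L M x x' \<longrightarrow> (\<exists>b. of_int b = h x' \<and> x'(t := b) \<in> \<Gamma>))"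
    using function_affine_on_classes[OF assms(1-3)] by blast
  have aff: "\<exists>h. pol V 1 h \<and> (\<forall>x'. eqv V L M x x' \<longrightarrow> (\<exists>b. of_int b = h x' \<and> x'(t := b) \<in> \<Gamma>))"
    if "x(t := b) \<in> \<Gamma>" for x b
    using LM(3)[of x] that assms(4) by blast
  define G where "G x = (if \<exists>b. x(t := b) \<in> \<Gamma> then of_int (THE b. x(t := b) \<in> \<Gamma>) else (0::rat))" for x
  have G: "G x = of_int b" if "x(t := b) \<in> \<Gamma>" for x b
  proof -
    have "(THE b. x(t := b) \<in> \<Gamma>) = b" using that assms(4) by blast
    then show ?thesis using that by (auto simp: G_def)
  qed
  have "\<exists>p. pol V 1 p \<and> (\<forall>y. eqv V L M x y \<longrightarrow> G y = p y)" for x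
  proof (cases "\<exists>b. x(t := b) \<in> \<Gamma>")
    case True
    then obtain h where h: "pol V 1 h" "\<And>x'. eqv V L M x x' \<Longrightarrow> \<exists>b. of_int b = h x' \<and> x'(t := b) \<in> \<Gamma>"
      using aff by blast
    have "G y = h y" if "eqv V L M x y" for y
      using h(2)[OF that] G by force
    then show ?thesis using h(1) by blast
  next
    case False
    have "G y = 0" if E: "eqv V L M x y" for y
    proof -
      have "\<not> (\<exists>b. y(t := b) \<in> \<Gamma>)"
        using False aff eqv_sym[OF E] by blast
      then show ?thesis by (simp add: G_def)
    qed
    then show ?thesis using pol_const[of V 1 0] by (intro exI[of _ "\<lambda>x. 0"]) simp
  qed
  then have "pqp V 1 G" unfolding pqp_def using LM(1,2) by blast
  then show ?thesis using that G by blast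
qed

text \<open>\<open>dim\<close> is the cardinality of a basis, and \<open>card\<close> is 0 on
  infinite sets; the finite spanning set excludes a nonzero space of dimension 0.\<close>

lemma (in vector_space) dim_eq_0_iff_finite_span:
  assumes "subspace U" "finite B" "span B = U"
  shows "dim U = 0 \<longleftrightarrow> U = {0}"
proof
  assume "dim U = 0"
  obtain B' where B': "B' \<subseteq> U" "independent B'" "U \<subseteq> span B'" "card B' = dim U"
    using basis_exists by blast
  then have "finite B'" using independent_span_bound[OF assms(2)] assms(3) by blast
  then have "B' = {}" using B'(4) \<open>dim U = 0\<close> by simp
  then have "U \<subseteq> {0}" using B'(3) by simp
  then show "U = {0}" using subspace_0[OF assms(1)] by blast
next
  assume "U = {0}"
  have "dim {} = 0" using dim_eq_card_independent[OF independent_empty] by simp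
  then have "dim (span {}) = 0" by (simp only: dim_span)
  then show "dim U = 0" using \<open>U = {0}\<close> by simp
qed

section \<open>Numerically constructible families\<close>

lemma presb_max_form_graph:
  assumes "finite V" "finite W" "V \<inter> W = {}" "t \<notin> V \<union> W" "presb (V \<union> W) S"
  shows "presb (insert t V) {x. (\<exists>y. override_on x y W \<in> S \<and> lin W a y = x t) \<and>
    (\<forall>y. override_on x y W \<in> S \<longrightarrow> lin W a y \<le> x t)}"
proof -
  let ?U = "insert t V \<union> W"
  have S: "presb ?U {z. z \<in> S}" using presb_mono[OF assms(5), of ?U] assms(1,2) by auto
  have t: "aff ?U (\<lambda>z. z t)" using assms(1,2) by (intro aff_var) auto
  have l: "aff ?U (lin W a)" unfolding lin_def
  proof (rule aff_sum)
    fix i assume "i \<in> W"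
    then show "aff ?U (\<lambda>z. a i * z i)" using assms(1,2) by (intro aff_scale aff_var) auto
  qed
  have ov: "lin W a (override_on x y W) = lin W a y" "override_on x y W t = x t" for x y
    using assms(4) by (auto intro: lin_cong)
  have 1: "presb (insert t V) {x. \<exists>y. override_on x y W \<in> {z. z \<in> S \<and> lin W a z = z t}}"
    by (rule presb_ex_many[OF _ _ _ presb_conj[OF S presb_eq[OF l t]]]) (use assms in auto)
  have 2: "presb (insert t V) {x. \<forall>y. override_on x y W \<in> S \<longrightarrow> lin W a (override_on x y W) \<le> override_on x y W t}"
    by (rule presb_all_many[OF _ _ _ presb_imp[OF S presb_le[OF l t]]]) (use assms in auto)
  from presb_conj[OF 1 2] show ?thesis by (simp only: mem_Collect_eq ov)
qed

text \<open>A set of integer points is finite iff one number bounds the absolute values of all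
  coordinates. That number becomes an extra variable \<open>t\<close>, under an existential
  quantifier.\<close>

lemma presb_finite_fibre:
  assumes "finite V" "finite W" "V \<inter> W = {}" "presb (V \<union> W) S"
  shows "presb V {x. finite {y\<in>extensional W. override_on x y W \<in> S}}"
proof -
  obtain t where t: "t \<notin> V \<union> W" using ex_new_if_finite[of "V \<union> W"] assms(1,2) by auto
  let ?U = "insert t V \<union> W"
  have S: "presb ?U {z. z \<in> S}" using presb_mono[OF assms(4), of ?U] assms(1,2) by auto
  have at: "aff ?U (\<lambda>z. z t)" using assms(1,2) by (intro aff_var) auto
  have am: "aff ?U (\<lambda>z. - z t)" using aff_diff[OF aff_const at, of 0] by simp
  have bnd: "presb ?U {z. \<forall>i\<in>W. - z t \<le> z i \<and> z i \<le> z t}"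
  proof (rule presb_ball[OF assms(2)])
    fix i assume "i \<in> W"
    then have "aff ?U (\<lambda>z. z i)" using assms(1,2) by (intro aff_var) auto
    then show "presb ?U {z. - z t \<le> z i \<and> z i \<le> z t}"
      by (intro presb_conj presb_le at am)
  qed
  have "presb (insert t V) {x. \<forall>y. override_on x y W \<in> S \<longrightarrow>
      (\<forall>i\<in>W. - override_on x y W t \<le> override_on x y W i \<and> override_on x y W i \<le> override_on x y W t)}"
    by (rule presb_all_many[OF _ _ _ presb_imp[OF S bnd]]) (use assms t in auto)
  then have "presb V {x. \<exists>b. x(t := b) \<in> {x. \<forall>y. override_on x y W \<in> S \<longrightarrow>
      (\<forall>i\<in>W. - override_on x y W t \<le> override_on x y W i \<and> override_on x y W i \<le> override_on x y W t)}}"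
    using assms(1) t by (intro presb_ex) auto
  also have "{x. \<exists>b. x(t := b) \<in> {x. \<forall>y. override_on x y W \<in> S \<longrightarrow>
      (\<forall>i\<in>W. - override_on x y W t \<le> override_on x y W i \<and> override_on x y W i \<le> override_on x y W t)}} =
    {x. \<exists>b. \<forall>y. override_on x y W \<in> S \<longrightarrow> (\<forall>i\<in>W. - b \<le> y i \<and> y i \<le> b)}"
  proof -
    have *: "override_on (x(t := b)) y W \<in> S \<longleftrightarrow> override_on x y W \<in> S" for x b y
      by (rule presb_determined[OF assms(4)]) (use t in \<open>auto simp: override_on_def\<close>)
    show ?thesis using t by (simp add: *)
  qed
  also have "\<dots> = {x. finite {y\<in>extensional W. override_on x y W \<in> S}}"
  proof (intro equalityI subsetI CollectI; elim CollectE)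
    fix x assume "\<exists>b. \<forall>y. override_on x y W \<in> S \<longrightarrow> (\<forall>i\<in>W. - b \<le> y i \<and> y i \<le> b)"
    then obtain b where "\<forall>y. override_on x y W \<in> S \<longrightarrow> (\<forall>i\<in>W. - b \<le> y i \<and> y i \<le> b)" by blast
    then have "{y\<in>extensional W. override_on x y W \<in> S} \<subseteq> (\<Pi>\<^sub>E i\<in>W. {- b..b})" by (auto simp: PiE_def)
    then show "finite {y\<in>extensional W. override_on x y W \<in> S}"
      by (rule finite_subset) (use assms(2) in \<open>auto intro: finite_PiE\<close>)
  next
    fix x assume fin: "finite {y\<in>extensional W. override_on x y W \<in> S}" (is "finite ?Y")
    define A where "A = (\<lambda>(y, i). \<bar>y i\<bar>) ` (?Y \<times> W)"
    have "finite A" unfolding A_def using fin assms(2) by simp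
    then obtain b where b: "\<And>v. v \<in> A \<Longrightarrow> v \<le> b" using bdd_above_finite unfolding bdd_above_def by metis
    have "- b \<le> y i \<and> y i \<le> b" if "override_on x y W \<in> S" "i \<in> W" for y i
    proof -
      have "override_on x (restrict y W) W = override_on x y W" by (auto simp: override_on_def)
      then have "restrict y W \<in> ?Y" using that(1) by simp
      then have "\<bar>restrict y W i\<bar> \<in> A" unfolding A_def using that(2)
        by (intro image_eqI[of _ _ "(restrict y W, i)"]) simp_all
      then have "\<bar>restrict y W i\<bar> \<le> b" by (rule b)
      then show ?thesis using that(2) by (simp add: abs_le_iff)
    qed
    then show "\<exists>b. \<forall>y. override_on x y W \<in> S \<longrightarrow> (\<forall>i\<in>W. - b \<le> y i \<and> y i \<le> b)" by blast
  qed
  finally show ?thesis .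
qed

text \<open>Turns the boundedness in the definition of \<open>Top\<close> into the existence of a
  maximum, which a Presburger graph can express.\<close>

lemma int_bdd_above_has_max:
  fixes X :: "int set"
  assumes "X \<noteq> {}" "bdd_above X"
  obtains m where "m \<in> X" "\<And>x. x \<in> X \<Longrightarrow> x \<le> m"
proof -
  obtain x0 where x0: "x0 \<in> X" using assms(1) by blast
  obtain b where b: "\<And>x. x \<in> X \<Longrightarrow> x \<le> b" using assms(2) unfolding bdd_above_def by blast
  have fin: "finite (X \<inter> {x0..b})" by simp
  have "x0 \<in> X \<inter> {x0..b}" using x0 b by simp
  then have "Max (X \<inter> {x0..b}) \<in> X \<inter> {x0..b}" using Max_in[OF fin] by blast
  moreover have "x \<le> Max (X \<inter> {x0..b})" if "x \<in> X" for x
  proof (cases "x \<ge> x0")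
    case True
    then show ?thesis using that b by (intro Max_ge[OF fin]) simp
  next
    case False
    have "x0 \<le> Max (X \<inter> {x0..b})" using x0 b by (intro Max_ge[OF fin]) simp
    then show ?thesis using False by simp
  qed
  ultimately show ?thesis using that by blast
qed

text \<open>The first \<open>k\<close> coordinates are the parameter n and the next \<open>d\<close>
  coordinates are the degree q.\<close>

abbreviation support_set :: "nat \<Rightarrow> nat \<Rightarrow> (int list \<Rightarrow> int list \<Rightarrow> 'v::zero set) \<Rightarrow> (nat \<Rightarrow> int) set" where
  "support_set k d V \<equiv> {x. V (listing k x) (map x [k..<k + d]) \<noteq> {0}}"

lemma listing_override_on: "listing k (override_on x y {k..<k + d}) = listing k x"
  and tail_override_on: "map (override_on x y {k..<k + d}) [k..<k + d] = map y [k..<k + d]"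
  by (auto simp: override_on_def)

lemma override_on_support_set:
  "override_on x y {k..<k + d} \<in> support_set k d V \<longleftrightarrow> map y [k..<k + d] \<in> supp d V (listing k x)"
  by (simp only: mem_Collect_eq listing_override_on tail_override_on supp_def) simp

lemma tail_surj:
  assumes "length q = d"
  obtains y where "y \<in> extensional {k..<k + d}" "map y [k..<k + d] = q"
proof (rule that[of "restrict (\<lambda>i. q ! (i - k)) {k..<k + d}"])
  show "map (restrict (\<lambda>i. q ! (i - k)) {k..<k + d}) [k..<k + d] = q"
    using assms by (intro nth_equalityI) auto
qed simp

lemma bij_betw_fibre_supp:
  "bij_betw (\<lambda>y. map y [k..<k + d]) {y\<in>extensional {k..<k + d}. override_on x y {k..<k + d} \<in> support_set k d V}
    (supp d V (listing k x))"
  unfolding override_on_support_set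
proof (rule bij_betw_imageI)
  show "inj_on (\<lambda>y. map y [k..<k + d]) {y\<in>extensional {k..<k + d}. map y [k..<k + d] \<in> supp d V (listing k x)}"
  proof (rule inj_onI)
    fix y y' :: "nat \<Rightarrow> int"
    assume "y \<in> {y\<in>extensional {k..<k + d}. map y [k..<k + d] \<in> supp d V (listing k x)}"
      "y' \<in> {y\<in>extensional {k..<k + d}. map y [k..<k + d] \<in> supp d V (listing k x)}"
      "map y [k..<k + d] = map y' [k..<k + d]"
    then show "y = y'" by (intro extensionalityI[of _ "{k..<k + d}"]) auto
  qed
  show "(\<lambda>y. map y [k..<k + d]) ` {y\<in>extensional {k..<k + d}. map y [k..<k + d] \<in> supp d V (listing k x)} = supp d V (listing k x)"
  proof (intro equalityI subsetI)
    fix q assume q: "q \<in> supp d V (listing k x)"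
    then have "length q = d" by (simp add: supp_def)
    then obtain y where "y \<in> extensional {k..<k + d}" "map y [k..<k + d] = q" by (rule tail_surj)
    then show "q \<in> (\<lambda>y. map y [k..<k + d]) ` {y\<in>extensional {k..<k + d}. map y [k..<k + d] \<in> supp d V (listing k x)}"
      using q by blast
  qed blast
qed

lemma pairing_tail: "length lam = d \<Longrightarrow> pairing lam (map y [k..<k + d]) = lin {k..<k + d} (\<lambda>j. lam ! (j - k)) y"
  unfolding pairing_def lin_def
  by (rule sum.reindex_bij_witness[of _ "\<lambda>j. j - k" "\<lambda>i. k + i"]) auto

lemma fibre_sets: "{..<k} \<union> {k..<k + d} = {..<k + d}" "{..<k} \<inter> {k..<k + d} = {}"
  for k d :: nat
  by auto

lemma semisimple_finite_length_set:
  assumes "presb {..<k + d} (support_set k d V)"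
  shows "semisimple k (finite_length_set k d V)"
proof -
  let ?W = "{k..<k + d}"
  have "presb {..<k} {x. finite {y\<in>extensional ?W. override_on x y ?W \<in> support_set k d V}}"
    by (rule presb_finite_fibre) (use assms fibre_sets in auto)
  moreover have "finite {y\<in>extensional ?W. override_on x y ?W \<in> support_set k d V} \<longleftrightarrow> finite (supp d V (listing k x))" for x
    by (rule bij_betw_finite[OF bij_betw_fibre_supp])
  ultimately have "presb {..<k} {x. finite (supp d V (listing k x))}" by simp
  then have "semisimple k {n. length n = k \<and> (!) n \<in> {x. finite (supp d V (listing k x))}}"
    by (rule semisimple_presb)
  moreover have "{n. length n = k \<and> (!) n \<in> {x. finite (supp d V (listing k x))}} = finite_length_set k d V"
    by (auto simp: finite_length_set_def listing_nth)
  ultimately show ?thesis by simp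
qed

lemma Top_max_fun:
  assumes "presb {..<k + d} (support_set k d V)" "length lam = d"
  shows "semisimple k (Top k d lam V)"
    "\<exists>G. pqp {..<k} 1 G \<and> (\<forall>n\<in>Top k d lam V. of_int (max_fun d lam V n) = G ((!) n))"
proof -
  let ?W = "{k..<k + d}" and ?a = "\<lambda>j. lam ! (j - k)" and ?t = "k + d"
  define X where "X n = pairing lam ` supp d V n" for n
  have X: "r \<in> X (listing k x) \<longleftrightarrow> (\<exists>y. override_on x y ?W \<in> support_set k d V \<and> lin ?W ?a y = r)" for r x
  proof
    assume "r \<in> X (listing k x)"
    then obtain q where q: "q \<in> supp d V (listing k x)" "r = pairing lam q" by (auto simp: X_def)
    then have "length q = d" by (simp add: supp_def)
    then obtain y where "map y [k..<k + d] = q" by (rule tail_surj)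
    then show "\<exists>y. override_on x y ?W \<in> support_set k d V \<and> lin ?W ?a y = r"
      using q unfolding override_on_support_set pairing_tail[OF assms(2), symmetric] by blast
  next
    assume "\<exists>y. override_on x y ?W \<in> support_set k d V \<and> lin ?W ?a y = r"
    then show "r \<in> X (listing k x)"
      unfolding override_on_support_set pairing_tail[OF assms(2), symmetric] X_def by blast
  qed
  \<comment> \<open>The graph of the maximum, with its value in the coordinate \<open>k + d\<close>.
    Its projection is \<open>Top\<close>, and its single-valuedness yields the function of degree
    one.\<close>
  define \<Gamma> where "\<Gamma> = {x. (\<exists>y. override_on x y ?W \<in> support_set k d V \<and> lin ?W ?a y = x ?t) \<and>
    (\<forall>y. override_on x y ?W \<in> support_set k d V \<longrightarrow> lin ?W ?a y \<le> x ?t)}"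
  have P\<Gamma>: "presb (insert ?t {..<k}) \<Gamma>"
    unfolding \<Gamma>_def by (rule presb_max_form_graph) (use assms fibre_sets in auto)
  have in\<Gamma>: "x(?t := b) \<in> \<Gamma> \<longleftrightarrow> b \<in> X (listing k x) \<and> (\<forall>r\<in>X (listing k x). r \<le> b)" for x b
  proof -
    have l: "listing k (x(?t := b)) = listing k x" by simp
    have "x(?t := b) \<in> \<Gamma> \<longleftrightarrow> b \<in> X (listing k (x(?t := b))) \<and> (\<forall>r\<in>X (listing k (x(?t := b))). r \<le> b)"
      unfolding \<Gamma>_def mem_Collect_eq fun_upd_same Ball_def X by blast
    then show ?thesis unfolding l .
  qed
  have ex: "(\<exists>b. ((!) n)(?t := b) \<in> \<Gamma>) \<longleftrightarrow> n \<in> Top k d lam V" if n: "length n = k" for n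
  proof -
    have "(\<exists>b. ((!) n)(?t := b) \<in> \<Gamma>) \<longleftrightarrow> (\<exists>b. b \<in> X n \<and> (\<forall>r\<in>X n. r \<le> b))"
      unfolding in\<Gamma> listing_nth[OF n] ..
    also have "\<dots> \<longleftrightarrow> X n \<noteq> {} \<and> bdd_above (X n)"
    proof
      assume "X n \<noteq> {} \<and> bdd_above (X n)"
      then show "\<exists>b. b \<in> X n \<and> (\<forall>r\<in>X n. r \<le> b)"
        by (metis int_bdd_above_has_max)
    qed (auto simp: bdd_above_def)
    finally show ?thesis using n by (simp add: Top_def X_def)
  qed
  have "presb {..<k} {x. \<exists>b. x(?t := b) \<in> \<Gamma>}"
    by (rule presb_ex[OF _ _ P\<Gamma>]) auto
  then have "semisimple k {n. length n = k \<and> (!) n \<in> {x. \<exists>b. x(?t := b) \<in> \<Gamma>}}"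
    by (rule semisimple_presb)
  moreover have "{n. length n = k \<and> (!) n \<in> {x. \<exists>b. x(?t := b) \<in> \<Gamma>}} = Top k d lam V"
  proof -
    have "length n = k" if "n \<in> Top k d lam V" for n using that by (simp add: Top_def)
    then show ?thesis using ex by blast
  qed
  ultimately show "semisimple k (Top k d lam V)" by simp
  obtain G where G: "pqp {..<k} 1 G" "\<And>x b. x(?t := b) \<in> \<Gamma> \<Longrightarrow> G x = of_int b"
  proof (rule pqp_presb_function[OF _ _ P\<Gamma>])
    fix x b b' assume "x(?t := b) \<in> \<Gamma>" "x(?t := b') \<in> \<Gamma>"
    then show "b = b'" unfolding in\<Gamma> by (blast intro: antisym)
  qed (use that in auto)
  have "of_int (max_fun d lam V n) = G ((!) n)" if T: "n \<in> Top k d lam V" for n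
  proof -
    have n: "length n = k" using T by (simp add: Top_def)
    then obtain b where b: "((!) n)(?t := b) \<in> \<Gamma>" using ex T by blast
    then have "b \<in> X n" "\<And>r. r \<in> X n \<Longrightarrow> r \<le> b" unfolding in\<Gamma> listing_nth[OF n] by blast+
    then have "Sup (X n) = b" by (rule cSup_eq_maximum)
    then show ?thesis using G(2)[OF b] by (simp add: max_fun_def X_def)
  qed
  then show "\<exists>G. pqp {..<k} 1 G \<and> (\<forall>n\<in>Top k d lam V. of_int (max_fun d lam V n) = G ((!) n))"
    using G(1) by blast
qed

lemma pairing_uminus: "length lam = length q \<Longrightarrow> pairing (map uminus lam) q = - pairing lam q"
  by (simp add: pairing_def sum_negf)

text \<open>Negating the linear form reverses the order of its values, so minima need no elimination
  of their own.\<close>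

lemma soc_min_fun_uminus:
  assumes "length lam = d"
  shows "soc k d lam V = Top k d (map uminus lam) V" "min_fun d lam V n = - max_fun d (map uminus lam) V n"
proof -
  have *: "pairing (map uminus lam) ` supp d V n = uminus ` pairing lam ` supp d V n" for n
    unfolding image_image by (rule image_cong) (auto simp: supp_def assms intro!: pairing_uminus)
  show "soc k d lam V = Top k d (map uminus lam) V"
    unfolding soc_def Top_def * by (simp add: bdd_above_uminus)
  show "min_fun d lam V n = - max_fun d (map uminus lam) V n"
    unfolding min_fun_def max_fun_def * by (simp add: Inf_int_def)
qed

lemma glength_pqp:
  assumes "presb {..<k + d} (support_set k d V)"
    and "pqp {..<k + d} 0 (\<lambda>x. of_nat (vector_space.dim scale (V (listing k x) (map x [k..<k + d]))))"
  shows "\<exists>G. pqp {..<k} d G \<and> (\<forall>n\<in>finite_length_set k d V. of_nat (glength scale d V n) = G ((!) n))"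
proof -
  let ?W = "{k..<k + d}" and ?F = "\<lambda>x. of_nat (vector_space.dim scale (V (listing k x) (map x [k..<k + d]))) :: rat"
  let ?Y = "\<lambda>x. {y\<in>extensional ?W. override_on x y ?W \<in> support_set k d V}"
  have "\<exists>G. pqp {..<k} (0 + card ?W) G \<and> (\<forall>x. finite (?Y x) \<longrightarrow> G x = (\<Sum>y\<in>?Y x. ?F (override_on x y ?W)))"
    by (rule pqp_fibre_sum_many) (use assms in \<open>simp_all only: fibre_sets finite_atLeastLessThan finite_lessThan\<close>)
  then obtain G where G: "pqp {..<k} d G" "\<And>x. finite (?Y x) \<Longrightarrow> G x = (\<Sum>y\<in>?Y x. ?F (override_on x y ?W))"
    by auto
  have "of_nat (glength scale d V n) = G ((!) n)" if T: "n \<in> finite_length_set k d V" for n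
  proof -
    have n: "length n = k" "finite (supp d V n)" using T by (auto simp: finite_length_set_def)
    have bij: "bij_betw (\<lambda>y. map y [k..<k + d]) (?Y ((!) n)) (supp d V n)"
      using bij_betw_fibre_supp[of k d "(!) n" V] unfolding listing_nth[OF n(1)] .
    have "finite (?Y ((!) n))" using bij_betw_finite[OF bij] n(2) by blast
    then have "G ((!) n) = (\<Sum>y\<in>?Y ((!) n). ?F (override_on ((!) n) y ?W))" by (rule G(2))
    also have "\<dots> = (\<Sum>y\<in>?Y ((!) n). of_nat (vector_space.dim scale (V n (map y [k..<k + d]))))"
      unfolding listing_override_on tail_override_on listing_nth[OF n(1)] ..
    also have "\<dots> = (\<Sum>q\<in>supp d V n. of_nat (vector_space.dim scale (V n q)))"
      by (rule sum.reindex_bij_betw[OF bij])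
    finally show ?thesis by (simp add: glength_def)
  qed
  then show ?thesis using G(1) by blast
qed

text \<open>Finitely many pieces admit a common refinement into classes, and the dimension is
  constant on each class. This gives degree 0, and the support is Presburger because it is where the
  dimension is nonzero.\<close>

lemma numerically_constructible_presb:
  assumes "graded_family scale k d V" "numerically_constructible scale k d V"
  shows "presb {..<k + d} (support_set k d V)"
    "pqp {..<k + d} 0 (\<lambda>x. of_nat (vector_space.dim scale (V (listing k x) (map x [k..<k + d]))))"
proof -
  interpret vector_space scale using assms(1) by (simp add: graded_family_def)
  let ?U = "{..<k + d}" and ?hd = "listing k" and ?tl = "\<lambda>x. map x [k..<k + d]"
  obtain Ps where Ps: "\<forall>P\<in>set Ps. semisimple (k + d) P" "\<Union>(set Ps) = lattice (k + d)"
    "\<forall>P\<in>set Ps. \<forall>n q n' q'. length n = k \<longrightarrow> length q = d \<longrightarrow> length n' = k \<longrightarrow> length q' = d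
      \<longrightarrow> n @ q \<in> P \<longrightarrow> n' @ q' \<in> P \<longrightarrow> dim (V n q) = dim (V n' q')"
    using assms(2) unfolding numerically_constructible_def by blast
  let ?\<S> = "(\<lambda>P. {x. listing (k + d) x \<in> P}) ` set Ps"
  have "presb ?U S" if "S \<in> ?\<S>" for S using that Ps(1) presb_semisimple by auto
  then obtain L M where LM: "finite L" "M > 0"
    "\<And>S x y. S \<in> ?\<S> \<Longrightarrow> eqv ?U L M x y \<Longrightarrow> x \<in> S \<longleftrightarrow> y \<in> S"
    using presb_common[of ?\<S> ?U "{}" 1 thesis] by auto
  have split: "listing (k + d) x = ?hd x @ ?tl x" for x :: "nat \<Rightarrow> int"
    by (simp add: upt_add_eq_append[of 0 k d] del: upt_add_eq_append)
  have dim_eq: "dim (V (?hd x) (?tl x)) = dim (V (?hd y) (?tl y))" if E: "eqv ?U L M x y" for x y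
  proof -
    have "listing (k + d) x \<in> lattice (k + d)" by (simp add: lattice_def)
    then obtain P where P: "P \<in> set Ps" "listing (k + d) x \<in> P" using Ps(2) by blast
    then have "listing (k + d) y \<in> P" using LM(3)[OF imageI[OF P(1)] E] by simp
    then show ?thesis using Ps(3) P unfolding split by (metis length_map length_upt diff_zero add_diff_cancel_left')
  qed
  have zero: "V n q = {0} \<longleftrightarrow> dim (V n q) = 0" if nq: "length n = k" "length q = d" for n q
  proof -
    have "subspace (V n q)" using assms(1) nq by (simp add: graded_family_def)
    moreover have "\<forall>n q. length n = k \<longrightarrow> length q = d \<longrightarrow> (\<exists>B. finite B \<and> span B = V n q)"
      using assms(2) unfolding numerically_constructible_def by (rule conjunct1)
    then obtain B where "finite B" "span B = V n q" using nq by blast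
    ultimately show ?thesis using dim_eq_0_iff_finite_span[of "V n q" B] by simp
  qed
  have "x \<in> support_set k d V \<longleftrightarrow> y \<in> support_set k d V" if "eqv ?U L M x y" for x y
    using dim_eq[OF that] by (simp add: zero)
  then show "presb ?U (support_set k d V)" unfolding presb_def using LM(1,2) by blast
  have "\<exists>p. pol ?U 0 p \<and> (\<forall>y. eqv ?U L M x y \<longrightarrow> of_nat (dim (V (?hd y) (?tl y))) = p y)" for x
    using dim_eq by (intro exI[of _ "\<lambda>_. of_nat (dim (V (?hd x) (?tl x)))"]) (simp add: pol_const)
  then show "pqp ?U 0 (\<lambda>x. of_nat (dim (V (?hd x) (?tl x))))" unfolding pqp_def using LM(1,2) by blast
qed

theorem theorem3p11:
  fixes scale :: "'k::field \<Rightarrow> 'v::ab_group_add \<Rightarrow> 'v"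
    and k d :: nat
    and V :: "int list \<Rightarrow> int list \<Rightarrow> 'v set"
  assumes "graded_family scale k d V"
    and "numerically_constructible scale k d V"
  shows "semisimple k (finite_length_set k d V) \<and>
         piecewise_qp_deg_le k d (finite_length_set k d V) (\<lambda>n. of_nat (glength scale d V n)) \<and>
         (\<forall>lam. length lam = d \<longrightarrow>
         semisimple k (Top k d lam V) \<and> semisimple k (soc k d lam V) \<and>
         piecewise_quasilinear k (Top k d lam V) (\<lambda>n. of_int (max_fun d lam V n)) \<and>
         piecewise_quasilinear k (soc k d lam V) (\<lambda>n. of_int (min_fun d lam V n)))"
proof (intro conjI allI impI)
  note S = numerically_constructible_presb[OF assms]
  show "semisimple k (finite_length_set k d V)" by (rule semisimple_finite_length_set[OF S(1)])
  obtain G where "pqp {..<k} d G" "\<forall>n\<in>finite_length_set k d V. of_nat (glength scale d V n) = G ((!) n)"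
    using glength_pqp[OF S] by blast
  then show "piecewise_qp_deg_le k d (finite_length_set k d V) (\<lambda>n. of_nat (glength scale d V n))"
    by (intro piecewise_qp_pqp) auto
  fix lam :: "int list" assume lam: "length lam = d"
  show "semisimple k (Top k d lam V)" by (rule Top_max_fun(1)[OF S(1) lam])
  obtain G1 where "pqp {..<k} 1 G1" "\<forall>n\<in>Top k d lam V. of_int (max_fun d lam V n) = G1 ((!) n)"
    using Top_max_fun(2)[OF S(1) lam] by blast
  then show "piecewise_quasilinear k (Top k d lam V) (\<lambda>n. of_int (max_fun d lam V n))"
    by (intro piecewise_qp_pqp) auto
  have lam': "length (map uminus lam) = d" using lam by simp
  show "semisimple k (soc k d lam V)"
    unfolding soc_min_fun_uminus[OF lam] by (rule Top_max_fun(1)[OF S(1) lam'])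
  obtain G2 where G2: "pqp {..<k} 1 G2"
    "\<forall>n\<in>Top k d (map uminus lam) V. of_int (max_fun d (map uminus lam) V n) = G2 ((!) n)"
    using Top_max_fun(2)[OF S(1) lam'] by blast
  show "piecewise_quasilinear k (soc k d lam V) (\<lambda>n. of_int (min_fun d lam V n))"
    unfolding soc_min_fun_uminus[OF lam] by (rule piecewise_qp_pqp[OF pqp_uminus[OF G2(1)]]) (simp add: G2(2))
qed

end
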